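(* Let $p$ be a prime. The limit $$\lim_{n\to\infty}\mathbb{E}\left[Z^{\mathrm{poly}}_{\overline{\mathbb{Q}}_p\setminus\mathbb{Q}_p^{\mathrm{un}},n}\right]$$ exists. Moreover, this limit is positive and no larger than $\frac{4p-3}{(p-1)^2}$.
   Context: $\overline{\mathbb{Q}}_p$ is a fixed algebraic closure of $\mathbb{Q}_p$, and $\mathbb{Q}_p^{\mathrm{un}}\subset\overline{\mathbb{Q}}_p$ is the maximal unramified extension of $\mathbb{Q}_p$. $\Omega_n(\mathbb{Z}_p)=\{a_nx^n+\cdots+a_1x+a_0: a_0,\dots,a_n\in\mathbb{Z}_p\}$ is the space of polynomials over $\mathbb{Z}_p$ of degree at most $n$, regarded as a probability space by taking $a_0,\dots,a_n$ independent and distributed according to the additive Haar probability measure on $\mathbb{Z}_p$. For $U\subset\overline{\mathbb{Q}}_p$ and $P\in\Omega_n(\mathbb{Z}_p)$, $Z^{\mathrm{poly}}_{U,n}=Z^{\mathrm{poly}}_{U,n}(P)$ is the number of roots of $P$ lying in $U$, counted with multiplicity; $\mathbb{E}$ is expectation over this random $P$. *)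

theory Defs
  imports
    "HOL-Probability.Probability"
    "HOL-Algebra.Algebraic_Closure_Type"
    "HOL-Algebra.Embedded_Algebras"
    "HOL-Algebra.Ideal"
    "Berlekamp_Zassenhaus.Finite_Field"
begin

section \<open>The ring of $p$-adic integers\<close>

text \<open>
  The prime $p$ is carried by the type: \<open>p = CARD('p)\<close> for \<open>'p\<close> of class
  \<open>prime_card\<close>. The ring $\mathbb{Z}_p$ is the inverse limit of the rings
  $\mathbb{Z}/p^n\mathbb{Z}$, whose elements are represented by their residues in
  $\{0,\dots,p^n-1\}$.
\<close>

typedef (overloaded) ('p :: prime_card) padic_int =
  "{x :: nat \<Rightarrow> int. \<forall>n. x n \<in> {0..<int CARD('p) ^ n} \<and> x (Suc n) mod int CARD('p) ^ n = x n}"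
  morphisms residue Abs_padic_int
  by (rule exI[of _ "\<lambda>_. 0"]) (simp add: prime_gt_0_nat[OF prime_card])

setup_lifting type_definition_padic_int

lemma residue_bounds:
  fixes x :: "'p :: prime_card padic_int"
  shows "0 \<le> residue x n" "residue x n < int CARD('p) ^ n"
  using residue[of x] by auto

lemma residue_mod [simp]:
  fixes x :: "'p :: prime_card padic_int"
  shows "residue x n mod int CARD('p) ^ n = residue x n"
  using residue_bounds[of x n] by simp

lemma residue_Suc:
  fixes x :: "'p :: prime_card padic_int"
  shows "residue x (Suc n) mod int CARD('p) ^ n = residue x n"
  using residue[of x] by auto

lemma residue_mod_le:
  fixes x :: "'p :: prime_card padic_int"
  assumes "m \<le> n"
  shows "residue x n mod int CARD('p) ^ m = residue x m"
  using assms
proof (induction n rule: dec_induct)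
  case (step n)
  have "residue x (Suc n) mod int CARD('p) ^ m
        = residue x (Suc n) mod int CARD('p) ^ n mod int CARD('p) ^ m"
    using step.hyps by (simp add: mod_mod_cancel le_imp_power_dvd)
  with step show ?case by (simp add: residue_Suc)
qed simp

lemma padic_card_gt_1: "int CARD('p :: prime_card) > 1"
  using prime_gt_1_nat[OF prime_card[where 'a = 'p]] by simp

lemma mod_padic_intI:
  fixes f :: "nat \<Rightarrow> int"
  assumes "\<And>n. f (Suc n) mod int CARD('p :: prime_card) ^ n = f n mod int CARD('p) ^ n"
  shows "f n mod int CARD('p) ^ n \<in> {0..<int CARD('p) ^ n} \<and>
           f (Suc n) mod int CARD('p) ^ Suc n mod int CARD('p) ^ n = f n mod int CARD('p) ^ n"
  using assms padic_card_gt_1[where 'p = 'p] by (simp add: mod_mod_cancel le_imp_power_dvd)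

instantiation padic_int :: (prime_card) comm_ring_1
begin

lift_definition zero_padic_int :: "'a padic_int" is "\<lambda>_. 0"
  by (simp add: prime_gt_0_nat[OF prime_card])

lift_definition one_padic_int :: "'a padic_int" is "\<lambda>n. 1 mod int CARD('a) ^ n"
  by (rule mod_padic_intI) simp

lift_definition plus_padic_int :: "'a padic_int \<Rightarrow> 'a padic_int \<Rightarrow> 'a padic_int"
  is "\<lambda>x y n. (x n + y n) mod int CARD('a) ^ n"
  by (rule mod_padic_intI) (metis mod_add_eq mod_mod_trivial)

lift_definition minus_padic_int :: "'a padic_int \<Rightarrow> 'a padic_int \<Rightarrow> 'a padic_int"
  is "\<lambda>x y n. (x n - y n) mod int CARD('a) ^ n"
  by (rule mod_padic_intI) (metis mod_diff_eq mod_mod_trivial)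

lift_definition uminus_padic_int :: "'a padic_int \<Rightarrow> 'a padic_int"
  is "\<lambda>x n. (- x n) mod int CARD('a) ^ n"
  by (rule mod_padic_intI) (metis mod_minus_eq mod_mod_trivial)

lift_definition times_padic_int :: "'a padic_int \<Rightarrow> 'a padic_int \<Rightarrow> 'a padic_int"
  is "\<lambda>x y n. (x n * y n) mod int CARD('a) ^ n"
  by (rule mod_padic_intI) (metis mod_mult_eq mod_mod_trivial)

instance
proof
  fix a b c :: "'a padic_int"
  show "a * b * c = a * (b * c)"
    by transfer (simp add: fun_eq_iff mod_simps mult.assoc)
  show "a * b = b * a"
    by transfer (simp add: fun_eq_iff mult.commute)
  show "1 * a = a"
    by transfer (simp add: fun_eq_iff mod_simps)
  show "a + b + c = a + (b + c)"
    by transfer (simp add: fun_eq_iff mod_simps add.assoc)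
  show "a + b = b + a"
    by transfer (simp add: fun_eq_iff add.commute)
  show "0 + a = a"
    by transfer (simp add: fun_eq_iff)
  show "- a + a = 0"
    by transfer (simp add: fun_eq_iff mod_simps)
  show "a - b = a + - b"
    by transfer (simp add: fun_eq_iff mod_simps)
  show "(a + b) * c = a * c + b * c"
    by transfer (simp add: fun_eq_iff mod_simps distrib_right)
  show "(0 :: 'a padic_int) \<noteq> 1"
  proof
    assume "(0 :: 'a padic_int) = 1"
    hence "residue (0 :: 'a padic_int) 1 = residue (1 :: 'a padic_int) 1" by simp
    thus False
      using padic_card_gt_1[where 'p = 'a] by (simp add: zero_padic_int.rep_eq one_padic_int.rep_eq)
  qed
qed

end

instance padic_int :: (prime_card) idom
proof
  fix a b :: "'a padic_int"
  assume "a \<noteq> 0" "b \<noteq> 0"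
  let ?p = "int CARD('a)"
  have p: "prime_elem ?p" using prime_card_int[where 'a = 'a] by (rule prime_imp_prime_elem)
  have ex: "\<exists>n. residue c n \<noteq> 0" if "c \<noteq> 0" for c :: "'a padic_int"
    using that by (auto simp flip: residue_inject simp: zero_padic_int.rep_eq)
  obtain m where m: "residue a m \<noteq> 0" using ex[OF \<open>a \<noteq> 0\<close>] ..
  obtain n where n: "residue b n \<noteq> 0" using ex[OF \<open>b \<noteq> 0\<close>] ..
  define N where "N = m + n"
  have a: "\<not> ?p ^ m dvd residue a N"
    using residue_mod_le[of m N a] m by (auto simp: N_def dvd_eq_mod_eq_0)
  have b: "\<not> ?p ^ n dvd residue b N"
    using residue_mod_le[of n N b] n by (auto simp: N_def dvd_eq_mod_eq_0)
  have nz: "residue a N \<noteq> 0" "residue b N \<noteq> 0" using a b by auto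
  have "\<not> ?p ^ N dvd residue a N * residue b N"
  proof
    assume "?p ^ N dvd residue a N * residue b N"
    hence "N \<le> multiplicity ?p (residue a N * residue b N)"
      using nz p by (intro multiplicity_geI) auto
    also have "\<dots> = multiplicity ?p (residue a N) + multiplicity ?p (residue b N)"
      using nz p by (intro prime_elem_multiplicity_mult_distrib) auto
    also have "\<dots> < N"
      using a b multiplicity_dvd'[of m ?p "residue a N"] multiplicity_dvd'[of n ?p "residue b N"]
      unfolding N_def by (meson add_strict_mono not_le)
    finally show False by simp
  qed
  hence "residue (a * b) N \<noteq> 0"
    by (simp add: times_padic_int.rep_eq dvd_eq_mod_eq_0)
  thus "a * b \<noteq> 0" by (auto simp: zero_padic_int.rep_eq)
qed


section \<open>Topology and Haar measure\<close>

text \<open>The inverse limit topology, a basis of which is given by the cosets of $p^n\mathbb{Z}_p$.\<close>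

instantiation padic_int :: (prime_card) topological_space
begin

definition open_padic_int :: "'a padic_int set \<Rightarrow> bool" where
  "open_padic_int U \<longleftrightarrow> (\<forall>x\<in>U. \<exists>n. \<forall>y. residue y n = residue x n \<longrightarrow> y \<in> U)"

instance
proof
  show "open (UNIV :: 'a padic_int set)" by (simp add: open_padic_int_def)
next
  fix S T :: "'a padic_int set"
  assume S: "open S" and T: "open T"
  show "open (S \<inter> T)"
    unfolding open_padic_int_def
  proof
    fix x assume "x \<in> S \<inter> T"
    then obtain m n where
      m: "\<And>y. residue y m = residue x m \<Longrightarrow> y \<in> S" and
      n: "\<And>y. residue y n = residue x n \<Longrightarrow> y \<in> T"
      using S T by (auto simp: open_padic_int_def) meson
    have "y \<in> S \<inter> T" if "residue y (max m n) = residue x (max m n)" for y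
      using that m n by (metis IntI residue_mod_le max.cobounded1 max.cobounded2)
    thus "\<exists>n. \<forall>y. residue y n = residue x n \<longrightarrow> y \<in> S \<inter> T" by blast
  qed
next
  fix K :: "'a padic_int set set"
  assume "\<forall>S\<in>K. open S"
  thus "open (\<Union>K)" unfolding open_padic_int_def by (meson UnionE UnionI)
qed

end

definition haar_probability :: "'p :: prime_card padic_int measure \<Rightarrow> bool" where
  "haar_probability \<mu> \<longleftrightarrow>
     prob_space \<mu> \<and> sets \<mu> = sets borel \<and> (\<forall>c. distr \<mu> borel (\<lambda>x. c + x) = \<mu>)"


section \<open>The field of $p$-adic numbers, its algebraic closure, and its unramified closure\<close>

type_synonym 'p padic = "'p padic_int fract"
type_synonym 'p padic_closure = "'p padic alg_closure"

definition padic_int_embed :: "'p :: prime_card padic_int \<Rightarrow> 'p padic_closure" where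
  "padic_int_embed a = to_ac (Fract a 1)"

text \<open>The integral closure of $\mathbb{Z}_p$ in \<open>L\<close>.\<close>

definition ring_of_integers :: "'p :: prime_card padic_closure set \<Rightarrow> 'p padic_closure set" where
  "ring_of_integers L =
     {x \<in> L. \<exists>f :: 'p padic_int poly.
        Polynomial.lead_coeff f = 1 \<and> poly (map_poly padic_int_embed f) x = 0}"

text \<open>
  A finite extension $L$ of $\mathbb{Q}_p$ inside $\overline{\mathbb{Q}}_p$ is unramified iff
  the maximal ideal of $\mathcal{O}_L$ is generated by the uniformiser $p$ of $\mathbb{Q}_p$.
  Separability of the residue extension is automatic, as residue fields are finite.
\<close>

definition unramified_extension :: "'p :: prime_card padic_closure set \<Rightarrow> bool" where
  "unramified_extension L \<longleftrightarrow>
     (let K = (ring_of_type_algebra :: 'p padic_closure ring);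
          Q = range to_ac;
          OL = K\<lparr>carrier := ring_of_integers L\<rparr>
      in subfield L K \<and> Q \<subseteq> L \<and> ring.finite_dimension K Q L \<and>
         maximalideal (PIdl\<^bsub>OL\<^esub> of_nat CARD('p)) OL)"

definition padic_unramified :: "'p :: prime_card padic_closure set" where
  "padic_unramified = \<Union>{L. unramified_extension L}"


section \<open>Random polynomials and their roots\<close>

definition poly_of_coeffs :: "nat \<Rightarrow> (nat \<Rightarrow> 'p :: prime_card padic_int) \<Rightarrow> 'p padic_int poly" where
  "poly_of_coeffs n a = (\<Sum>i\<le>n. Polynomial.monom (a i) i)"

text \<open>
  Here \<open>proots\<close> is the multiset of roots of a nonzero polynomial, and it is empty for
  the zero polynomial, which occurs with probability zero.
\<close>

definition num_roots_in :: "'p :: prime_card padic_closure set \<Rightarrow> 'p padic_int poly \<Rightarrow> nat" where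
  "num_roots_in U P = size {# x \<in># proots (map_poly padic_int_embed P). x \<in> U #}"

text \<open>
  The expectation of the number of roots in \<open>U\<close>, for independent coefficients
  $a_0,\dots,a_n$ with common distribution \<open>\<mu>\<close>.
\<close>

definition expected_roots ::
  "'p :: prime_card padic_int measure \<Rightarrow> 'p padic_closure set \<Rightarrow> nat \<Rightarrow> ennreal" where
  "expected_roots \<mu> U n =
     (\<integral>\<^sup>+ a. of_nat (num_roots_in U (poly_of_coeffs n a)) \<partial>(\<Pi>\<^sub>M i\<in>{..n}. \<mu>))"

end

theory Submission
  imports Defs "Berlekamp_Zassenhaus.Distinct_Degree_Factorization" "Jordan_Normal_Form.Char_Poly"
begin

text \<open>
  Condition a random polynomial of degree at most $n$ on its reduction $h$ modulo $p$. By Hensel's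
  lemma the roots of a polynomial over $h \neq 0$ fall into clusters, one for every monic irreducible
  factor $f$ of $h$ and one at infinity, and the lifted factorization identifies the coefficients
  with those of independent Haar distributed factors, because the map involved is an isometry.
  Thus each cluster contributes a quantity depending only on $f$ and its multiplicity $m$. Clusters
  with $m = 1$ consist of unramified roots, a cluster contributes at most $m \deg f$, and counting
  the polynomials $h$ with $f^m$ exactly dividing $h$ gives a sequence that increases in $n$ and is
  bounded by geometric series. The case $h = 0$ merely rescales the polynomial. The limit is
  positive because of Eisenstein polynomials of degree 2 over $h$ with a double root.

  The number of unramified roots is measurable because the unramified elements are an increasing
  union of compact sets, and the polynomials with at least $k$ roots in a compact set form a closed
  set.
\<close>

section \<open>The $p$-adic integers\<close>

text \<open>No absolute value on the algebraic closure is constructed. Its valuation ring is the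
  integral closure \<open>OC\<close> of Z_p; that \<open>x\<close> or \<open>1/x\<close> always lies
  in it is itself extracted from Hensel lifting (\<open>OC_or_inverse_OC\<close>), and congruences
  are divisibility by powers of p in \<open>OC\<close>. Unramified elements are handled through the
  fields \<open>Sq q\<close> generated over Q_p by the solutions of t^q = t, for q a power of p. A
  ring of integral elements in which y^q is always congruent to y modulo p has digit expansions in
  such t, hence lies in \<open>Sq q\<close>. This one criterion serves both for the definition by
  maximal ideals and for roots of polynomials with irreducible reduction.

  The constant arises by weakening the bound m d for a cluster, d being the degree of f, to 2(m-1)d,
  which also covers m = 1. With at most p^d/d monic irreducibles of degree d, the series give
  2p/(p-1)^2 for the finite clusters and 2/(p(p-1)) for the one at infinity. The sum of these two is
  at most (4p-3)/(p-1)^2, with equality for p = 2.\<close>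

hide_const (open) Module.smult Divisibility.prime Divisibility.irreducible up_ring.coeff up_ring.monom Coset.order
  Polynomials.degree Polynomials.lead_coeff comm_monoid_mult_class.coprime

section \<open>Residues and divisibility by powers of p\<close>

abbreviation pZ :: "'p :: prime_card padic_int" where "pZ \<equiv> of_nat CARD('p)"

lemma pZ_gt_0: "int CARD('p :: prime_card) > 0"
  using padic_card_gt_1[where 'p = 'p] by simp

lemma residue_0 [simp]: "residue (0 :: 'p :: prime_card padic_int) n = 0"
  by (simp add: zero_padic_int.rep_eq)

lemma residue_of_nat: "residue (of_nat a :: 'p :: prime_card padic_int) n = int a mod int CARD('p) ^ n"
  by (induction a) (simp_all add: plus_padic_int.rep_eq one_padic_int.rep_eq mod_simps add.commute)

lemma residue_of_int: "residue (of_int a :: 'p :: prime_card padic_int) n = a mod int CARD('p) ^ n"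
  by (cases a rule: int_cases2)
     (simp_all add: residue_of_nat uminus_padic_int.rep_eq mod_simps)

lemma residue_power: "residue (x ^ k :: 'p :: prime_card padic_int) n = residue x n ^ k mod int CARD('p) ^ n"
  by (induction k) (simp_all add: one_padic_int.rep_eq times_padic_int.rep_eq mod_simps)

text \<open>The quotient of \<open>x\<close> by p^n is written down residue by residue. Dividing
  costs \<open>n\<close> digits, so its residue at level \<open>k\<close> is read from level
  \<open>k + n\<close> of \<open>x\<close>.\<close>

lemma residue_eq_0_iff: 
  fixes x :: "'p :: prime_card padic_int"
  shows "residue x n = 0 \<longleftrightarrow> pZ ^ n dvd x"
proof
  let ?p = "int CARD('p)"
  assume x0: "residue x n = 0"
  define f where "f = (\<lambda>k. residue x (k + n) div ?p ^ n)"
  have f1: "f k \<in> {0..<?p ^ k}" for k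
  proof -
    have "residue x (k + n) < ?p ^ k * ?p ^ n"
      using residue_bounds(2)[of x "k + n"] by (simp add: power_add)
    moreover have "residue x (k + n) div ?p ^ n * ?p ^ n = residue x (k + n) - residue x (k + n) mod ?p ^ n"
      by (rule minus_mod_eq_div_mult [symmetric])
    moreover have "residue x (k + n) mod ?p ^ n \<ge> 0"
      using pZ_gt_0[where 'p = 'p] by (intro pos_mod_sign zero_less_power)
    ultimately have "residue x (k + n) div ?p ^ n * ?p ^ n < ?p ^ k * ?p ^ n" by linarith
    thus ?thesis
      using residue_bounds(1)[of x "k+n"] pZ_gt_0[where 'p = 'p]
      by (simp add: f_def pos_imp_zdiv_nonneg_iff)
  qed
  have f2: "f (Suc k) mod ?p ^ k = f k" for k
  proof -
    have "residue x (k + n) = residue x (Suc k + n) mod (?p ^ n * ?p ^ k)"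
      using residue_Suc[of x "k + n"] by (simp add: power_add mult.commute)
    also have "\<dots> = ?p ^ n * (f (Suc k) mod ?p ^ k) + residue x (Suc k + n) mod ?p ^ n"
      unfolding f_def by (rule zmod_zmult2_eq) (use pZ_gt_0[where 'p = 'p] in simp)
    also have "residue x (Suc k + n) mod ?p ^ n = 0"
      using residue_mod_le[of n "Suc k + n" x] x0 by simp
    finally have "f k = ?p ^ n * (f (Suc k) mod ?p ^ k) div ?p ^ n"
      by (simp add: f_def)
    thus ?thesis using pZ_gt_0[where 'p = 'p] by simp
  qed
  define y where "y = (Abs_padic_int f :: 'p padic_int)"
  have y: "residue y = f"
    unfolding y_def by (rule Abs_padic_int_inverse) (use f1 f2 in auto)
  have "x = pZ ^ n * y"
  proof -
    have "residue x k = residue (pZ ^ n * y) k" for k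
    proof -
      have "residue (pZ ^ n * y) k = ?p ^ n * f k mod ?p ^ k"
        by (simp add: times_padic_int.rep_eq residue_power residue_of_nat y mod_simps)
      also have "?p ^ n * f k = residue x (k + n) - residue x (k + n) mod ?p ^ n"
        by (simp add: f_def minus_mod_eq_mult_div)
      also have "residue x (k + n) mod ?p ^ n = 0"
        using residue_mod_le[of n "k + n" x] x0 by simp
      also have "(residue x (k + n) - 0) mod ?p ^ k = residue x k"
        using residue_mod_le[of k "k + n" x] by simp
      finally show ?thesis ..
    qed
    thus ?thesis by (simp add: residue_inject[symmetric] fun_eq_iff)
  qed
  thus "pZ ^ n dvd x" by simp
next
  assume "pZ ^ n dvd x"
  then obtain y where "x = pZ ^ n * y" by (elim dvdE)
  thus "residue x n = 0"
    by (simp add: times_padic_int.rep_eq residue_power residue_of_nat mod_simps)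
qed

lemma residue_eq_iff:
  fixes x y :: "'p :: prime_card padic_int"
  shows "residue x n = residue y n \<longleftrightarrow> pZ ^ n dvd (x - y)"
proof -
  have "residue (x - y) n = (residue x n - residue y n) mod int CARD('p) ^ n"
    by (simp add: minus_padic_int.rep_eq)
  moreover have "(residue x n - residue y n) mod int CARD('p) ^ n = 0 \<longleftrightarrow> residue x n = residue y n"
    by (metis mod_eq_dvd_iff dvd_eq_mod_eq_0 residue_mod)
  ultimately show ?thesis by (simp add: residue_eq_0_iff[symmetric])
qed

lemma all_pZ_power_dvd_imp_0:
  fixes x :: "'p :: prime_card padic_int"
  assumes "\<And>n. pZ ^ n dvd x"
  shows "x = 0"
  using assms by (simp flip: residue_eq_0_iff add: residue_inject[symmetric] fun_eq_iff)

lemma pZ_neq_0 [simp]: "(pZ :: 'p :: prime_card padic_int) \<noteq> 0"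
proof
  assume "(pZ :: 'p padic_int) = 0"
  hence "residue (pZ :: 'p padic_int) 2 = 0" by simp
  thus False using padic_card_gt_1[where 'p = 'p] 
    by (simp add: residue_of_nat power2_eq_square)
qed

instance padic_int :: (prime_card) ring_char_0
proof
  show "inj (of_nat :: nat \<Rightarrow> 'a padic_int)"
  proof (rule injI)
    fix a b :: nat assume *: "(of_nat a :: 'a padic_int) = of_nat b"
    have 1: "1 < CARD('a)" using padic_card_gt_1[where 'p = 'a] by simp
    \<comment> \<open>At level \<open>a + b\<close> both numbers are smaller than the modulus, hence
      equal to their own residues.\<close>
    have "a < CARD('a) ^ (a + b)" "b < CARD('a) ^ (a + b)"
      using power_gt_expt[of "CARD('a)" "a + b"] 1 by linarith+
    hence "int a < int CARD('a) ^ (a + b)" "int b < int CARD('a) ^ (a + b)"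
      by (metis of_nat_less_iff of_nat_power)+
    moreover have "residue (of_nat a :: 'a padic_int) (a + b) = residue (of_nat b :: 'a padic_int) (a + b)"
      using * by simp
    ultimately show "a = b" by (simp add: residue_of_nat)
  qed
qed

section \<open>Reduction to the residue field, and units\<close>

definition red :: "'p :: prime_card padic_int \<Rightarrow> 'p mod_ring" where
  "red x = of_int (residue x 1)"

lemma of_int_mod_card: "(of_int (a mod int CARD('p)) :: 'p :: prime_card mod_ring) = of_int a"
  unfolding of_int_of_int_mod_ring by transfer simp

interpretation red: comm_ring_hom red
proof
  fix x y :: "'a :: prime_card padic_int"
  show "red (x + y) = red x + red y" 
    by (simp add: red_def plus_padic_int.rep_eq of_int_mod_card)
  show "red (x * y) = red x * red y"
    by (simp add: red_def times_padic_int.rep_eq of_int_mod_card)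
  show "red (0 :: 'a padic_int) = 0" by (simp add: red_def)
  show "red (1 :: 'a padic_int) = 1"
    using padic_card_gt_1[where 'p = 'a] by (simp add: red_def one_padic_int.rep_eq)
qed

lemma of_int_mod_ring_eq_0_iff: "(of_int a :: 'p :: prime_card mod_ring) = 0 \<longleftrightarrow> int CARD('p) dvd a"
  unfolding of_int_of_int_mod_ring by transfer auto

lemma red_eq_0_iff: "red x = 0 \<longleftrightarrow> pZ dvd x"
  for x :: "'p :: prime_card padic_int"
  unfolding red_def of_int_mod_ring_eq_0_iff
  using residue_eq_0_iff[of x 1] residue_mod[of x 1]
  by (metis dvd_eq_mod_eq_0 power_one_right)

text \<open>A set-theoretic section of \<open>red\<close>, not a homomorphism. Fixing 0 and 1 makes
  \<open>map_poly lift\<close> preserve degrees and monic polynomials.\<close>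

definition lift :: "'p :: prime_card mod_ring \<Rightarrow> 'p padic_int" where
  "lift a = of_int (to_int_mod_ring a)"

lemma red_of_int [simp]: "red (of_int a) = of_int a" 
  by (simp add: red_def residue_of_int of_int_mod_card)

lemma red_lift [simp]: "red (lift a) = a"
  by (simp add: lift_def of_int_of_int_mod_ring)

lemma red_pZ [simp]: "red (of_nat CARD('p) :: 'p :: prime_card padic_int) = 0"
  by (simp add: red_eq_0_iff)

lemma lift_0 [simp]: "lift 0 = 0" and lift_1 [simp]: "lift 1 = 1"
  by (simp_all add: lift_def)

lemma lift_eq_0_iff [simp]: "lift a = 0 \<longleftrightarrow> a = 0"
  by (metis red_lift lift_0 red.hom_zero)

text \<open>Residues prime to p are inverted level by level. An inverse modulo p^n is unique, so
  arbitrary choices at different levels are automatically compatible and define a p-adic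
  integer.\<close>

lemma red_neq_0_imp_unit:
  fixes x :: "'p :: prime_card padic_int"
  assumes "red x \<noteq> 0"
  shows "\<exists>y. x * y = 1"
proof -
  let ?p = "int CARD('p)"
  have p: "prime ?p" using prime_card_int[where 'a = 'p] by simp
  have cop: "coprime (residue x n) (?p ^ n)" for n
  proof (cases "n = 0")
    case False
    have "\<not> ?p dvd residue x n"
    proof
      assume "?p dvd residue x n"
      hence "residue x n mod ?p ^ 1 = 0" by simp
      hence "residue x 1 = 0" using residue_mod_le[of 1 n x] False by simp
      thus False using assms by (simp add: red_def)
    qed
    hence "coprime ?p (residue x n)" using prime_imp_coprime[OF p] by blast
    thus ?thesis by (simp add: ac_simps)
  qed simp
  define f where "f = (\<lambda>n. SOME y. [residue x n * y = 1] (mod ?p ^ n))"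
  have f: "[residue x n * f n = 1] (mod ?p ^ n)" for n
    unfolding f_def by (rule someI_ex) (use cop in \<open>blast intro: cong_solve_coprime_int\<close>)
  have "f (Suc n) mod ?p ^ n = f n mod ?p ^ n" for n
  proof -
    have "[residue x (Suc n) * f (Suc n) = 1] (mod ?p ^ n)"
      using f[of "Suc n"] by (metis cong_dvd_modulus le_imp_power_dvd le_SucI order_refl)
    moreover have "[residue x (Suc n) = residue x n] (mod ?p ^ n)"
      using residue_Suc[of x n] by (simp add: cong_def)
    ultimately have "[residue x n * f (Suc n) = residue x n * f n] (mod ?p ^ n)"
      using f[of n] by (meson cong_scalar_right cong_sym cong_trans)
    hence "[f (Suc n) = f n] (mod ?p ^ n)" 
      using cop[of n] by (simp add: cong_mult_lcancel)
    thus ?thesis by (simp add: cong_def)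
  qed
  note g = mod_padic_intI[OF this]
  define y where "y = (Abs_padic_int (\<lambda>n. f n mod ?p ^ n) :: 'p padic_int)"
  have y: "residue y = (\<lambda>n. f n mod ?p ^ n)"
    unfolding y_def by (rule Abs_padic_int_inverse) (use g in auto)
  have "x * y = 1"
    using f by (simp add: residue_inject[symmetric] fun_eq_iff times_padic_int.rep_eq one_padic_int.rep_eq y mod_simps cong_def)
  thus ?thesis ..
qed

lemma red_poly_eq_0_iff:
  fixes P :: "'p :: prime_card padic_int poly"
  shows "map_poly red P = 0 \<longleftrightarrow> [:pZ:] dvd P"
  by (auto simp: poly_eq_iff const_poly_dvd_iff red_eq_0_iff)

text \<open>Removal of the p-part of the content. A nonzero coefficient is divisible by only
  finitely many powers of p, so there is a largest power dividing all coefficients, and maximality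
  forces a nonzero reduction.\<close>

lemma primitive_decomp:
  fixes P :: "'p :: prime_card padic_int poly"
  assumes "P \<noteq> 0"
  obtains v Q where "P = smult (pZ ^ v) Q" "map_poly red Q \<noteq> 0"
proof -
  obtain i where i: "coeff P i \<noteq> 0" using assms by (auto simp: poly_eq_iff)
  obtain n where n: "\<not> pZ ^ n dvd coeff P i" using all_pZ_power_dvd_imp_0 i by blast
  define S where "S = {v. [:pZ ^ v:] dvd P}"
  have "v < n" if "v \<in> S" for v
  proof (rule ccontr)
    assume "\<not> v < n"
    hence "pZ ^ n dvd (pZ :: 'p padic_int) ^ v" by (intro le_imp_power_dvd) simp
    moreover have "pZ ^ v dvd coeff P i" using that by (simp add: S_def const_poly_dvd_iff)
    ultimately show False using n dvd_trans by blast
  qed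
  hence fin: "finite S" by (auto simp: finite_nat_set_iff_bounded)
  have "0 \<in> S" by (simp add: S_def const_poly_dvd_iff)
  hence v: "Max S \<in> S" using fin by (intro Max_in) auto
  then obtain Q where Q: "P = [:pZ ^ Max S:] * Q" unfolding S_def by auto
  have "map_poly red Q \<noteq> 0"
  proof
    assume "map_poly red Q = 0"
    then obtain R where "Q = [:pZ:] * R" by (auto simp: red_poly_eq_0_iff)
    hence "P = [:pZ ^ Suc (Max S):] * R" using Q by simp
    hence "[:pZ ^ Suc (Max S):] dvd P" by (rule dvdI)
    hence "Suc (Max S) \<in> S" by (simp add: S_def)
    thus False using Max_ge[OF fin] by fastforce
  qed
  thus ?thesis using Q that by simp
qed

section \<open>The integral closure\<close>

abbreviation pC :: "'p :: prime_card padic_closure" where "pC \<equiv> of_nat CARD('p)"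
abbreviation emb :: "'p :: prime_card padic_int \<Rightarrow> 'p padic_closure" where "emb \<equiv> padic_int_embed"
abbreviation embp :: "'p :: prime_card padic_int poly \<Rightarrow> 'p padic_closure poly" where "embp \<equiv> map_poly padic_int_embed"
abbreviation OC :: "'p :: prime_card padic_closure set" where "OC \<equiv> ring_of_integers UNIV"

interpretation emb: inj_idom_hom "padic_int_embed :: 'p :: prime_card padic_int \<Rightarrow> 'p padic_closure"
proof
  fix x y :: "'p padic_int"
  show "emb (x + y) = emb x + emb y" by (simp add: padic_int_embed_def flip: to_ac_add)
  show "emb (x * y) = emb x * emb y" by (simp add: padic_int_embed_def flip: to_ac_mult)
  show "emb (0 :: 'p padic_int) = 0" by (simp add: padic_int_embed_def flip: Zero_fract_def)
  show "emb (1 :: 'p padic_int) = 1" by (simp add: padic_int_embed_def flip: One_fract_def)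
  show "emb x = 0 \<Longrightarrow> x = 0" by (simp add: padic_int_embed_def Zero_fract_def eq_fract)
qed

lemma emb_of_nat [simp]: "emb (of_nat n) = of_nat n"
  by (induction n) (simp_all add: emb.hom_add)

lemma emb_eq_0_iff [simp]: "emb x = 0 \<longleftrightarrow> x = 0"
  using emb.hom_0 emb.hom_zero by blast

lemma emb_power: "emb (x ^ n) = emb x ^ n"
  by (induction n) (simp_all add: emb.hom_mult)

lemma of_nat_closure_eq_0_iff [simp]: "(of_nat n :: 'p :: prime_card padic_closure) = 0 \<longleftrightarrow> n = 0"
  by (metis emb_of_nat emb_eq_0_iff of_nat_eq_0_iff)

interpretation embp: map_poly_inj_idom_hom "padic_int_embed :: 'p :: prime_card padic_int \<Rightarrow> 'p padic_closure" ..
interpretation redp: map_poly_comm_ring_hom "red :: 'p :: prime_card padic_int \<Rightarrow> 'p mod_ring" ..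

lemma embp_eq_0_iff [simp]: "embp P = 0 \<longleftrightarrow> P = 0"
  by (simp add: poly_eq_iff)

lemma degree_embp [simp]: "degree (embp P) = degree P"
  by (simp add: degree_map_poly)

lemma embp_mult: "embp (P * Q) = embp P * embp Q"
  by (rule embp.hom_mult)

lemma embp_add: "embp (P + Q) = embp P + embp Q"
  by (rule embp.hom_add)

lemma embp_smult: "embp (smult c P) = smult (emb c) (embp P)"
  by (simp add: poly_eq_iff emb.hom_mult)

lemma embp_power: "embp (P ^ n) = embp P ^ n"
  by (induction n) (simp_all add: embp_mult)

lemma mem_OC_iff: "x \<in> OC \<longleftrightarrow> (\<exists>f. lead_coeff f = 1 \<and> poly (embp f) x = 0)"
  by (simp add: ring_of_integers_def)

section \<open>Integral elements through finitely generated Z_p-modules\<close>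

definition Zspan :: "'p :: prime_card padic_closure set \<Rightarrow> 'p padic_closure set" where
  "Zspan V = {\<Sum>v\<in>V. emb (c v) * v |c. True}"

lemma Zspan_0 [simp]: "0 \<in> Zspan V"
  unfolding Zspan_def by (auto intro!: exI[of _ "\<lambda>_. 0"])

lemma Zspan_base: "finite V \<Longrightarrow> v \<in> V \<Longrightarrow> v \<in> Zspan V"
  unfolding Zspan_def by (auto intro!: exI[of _ "\<lambda>w. if w = v then 1 else 0"] simp: if_distrib if_distribR sum.delta cong: if_cong)

lemma Zspan_add: "x \<in> Zspan V \<Longrightarrow> y \<in> Zspan V \<Longrightarrow> x + y \<in> Zspan V"
  unfolding Zspan_def
  by clarsimp (rule_tac x = "\<lambda>v. c v + ca v" in exI, simp add: emb.hom_add distrib_right sum.distrib)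

lemma Zspan_scale: "x \<in> Zspan V \<Longrightarrow> emb a * x \<in> Zspan V"
  unfolding Zspan_def
  by clarsimp (rule_tac x = "\<lambda>v. a * c v" in exI, simp add: emb.hom_mult sum_distrib_left mult_ac)

lemma Zspan_sum: "(\<And>i. i \<in> I \<Longrightarrow> f i \<in> Zspan V) \<Longrightarrow> sum f I \<in> Zspan V"
  by (induction I rule: infinite_finite_induct) (auto intro: Zspan_add)

lemma Zspan_diff: "x \<in> Zspan V \<Longrightarrow> y \<in> Zspan V \<Longrightarrow> x - y \<in> Zspan V"
  using Zspan_add[of x V "emb (-1) * y"] Zspan_scale[of y V "-1"] by (simp add: emb.hom_uminus)

lemma Zspan_mult:
  assumes "\<And>v. v \<in> V \<Longrightarrow> x * v \<in> Zspan W" "y \<in> Zspan V"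
  shows "x * y \<in> Zspan W"
proof -
  obtain c where y: "y = (\<Sum>v\<in>V. emb (c v) * v)" using assms(2) by (auto simp: Zspan_def)
  have "x * y = (\<Sum>v\<in>V. emb (c v) * (x * v))" by (simp add: y sum_distrib_left mult_ac)
  thus ?thesis using assms(1) by (auto intro!: Zspan_sum Zspan_scale)
qed

text \<open>An endomorphism of a finitely generated module is annihilated by the characteristic
  polynomial of any matrix representing it.\<close>

lemma OC_if_Zspan_invariant:
  fixes x :: "'p :: prime_card padic_closure"
  assumes fin: "finite V" and inv: "\<And>v. v \<in> V \<Longrightarrow> x * v \<in> Zspan V" and nz: "w \<in> V" "w \<noteq> 0"
  shows "x \<in> OC"
proof -
  obtain xs where xs: "set xs = V" "distinct xs" using finite_distinct_list[OF fin] by blast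
  define n where "n = length xs"
  have "\<exists>c. x * v = (\<Sum>w\<in>V. emb (c w) * w)" if "v \<in> V" for v
    using inv[OF that] by (auto simp: Zspan_def)
  hence "\<forall>v\<in>V. \<exists>c. x * v = (\<Sum>w\<in>V. emb (c w) * w)" by blast
  from bchoice[OF this] obtain c where c: "\<And>v. v \<in> V \<Longrightarrow> x * v = (\<Sum>w\<in>V. emb (c v w) * w)" by blast
  define A where "A = mat n n (\<lambda>(i, j). c (xs ! i) (xs ! j))"
  define v where "v = vec_of_list xs"
  have A: "A \<in> carrier_mat n n" and A': "map_mat emb A \<in> carrier_mat n n" by (auto simp: A_def)
  have v: "v \<in> carrier_vec n" by (auto simp: v_def n_def)
  have "map_mat emb A *\<^sub>v v = x \<cdot>\<^sub>v v"
  proof (rule eq_vecI)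
    fix i assume i: "i < dim_vec (x \<cdot>\<^sub>v v)"
    hence i: "i < n" using v by simp
    have "(map_mat emb A *\<^sub>v v) $ i = (\<Sum>j<n. emb (c (xs ! i) (xs ! j)) * xs ! j)"
      using i v by (auto simp: A_def scalar_prod_def v_def n_def vec_of_list_index atLeast0LessThan intro!: sum.cong)
    also have "\<dots> = (\<Sum>w\<in>V. emb (c (xs ! i) w) * w)"
      using xs by (intro sum.reindex_bij_betw[OF bij_betw_nth]) (auto simp: n_def)
    also have "\<dots> = x * xs ! i" using c[of "xs ! i"] i xs by (auto simp: n_def)
    finally show "(map_mat emb A *\<^sub>v v) $ i = (x \<cdot>\<^sub>v v) $ i"
      using i v by (simp add: v_def vec_of_list_index n_def)
  qed (use A v in auto)
  moreover have "v \<noteq> 0\<^sub>v n"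
  proof
    assume "v = 0\<^sub>v n"
    obtain j where j: "j < n" "xs ! j = w" using nz xs by (auto simp: n_def in_set_conv_nth)
    hence "v $ j = w" by (simp add: v_def vec_of_list_index)
    thus False using \<open>v = 0\<^sub>v n\<close> j nz by simp
  qed
  ultimately have "eigenvalue (map_mat emb A) x"
    unfolding eigenvalue_def eigenvector_def using v A by auto
  hence "poly (char_poly (map_mat emb A)) x = 0"
    using eigenvalue_root_char_poly[OF A'] by simp
  hence "poly (embp (char_poly A)) x = 0"
    using emb.char_poly_hom[OF A] by simp
  moreover have "lead_coeff (char_poly A) = 1"
    using degree_monic_char_poly[OF A] by auto
  ultimately show ?thesis by (auto simp: mem_OC_iff)
qed

lemma OC_imp_Zspan_invariant:
  fixes x :: "'p :: prime_card padic_closure"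
  assumes "x \<in> OC"
  obtains n where "n > 0" "x ^ n \<in> Zspan ((\<lambda>i. x ^ i) ` {..<n})"
proof -
  obtain f where f: "lead_coeff f = 1" "poly (embp f) x = 0" using assms by (auto simp: mem_OC_iff)
  define n where "n = degree f"
  have "n > 0"
  proof (rule ccontr)
    assume "\<not> n > 0"
    then obtain a where "f = [:a:]" unfolding n_def by (metis degree_eq_zeroE gr0I)
    thus False using f by auto
  qed
  have fin: "finite ((\<lambda>i. x ^ i) ` {..<n})" by simp
  have "0 = (\<Sum>i\<le>n. emb (coeff f i) * x ^ i)"
    using f(2) by (simp add: poly_altdef n_def)
  also have "\<dots> = (\<Sum>i<n. emb (coeff f i) * x ^ i) + x ^ n"
    using f(1) by (simp add: n_def lessThan_Suc_atMost[symmetric])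
  finally have "x ^ n = 0 - (\<Sum>i<n. emb (coeff f i) * x ^ i)" by (simp add: eq_neg_iff_add_eq_0 add.commute)
  also have "\<dots> \<in> Zspan ((\<lambda>i. x ^ i) ` {..<n})"
    using fin by (intro Zspan_diff[OF Zspan_0] Zspan_sum Zspan_scale Zspan_base) auto
  finally show ?thesis using that \<open>n > 0\<close> by blast
qed

text \<open>The monomials x^i y^j below the degrees of the two monic equations span one module
  stable under both elements. Sums and products then stabilise it as well, so no equation for them
  has to be computed.\<close>

lemma OC_common_module:
  fixes x y :: "'p :: prime_card padic_closure"
  assumes "x \<in> OC" "y \<in> OC"
  obtains V where "finite V" "1 \<in> V" 
    "\<And>v. v \<in> V \<Longrightarrow> x * v \<in> Zspan V" "\<And>v. v \<in> V \<Longrightarrow> y * v \<in> Zspan V"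
proof -
  obtain m where m: "m > 0" "x ^ m \<in> Zspan ((\<lambda>i. x ^ i) ` {..<m})"
    using OC_imp_Zspan_invariant[OF assms(1)] .
  obtain n where n: "n > 0" "y ^ n \<in> Zspan ((\<lambda>i. y ^ i) ` {..<n})"
    using OC_imp_Zspan_invariant[OF assms(2)] .
  define V where "V = (\<lambda>(i, j). x ^ i * y ^ j) ` ({..<m} \<times> {..<n})"
  have fin: "finite V" by (simp add: V_def)
  have base: "x ^ i * y ^ j \<in> Zspan V" if "i < m" "j < n" for i j
    using that fin by (intro Zspan_base) (auto simp: V_def)
  have "1 \<in> V" unfolding V_def using m n by (intro image_eqI[of _ _ "(0, 0)"]) auto
  moreover have "x * v \<in> Zspan V" if "v \<in> V" for v
  proof -
    obtain i j where ij: "v = x ^ i * y ^ j" "i < m" "j < n" using \<open>v \<in> V\<close> by (auto simp: V_def)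
    show ?thesis
    proof (cases "Suc i < m")
      case True
      thus ?thesis using base[of "Suc i" j] ij by (simp add: mult_ac)
    next
      case False
      \<comment> \<open>The only product leaving the range is x^m y^j, which the equation of
        \<open>x\<close> sends back.\<close>
      hence "m = Suc i" using ij by simp
      hence "x * v = y ^ j * x ^ m" by (simp add: ij mult_ac)
      also have "\<dots> \<in> Zspan V"
        using m(2) by (rule Zspan_mult[rotated]) (use base ij in \<open>auto simp: mult.commute\<close>)
      finally show ?thesis .
    qed
  qed
  moreover have "y * v \<in> Zspan V" if "v \<in> V" for v
  proof -
    obtain i j where ij: "v = x ^ i * y ^ j" "i < m" "j < n" using \<open>v \<in> V\<close> by (auto simp: V_def)
    show ?thesis
    proof (cases "Suc j < n")
      case True
      thus ?thesis using base[of i "Suc j"] ij by (simp add: mult_ac)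
    next
      case False
      hence "n = Suc j" using ij by simp
      hence "y * v = x ^ i * y ^ n" by (simp add: ij mult_ac)
      also have "\<dots> \<in> Zspan V"
        using n(2) by (rule Zspan_mult[rotated]) (use base ij in auto)
      finally show ?thesis .
    qed
  qed
  ultimately show ?thesis using that fin by blast
qed

lemma OC_add: "x \<in> OC \<Longrightarrow> y \<in> OC \<Longrightarrow> x + y \<in> OC"
  by (rule OC_common_module[of x y], assumption+, rule OC_if_Zspan_invariant[where w = 1])
     (auto simp: distrib_right intro: Zspan_add)

lemma OC_mult:
  assumes "x \<in> OC" "y \<in> OC"
  shows "x * y \<in> OC"
proof -
  obtain V where V: "finite V" "1 \<in> V" 
    "\<And>v. v \<in> V \<Longrightarrow> x * v \<in> Zspan V" "\<And>v. v \<in> V \<Longrightarrow> y * v \<in> Zspan V"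
    using OC_common_module[OF assms] by metis
  have "x * y * v \<in> Zspan V" if "v \<in> V" for v
    using Zspan_mult[OF V(3) V(4)[OF that]] by (simp add: mult.assoc)
  thus ?thesis using V by (intro OC_if_Zspan_invariant[of V _ 1]) auto
qed

lemma OC_emb [simp]: "emb a \<in> OC"
  by (auto simp: mem_OC_iff emb.hom_uminus intro!: exI[of _ "[:-a, 1:]"])

lemma OC_of_nat [simp]: "of_nat n \<in> OC"
  using OC_emb[of "of_nat n"] by simp

lemma OC_0 [simp]: "0 \<in> OC" and OC_1 [simp]: "1 \<in> OC"
  using OC_of_nat[of 0] OC_of_nat[of 1] by simp_all

lemma OC_uminus: "x \<in> OC \<Longrightarrow> - x \<in> OC"
  using OC_mult[OF OC_emb[of "-1"], of x] by (simp add: emb.hom_uminus)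

lemma OC_diff: "x \<in> OC \<Longrightarrow> y \<in> OC \<Longrightarrow> x - y \<in> OC"
  using OC_add[of x "-y"] OC_uminus[of y] by simp

lemma OC_power: "x \<in> OC \<Longrightarrow> x ^ n \<in> OC"
  by (induction n) (auto intro: OC_mult)

lemma OC_sum: "(\<And>i. i \<in> I \<Longrightarrow> f i \<in> OC) \<Longrightarrow> sum f I \<in> OC"
  by (induction I rule: infinite_finite_induct) (auto intro: OC_add)

lemma OC_prod: "(\<And>i. i \<in> I \<Longrightarrow> f i \<in> OC) \<Longrightarrow> prod f I \<in> OC"
  by (induction I rule: infinite_finite_induct) (auto intro: OC_mult)

lemma OC_poly_embp: "x \<in> OC \<Longrightarrow> poly (embp P) x \<in> OC"
  by (auto simp: poly_altdef intro!: OC_sum OC_mult OC_power)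

text \<open>Multiplying a monic equation of 1/p by p^n puts it into Z_p and makes every term except
  the leading 1 divisible by p. This is what keeps p a nonunit of \<open>OC\<close>.\<close>

lemma OC_pC_inverse: "1 / pC \<notin> (OC :: 'p :: prime_card padic_closure set)"
proof
  assume "1 / pC \<in> (OC :: 'p padic_closure set)"
  then obtain f where f: "lead_coeff f = 1" "poly (embp f) (1 / (pC :: 'p padic_closure)) = 0" by (auto simp: mem_OC_iff)
  define n where "n = degree f"
  have "0 = pC ^ n * (\<Sum>i\<le>n. emb (coeff f i) * (1 / (pC :: 'p padic_closure)) ^ i)"
    using f(2) by (simp add: poly_altdef n_def)
  also have "\<dots> = (\<Sum>i\<le>n. emb (coeff f i * pZ ^ (n - i)))"
    unfolding sum_distrib_left
    by (intro sum.cong) (auto simp: emb.hom_mult emb_power power_diff field_simps)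
  also have "\<dots> = emb (\<Sum>i\<le>n. coeff f i * pZ ^ (n - i))" by (simp add: emb.hom_sum)
  finally have "(\<Sum>i\<le>n. coeff f i * pZ ^ (n - i)) = 0" by simp
  hence "(\<Sum>i<n. coeff f i * pZ ^ (n - i)) + 1 = 0"
    using f(1) by (simp add: n_def lessThan_Suc_atMost[symmetric])
  moreover have "pZ dvd (\<Sum>i<n. coeff f i * pZ ^ (n - i))"
    by (intro dvd_sum dvd_mult dvd_power) auto
  ultimately have "pZ dvd (1 :: 'p padic_int)" using dvd_add_right_iff[of pZ _ 1] by (metis dvd_0_right)
  hence "red (1 :: 'p padic_int) = 0" by (simp only: red_eq_0_iff)
  thus False by simp
qed

text \<open>If p did not divide \<open>a\<close>, then \<open>a\<close> would be a unit of Z_p and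
  1/p would be integral.\<close>

lemma pZ_dvd_if_OC:
  assumes "emb a = pC * y" "y \<in> OC"
  shows "pZ dvd (a :: 'p :: prime_card padic_int)"
proof (rule ccontr)
  assume "\<not> pZ dvd a"
  then obtain b where b: "a * b = 1" using red_neq_0_imp_unit[of a] red_eq_0_iff[of a] by auto
  have "1 = emb (a * b)" by (simp add: b)
  also have "\<dots> = pC * (y * emb b)" using assms by (simp add: emb.hom_mult)
  finally have "1 / pC = y * emb b" by (simp add: field_simps)
  thus False using OC_mult[OF assms(2) OC_emb[of b]] OC_pC_inverse by metis
qed

section \<open>Integral equations for algebraic elements\<close>

lemma emb_clear_denominators:
  fixes P :: "'p :: prime_card padic poly"
  shows "\<exists>d F. d \<noteq> 0 \<and> smult (emb d) (map_poly to_ac P) = embp F"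
proof (induction P)
  case 0
  have "1 \<noteq> (0 :: 'p padic_int) \<and> smult (emb 1) (map_poly to_ac 0) = embp (0 :: 'p padic_int poly)" by simp
  thus ?case by blast
next
  case (pCons a P)
  then obtain d F where dF: "d \<noteq> 0" "smult (emb d) (map_poly to_ac P) = embp F" by blast
  obtain b c where bc: "a = Fract b c" "c \<noteq> 0" by (cases a)
  have a: "emb c * to_ac a = emb b"
  proof -
    have "Fract (c * b) (1 * c) = Fract b 1"
      using bc(2) by (subst eq_fract) (auto simp: mult_ac)
    hence *: "Fract c 1 * a = Fract b 1"
      unfolding bc(1) by (simp only: mult_fract)
    have "emb c * to_ac a = to_ac (Fract c 1 * a)" unfolding padic_int_embed_def by (rule to_ac_mult [symmetric])
    also have "\<dots> = emb b" unfolding * padic_int_embed_def by (rule refl)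
    finally show ?thesis .
  qed
  have "smult (emb (d * c)) (map_poly to_ac (pCons a P)) = embp (pCons (d * b) (smult c F))"
  proof -
    have "smult (emb (d * c)) (map_poly to_ac (pCons a P)) =
        pCons (emb d * (emb c * to_ac a)) (smult (emb c) (smult (emb d) (map_poly to_ac P)))"
      by (simp add: poly_eq_iff coeff_map_poly coeff_pCons emb.hom_mult mult_ac split: nat.split)
    also have "\<dots> = embp (pCons (d * b) (smult c F))"
      unfolding a dF(2) by (simp add: poly_eq_iff coeff_map_poly coeff_pCons emb.hom_mult split: nat.split)
    finally show ?thesis .
  qed
  moreover have "d * c \<noteq> 0" using dF bc by simp
  ultimately show ?case by blast
qed

lemma algebraic_over_Z:
  fixes x :: "'p :: prime_card padic_closure"
  obtains F where "F \<noteq> 0" "poly (embp F) x = 0"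
proof -
  obtain P :: "'p padic poly" where P: "P \<noteq> 0" "poly (map_poly to_ac P) x = 0" by (rule alg_closure_algebraic)
  obtain d F where dF: "d \<noteq> 0" "smult (emb d) (map_poly to_ac P) = embp F" using emb_clear_denominators by blast
  have "map_poly to_ac P \<noteq> 0" using P(1) by (simp add: poly_eq_iff coeff_map_poly)
  hence "F \<noteq> 0" using dF by (metis embp_eq_0_iff emb_eq_0_iff smult_eq_0_iff)
  moreover have "poly (embp F) x = 0" using P(2) by (simp flip: dF(2))
  ultimately show ?thesis using that by blast
qed

text \<open>The index counts free coefficients, so the degree is below \<open>n\<close>; the random
  polynomial of degree at most \<open>n\<close> is therefore \<open>pol (Suc n)\<close>.\<close>

definition pol :: "nat \<Rightarrow> (nat \<Rightarrow> 'a) \<Rightarrow> 'a :: comm_monoid_add poly" where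
  "pol n z = (\<Sum>i<n. Polynomial.monom (z i) i)"

lemma coeff_pol [simp]: "coeff (pol n z) j = (if j < n then z j else 0)"
  by (simp add: pol_def coeff_sum sum.delta')

text \<open>The monic polynomial $a^{n-1} F(X/a)$, where $a$ is the leading coefficient.\<close>

definition monicize :: "'a :: comm_ring_1 poly \<Rightarrow> 'a poly" where
  "monicize F = Polynomial.monom 1 (degree F) +
     pol (degree F) (\<lambda>i. coeff F i * lead_coeff F ^ (degree F - 1 - i))"

lemma coeff_monicize:
  "coeff (monicize F) i = (if i < degree F then coeff F i * lead_coeff F ^ (degree F - 1 - i)
     else if i = degree F then 1 else 0)"
  by (simp add: monicize_def)

lemma degree_monicize [simp]: "degree (monicize F) = degree F"
  by (intro antisym degree_le le_degree) (auto simp: coeff_monicize)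

lemma lead_coeff_monicize [simp]: "lead_coeff (monicize F) = 1"
  by (simp add: coeff_monicize)

lemma poly_monicize:
  assumes "degree F > 0"
  shows "poly (monicize F) (lead_coeff F * x) = lead_coeff F ^ (degree F - 1) * poly F x"
proof -
  define n a where "n = degree F" and "a = lead_coeff F"
  have n: "n = Suc (n - 1)" using assms by (simp add: n_def)
  have "poly (monicize F) (a * x) = (\<Sum>i\<le>n. coeff (monicize F) i * (a * x) ^ i)"
    by (simp add: poly_altdef n_def)
  also have "\<dots> = (\<Sum>i<n. coeff F i * a ^ (n - 1 - i) * (a * x) ^ i) + (a * x) ^ n"
    by (simp add: lessThan_Suc_atMost[symmetric] coeff_monicize n_def a_def)
  also have "(\<Sum>i<n. coeff F i * a ^ (n - 1 - i) * (a * x) ^ i) = (\<Sum>i<n. a ^ (n - 1) * (coeff F i * x ^ i))"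
  proof (intro sum.cong refl)
    fix i assume "i \<in> {..<n}"
    hence "a ^ (n - 1) = a ^ (n - 1 - i) * a ^ i" by (simp flip: power_add)
    thus "coeff F i * a ^ (n - 1 - i) * (a * x) ^ i = a ^ (n - 1) * (coeff F i * x ^ i)"
      by (simp add: power_mult_distrib mult_ac)
  qed
  also have "(a * x) ^ n = a ^ (n - 1) * (a * x ^ n)"
    by (subst (1 2) n) (simp add: power_mult_distrib mult_ac)
  also have "(\<Sum>i<n. a ^ (n - 1) * (coeff F i * x ^ i)) + \<dots> = a ^ (n - 1) * (\<Sum>i\<le>n. coeff F i * x ^ i)"
    by (simp add: lessThan_Suc_atMost[symmetric] sum_distrib_left distrib_left a_def n_def)
  also have "(\<Sum>i\<le>n. coeff F i * x ^ i) = poly F x" by (simp add: poly_altdef n_def)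
  finally show ?thesis by (simp add: n_def a_def)
qed

lemma embp_monicize: "embp (monicize F) = monicize (embp F)"
  by (simp add: poly_eq_iff coeff_monicize emb.hom_mult emb_power)

lemma lead_coeff_times_root_OC:
  assumes "poly (embp F) x = 0" "F \<noteq> 0"
  shows "emb (lead_coeff F) * x \<in> OC"
proof -
  have "degree F > 0"
  proof (rule ccontr)
    assume "\<not> degree F > 0"
    then obtain a where "F = [:a:]" by (metis degree_eq_zeroE gr0I)
    thus False using assms by auto
  qed
  hence "poly (embp (monicize F)) (emb (lead_coeff F) * x) = 0"
    using poly_monicize[of "embp F" x] assms by (simp add: embp_monicize)
  thus ?thesis unfolding mem_OC_iff using lead_coeff_monicize by blast
qed

text \<open>This is \<open>primitive_decomp\<close> for a constant polynomial: a primitive constant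
  has nonzero reduction and is therefore a unit.\<close>

lemma pZ_power_unit_decomp:
  fixes a :: "'p :: prime_card padic_int"
  assumes "a \<noteq> 0"
  obtains k u u' where "a = pZ ^ k * u" "u * u' = 1"
proof -
  obtain v Q where vQ: "[:a:] = smult (pZ ^ v) Q" "map_poly red Q \<noteq> 0"
    using primitive_decomp[of "[:a:]"] assms by auto
  have "degree Q = 0" using vQ(1) by (metis degree_pCons_0 degree_smult_eq pZ_neq_0 power_not_zero)
  then obtain u where u: "Q = [:u:]" by (metis degree_eq_zeroE)
  with vQ have "red u \<noteq> 0" by (auto simp: poly_eq_iff coeff_pCons split: nat.splits)
  then obtain u' where "u * u' = 1" using red_neq_0_imp_unit by blast
  thus ?thesis using that vQ u by auto
qed

text \<open>Multiplying by the leading coefficient of an equation over Z_p makes \<open>x\<close>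
  integral. That coefficient is a power of p times a unit, and the unit can be divided out.\<close>

lemma pC_power_times_OC:
  fixes x :: "'p :: prime_card padic_closure"
  obtains k where "pC ^ k * x \<in> OC"
proof -
  obtain F where F: "F \<noteq> 0" "poly (embp F) x = 0" by (rule algebraic_over_Z)
  obtain k u u' where u: "lead_coeff F = pZ ^ k * u" "u * u' = 1"
    using pZ_power_unit_decomp[of "lead_coeff F"] F by auto
  have "pC ^ k * x = emb u' * (emb (lead_coeff F) * x)"
  proof -
    have "emb u' * (emb (lead_coeff F) * x) = emb (u * u') * (pC ^ k * x)"
      unfolding u(1) by (simp add: emb.hom_mult emb_power mult_ac)
    thus ?thesis unfolding u(2) emb.hom_one mult_1_left by (rule sym)
  qed
  also have "\<dots> \<in> OC" using lead_coeff_times_root_OC F by (blast intro: OC_mult OC_emb)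
  finally show ?thesis using that by blast
qed

text \<open>Separatedness of the p-adic filtration. For nonzero x some p^k/x is integral, so
  integrality of x/p^(k+1) would make 1/p integral.\<close>

lemma all_pC_power_divide_OC_imp_0:
  fixes x :: "'p :: prime_card padic_closure"
  assumes "\<And>N. x / pC ^ N \<in> OC"
  shows "x = 0"
proof (rule ccontr)
  assume x: "x \<noteq> 0"
  obtain k where k: "pC ^ k * (1 / x) \<in> OC" using pC_power_times_OC .
  have "x / pC ^ Suc k * (pC ^ k * (1 / x)) \<in> OC" using assms k by (rule OC_mult)
  also have "x / pC ^ Suc k * (pC ^ k * (1 / x)) = 1 / (pC :: 'p padic_closure)" using x by (simp add: field_simps)
  finally show False using OC_pC_inverse by blast
qed

section \<open>Hensel lifting as an isometry\<close>

lemma const_dvd_smult [simp]: "[:c:] dvd smult c P"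
  using dvd_triv_left[of "[:c:]" P] by simp

section \<open>Congruence levels, completeness and isometries\<close>

definition cong_level :: "nat \<Rightarrow> nat \<Rightarrow> (nat \<Rightarrow> 'p :: prime_card padic_int) \<Rightarrow> (nat \<Rightarrow> 'p padic_int) \<Rightarrow> bool" where
  "cong_level D N z z' \<longleftrightarrow> (\<forall>i<D. residue (z i) N = residue (z' i) N)"

text \<open>Extensional functions, so that the vectors are exactly the points of the product measure
  space used later.\<close>

abbreviation vecs :: "nat \<Rightarrow> (nat \<Rightarrow> 'p :: prime_card padic_int) set" where
  "vecs D \<equiv> PiE {..<D} (\<lambda>_. UNIV)"

lemma cong_level_refl [simp]: "cong_level D N z z"
  by (simp add: cong_level_def)

lemma cong_level_sym: "cong_level D N z z' \<Longrightarrow> cong_level D N z' z"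
  by (simp add: cong_level_def)

lemma cong_level_trans: "cong_level D N x y \<Longrightarrow> cong_level D N y z \<Longrightarrow> cong_level D N x z"
  by (simp add: cong_level_def)

lemma cong_level_mono: "cong_level D N x y \<Longrightarrow> M \<le> N \<Longrightarrow> cong_level D M x y"
  unfolding cong_level_def by (metis residue_mod_le)

lemma cong_level_0 [simp]: "cong_level D 0 x y"
  unfolding cong_level_def using residue_bounds[of _ 0] by (smt (verit) power_0)

lemma cong_level_all_imp_eq:
  assumes "\<And>N. cong_level D N x y" "x \<in> vecs D" "y \<in> vecs D"
  shows "x = y"
proof (rule PiE_ext[OF assms(2,3)])
  fix i assume "i \<in> {..<D}"
  thus "x i = y i" using assms(1) by (auto simp: cong_level_def residue_inject[symmetric] fun_eq_iff)
qed

text \<open>Completeness: the limit takes its residue at level \<open>N\<close> from the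
  \<open>N\<close>-th term of the sequence.\<close>

lemma padic_int_limit:
  fixes f :: "nat \<Rightarrow> 'p :: prime_card padic_int"
  assumes "\<And>N. residue (f (Suc N)) N = residue (f N) N"
  shows "\<exists>z :: 'p padic_int. \<forall>N. residue z N = residue (f N) N"
proof -
  have "residue (Abs_padic_int (\<lambda>N. residue (f N) N) :: 'p padic_int) = (\<lambda>N. residue (f N) N)"
  proof (rule Abs_padic_int_inverse, safe)
    fix N
    show "residue (f N) N \<in> {0..<int CARD('p) ^ N}" using residue_bounds[of "f N" N] by simp
    show "residue (f (Suc N)) (Suc N) mod int CARD('p) ^ N = residue (f N) N"
      using residue_Suc[of "f (Suc N)" N] assms[of N] by simp
  qed
  thus ?thesis by (auto intro!: exI[of _ "Abs_padic_int (\<lambda>N. residue (f N) N) :: 'p padic_int"])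
qed

lemma cong_level_limit:
  fixes f :: "nat \<Rightarrow> nat \<Rightarrow> 'p :: prime_card padic_int"
  assumes "\<And>N. cong_level D N (f (Suc N)) (f N)"
  shows "\<exists>z\<in>vecs D. \<forall>N. cong_level D N z (f N)"
proof -
  have "\<forall>i\<in>{..<D}. \<exists>z :: 'p padic_int. \<forall>N. residue z N = residue (f N i) N"
    using assms by (intro ballI padic_int_limit) (auto simp: cong_level_def)
  from bchoice[OF this] obtain z :: "nat \<Rightarrow> 'p padic_int"
    where "\<And>i N. i < D \<Longrightarrow> residue (z i) N = residue (f N i) N" by auto
  hence "\<forall>N. cong_level D N (restrict z {..<D}) (f N)" by (auto simp: cong_level_def)
  thus ?thesis by (intro bexI[of _ "restrict z {..<D}"]) auto
qed

text \<open>An isometry for the maximum norm. Preserving congruences gives induced maps modulo each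
  p^N, and reflecting them makes these maps injective. Surjectivity is a consequence, see
  \<open>isometry_surj\<close>.\<close>

definition isometry :: "nat \<Rightarrow> ((nat \<Rightarrow> 'p :: prime_card padic_int) \<Rightarrow> nat \<Rightarrow> 'p padic_int) \<Rightarrow> bool" where
  "isometry D \<Psi> \<longleftrightarrow> \<Psi> ` vecs D \<subseteq> vecs D \<and>
     (\<forall>z\<in>vecs D. \<forall>z'\<in>vecs D. \<forall>N. cong_level D N (\<Psi> z) (\<Psi> z') \<longleftrightarrow> cong_level D N z z')"

lemma residue_of_int_small: "0 \<le> a \<Longrightarrow> a < int CARD('p) ^ N \<Longrightarrow> residue (of_int a :: 'p :: prime_card padic_int) N = a"
  by (simp add: residue_of_int)

text \<open>Modulo p^N the isometry induces an injective map of the finite set of residue vectors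
  into itself, which must be onto.\<close>

lemma isometry_surj_level:
  fixes \<Psi> :: "(nat \<Rightarrow> 'p :: prime_card padic_int) \<Rightarrow> nat \<Rightarrow> 'p padic_int"
  assumes "isometry D \<Psi>" "y \<in> vecs D"
  shows "\<exists>z\<in>vecs D. cong_level D N (\<Psi> z) y"
proof -
  define A where "A = (PiE {..<D} (\<lambda>_. {0..<int CARD('p) ^ N}) :: (nat \<Rightarrow> int) set)"
  define r where "r = (\<lambda>z :: nat \<Rightarrow> 'p padic_int. restrict (\<lambda>i. residue (z i) N) {..<D})"
  define s where "s = (\<lambda>a :: nat \<Rightarrow> int. restrict (\<lambda>i. of_int (a i) :: 'p padic_int) {..<D})"
  have rA: "r z \<in> A" for z using residue_bounds[of _ N] by (auto simp: r_def A_def)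
  have s: "s a \<in> vecs D" for a by (auto simp: s_def)
  have rs: "r (s a) = a" if "a \<in> A" for a
    using that by (auto simp: r_def s_def A_def PiE_iff residue_of_int_small extensional_def fun_eq_iff)
  have r_eq: "r z = r z' \<longleftrightarrow> cong_level D N z z'" for z z'
    by (auto simp: r_def cong_level_def fun_eq_iff restrict_def)
  have fin: "finite A" unfolding A_def by (intro finite_PiE) auto
  have "inj_on (\<lambda>a. r (\<Psi> (s a))) A"
  proof (rule inj_onI)
    fix a b assume ab: "a \<in> A" "b \<in> A" "r (\<Psi> (s a)) = r (\<Psi> (s b))"
    hence "cong_level D N (s a) (s b)" using assms(1) s by (simp add: r_eq isometry_def)
    hence "r (s a) = r (s b)" by (simp add: r_eq)
    thus "a = b" using ab rs by simp
  qed
  hence "(\<lambda>a. r (\<Psi> (s a))) ` A = A"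
    using fin rA by (intro endo_inj_surj) auto
  then obtain a where "a \<in> A" "r (\<Psi> (s a)) = r y" using rA[of y] by (metis (no_types, lifting) imageE)
  thus ?thesis using s r_eq by blast
qed

text \<open>Preimages modulo each p^N form a Cauchy sequence, because an isometry reflects
  congruences; completeness supplies the exact preimage.\<close>

lemma isometry_surj:
  assumes "isometry D \<Psi>" "y \<in> vecs D"
  shows "\<exists>z\<in>vecs D. \<Psi> z = y"
proof -
  obtain f where f: "\<And>N. f N \<in> vecs D" "\<And>N. cong_level D N (\<Psi> (f N)) y"
    using isometry_surj_level[OF assms] by metis
  have "cong_level D N (f (Suc N)) (f N)" for N
  proof -
    have "cong_level D N (\<Psi> (f (Suc N))) y" by (rule cong_level_mono[OF f(2)]) simp
    hence "cong_level D N (\<Psi> (f (Suc N))) (\<Psi> (f N))"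
      using f(2) cong_level_sym cong_level_trans by blast
    thus ?thesis using assms(1) f(1) by (simp add: isometry_def)
  qed
  from cong_level_limit[OF this] obtain z where z: "z \<in> vecs D" "\<And>N. cong_level D N z (f N)" by blast
  have "cong_level D N (\<Psi> z) y" for N
  proof -
    have "cong_level D N (\<Psi> z) (\<Psi> (f N))" using assms(1) z f(1) by (simp add: isometry_def)
    thus ?thesis using f(2) by (rule cong_level_trans)
  qed
  moreover have "\<Psi> z \<in> vecs D" using assms(1) z by (auto simp: isometry_def)
  ultimately show ?thesis using assms(2) z cong_level_all_imp_eq by blast
qed

lemma isometry_bij_betw:
  assumes "isometry D \<Psi>"
  shows "bij_betw \<Psi> (vecs D) (vecs D)"
  unfolding bij_betw_def
proof
  show "inj_on \<Psi> (vecs D)"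
    by (rule inj_onI) (metis assms cong_level_all_imp_eq cong_level_refl isometry_def)
  show "\<Psi> ` vecs D = vecs D"
    using assms isometry_surj[OF assms] by (auto simp: isometry_def)
qed

lemma isometry_the_inv_into:
  assumes "isometry D \<Psi>"
  shows "isometry D (the_inv_into (vecs D) \<Psi>)"
proof -
  note bij = isometry_bij_betw[OF assms]
  define \<Phi> where "\<Phi> = the_inv_into (vecs D) \<Psi>"
  have 1: "\<Phi> z \<in> vecs D" "\<Psi> (\<Phi> z) = z" if "z \<in> vecs D" for z
    using that bij unfolding \<Phi>_def
    by (metis bij_betw_def order_refl the_inv_into_into, metis bij_betw_def f_the_inv_into_f)
  show ?thesis unfolding \<Phi>_def[symmetric] isometry_def
  proof (intro conjI ballI allI)
    show "\<Phi> ` vecs D \<subseteq> vecs D" using 1 by blast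
    fix z z' :: "nat \<Rightarrow> 'a padic_int" and N assume "z \<in> vecs D" "z' \<in> vecs D"
    thus "cong_level D N (\<Phi> z) (\<Phi> z') = cong_level D N z z'"
      using assms 1[of z] 1[of z'] unfolding isometry_def by metis
  qed
qed

lemma const_power_dvd_pol_iff:
  "[:pZ ^ N:] dvd (pol D z - pol D z') \<longleftrightarrow> cong_level D N z z'"
  by (auto simp: const_poly_dvd_iff cong_level_def residue_eq_iff)

lemma pol_coeff: "degree P < D \<Longrightarrow> pol D (coeff P) = P"
  by (auto simp: poly_eq_iff coeff_eq_0)

lemma pol_cong: "(\<And>i. i < D \<Longrightarrow> z i = z' i) \<Longrightarrow> pol D z = pol D z'"
  by (auto simp: poly_eq_iff)

lemma degree_pol_le: "degree (pol (Suc n) z) \<le> n"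
  by (intro degree_le) auto

lemma degree_pol_less: "n > 0 \<Longrightarrow> degree (pol n z) < n"
  using degree_pol_le[of "n - 1" z] by simp

text \<open>Hensel lifting of a factorization in coordinates: $(H + pX^sw)(U_0 + pu) = P_0 + p\,\Psi(w, u)$.
  The case $s = 1$ is used to split off the roots of absolute value greater than 1.\<close>

locale hensel_map =
  fixes n k s :: nat and H U0 P0 :: "'p :: prime_card padic_int poly"
  assumes k_le: "k \<le> n" and s_le: "s \<le> 1"
    and degree_H: "degree H \<le> k" and degree_U0: "degree U0 \<le> n - k" and degree_P0: "degree P0 \<le> n"
    and cong_P0: "[:pZ:] dvd H * U0 - P0"
    and inj: "\<And>a b. \<lbrakk>\<And>i. i \<ge> k \<Longrightarrow> coeff a i = 0; \<And>i. i \<ge> Suc n - k \<Longrightarrow> coeff b i = 0;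
       Polynomial.monom 1 s * a * map_poly red U0 + map_poly red H * b = 0\<rbrakk> \<Longrightarrow> a = 0 \<and> b = 0"
begin

definition hw :: "(nat \<Rightarrow> 'p padic_int) \<Rightarrow> 'p padic_int poly" where
  "hw z = pol k z"

definition hu :: "(nat \<Rightarrow> 'p padic_int) \<Rightarrow> 'p padic_int poly" where
  "hu z = pol (Suc n - k) (\<lambda>i. z (k + i))"

text \<open>The product minus \<open>P0\<close>, divided by p. The \<open>SOME\<close> term is the
  constant part. The part linear in \<open>w\<close> and \<open>u\<close> is the derivative of
  multiplication at the given factorization, and the quadratic part keeps a factor p, so it
  disappears modulo p.\<close>

definition hv :: "(nat \<Rightarrow> 'p padic_int) \<Rightarrow> 'p padic_int poly" where
  "hv z = (SOME g. H * U0 - P0 = smult pZ g) + Polynomial.monom 1 s * hw z * U0 + H * hu z +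
     smult pZ (Polynomial.monom 1 s * hw z * hu z)"

definition Psi :: "(nat \<Rightarrow> 'p padic_int) \<Rightarrow> nat \<Rightarrow> 'p padic_int" where
  "Psi z = restrict (coeff (hv z)) {..<Suc n}"

lemma degree_monom_hw: "hw z = 0 \<or> degree (Polynomial.monom 1 s * hw z) + (n - k) \<le> n"
proof (cases "k = 0")
  \<comment> \<open>Here \<open>w\<close> has no coefficients at all. The case is separate because
    X^s alone may have degree 1, exceeding k = 0.\<close>
  case True
  have "hw z = 0" unfolding hw_def pol_def using True by simp
  thus ?thesis ..
next
  case False
  have "degree (Polynomial.monom 1 s * hw z) \<le> s + degree (hw z)"
    by (rule order_trans[OF degree_mult_le add_right_mono[OF degree_monom_le]])
  also have "\<dots> \<le> k" using degree_pol_less[of k z] False s_le by (simp add: hw_def)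
  finally show ?thesis using k_le by arith
qed

lemma degree_hu: "degree (hu z) \<le> n - k"
  unfolding hu_def using degree_pol_le[of "n - k"] k_le by (simp add: Suc_diff_le)

lemma degree_hv: "degree (hv z) \<le> n"
proof -
  have "\<exists>g. H * U0 - P0 = smult pZ g" using cong_P0 by (auto elim!: dvdE)
  hence g: "H * U0 - P0 = smult pZ (SOME g. H * U0 - P0 = smult pZ g)" by (rule someI_ex)
  have "degree (H * U0) \<le> n" using degree_H degree_U0 k_le degree_mult_le[of H U0] by linarith
  hence "degree (H * U0 - P0) \<le> n" using degree_P0 by (intro degree_diff_le) auto
  hence 1: "degree (SOME g. H * U0 - P0 = smult pZ g) \<le> n"
    by (subst (asm) g) simp
  have "degree (H * hu z) \<le> n" using degree_H degree_hu[of z] k_le degree_mult_le[of H "hu z"] by linarith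
  moreover have "degree (Polynomial.monom 1 s * hw z * Q) \<le> n" if "degree Q \<le> n - k" for Q
    using degree_monom_hw[of z] that degree_mult_le[of "Polynomial.monom 1 s * hw z" Q] by auto
  ultimately show ?thesis unfolding hv_def using 1 degree_U0 degree_hu
    by (intro degree_add_le) (auto intro: order_trans[OF degree_smult_le])
qed

lemma hensel_eq:
  "(H + smult pZ (Polynomial.monom 1 s * hw z)) * (U0 + smult pZ (hu z)) = P0 + smult pZ (pol (Suc n) (Psi z))"
proof -
  have "\<exists>g. H * U0 - P0 = smult pZ g" using cong_P0 by (auto elim!: dvdE)
  hence g: "H * U0 - P0 = smult pZ (SOME g. H * U0 - P0 = smult pZ g)" by (rule someI_ex)
  have "pol (Suc n) (Psi z) = pol (Suc n) (coeff (hv z))"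
    by (intro pol_cong) (auto simp: Psi_def)
  also have "\<dots> = hv z" using degree_hv[of z] by (intro pol_coeff) simp
  finally have "P0 + smult pZ (pol (Suc n) (Psi z)) = P0 + smult pZ (hv z)" by simp
  also have "\<dots> = P0 + smult pZ (SOME g. H * U0 - P0 = smult pZ g) + smult pZ (Polynomial.monom 1 s * hw z * U0 + H * hu z +
     smult pZ (Polynomial.monom 1 s * hw z * hu z))"
    by (simp add: hv_def smult_add_right)
  also have "P0 + smult pZ (SOME g. H * U0 - P0 = smult pZ g) = H * U0"
    unfolding g[symmetric] by simp
  finally show ?thesis by (simp add: algebra_simps smult_add_right)
qed

lemma hv_diff:
  "hv z - hv z' = Polynomial.monom 1 s * (hw z - hw z') * U0 + H * (hu z - hu z') +
     smult pZ (Polynomial.monom 1 s * (hw z * (hu z - hu z') + (hw z - hw z') * hu z'))"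
  unfolding hv_def by (simp add: algebra_simps smult_add_right smult_diff_right)

lemma cong_level_iff_parts:
  "cong_level (Suc n) N z z' \<longleftrightarrow> [:pZ ^ N:] dvd hw z - hw z' \<and> [:pZ ^ N:] dvd hu z - hu z'"
proof -
  have "cong_level (Suc n) N z z' \<longleftrightarrow> cong_level k N z z' \<and> cong_level (Suc n - k) N (\<lambda>i. z (k + i)) (\<lambda>i. z' (k + i))"
  proof (intro iffI conjI)
    assume *: "cong_level k N z z' \<and> cong_level (Suc n - k) N (\<lambda>i. z (k + i)) (\<lambda>i. z' (k + i))"
    show "cong_level (Suc n) N z z'" unfolding cong_level_def
    proof (intro allI impI)
      fix i assume i: "i < Suc n"
      show "residue (z i) N = residue (z' i) N"
      proof (cases "i < k")
        case False
        hence "i - k < Suc n - k" using i by simp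
        thus ?thesis using * False unfolding cong_level_def by (metis le_add_diff_inverse not_less)
      qed (use * in \<open>auto simp: cong_level_def\<close>)
    qed
  qed (use k_le in \<open>auto simp: cong_level_def\<close>)
  thus ?thesis by (simp add: hw_def hu_def const_power_dvd_pol_iff)
qed

text \<open>Modulo p the difference of two values is the linear map in the assumption
  \<open>inj\<close>, applied to the difference of the arguments. If the values agree modulo
  p^(N+1), the arguments agree modulo p^N by induction; cancelling p^N and reducing,
  \<open>inj\<close> gains one more power of p.\<close>

lemma isometry_Psi: "isometry (Suc n) Psi"
  unfolding isometry_def
proof (intro conjI ballI allI)
  show "Psi ` vecs (Suc n) \<subseteq> vecs (Suc n)" by (auto simp: Psi_def)
  fix z z' :: "nat \<Rightarrow> 'p padic_int" and N
  have "cong_level (Suc n) N (Psi z) (Psi z') \<longleftrightarrow> cong_level (Suc n) N (coeff (hv z)) (coeff (hv z'))"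
    by (simp add: cong_level_def Psi_def)
  hence 1: "cong_level (Suc n) N (Psi z) (Psi z') \<longleftrightarrow> [:pZ ^ N:] dvd hv z - hv z'"
    using degree_hv[of z] degree_hv[of z'] by (simp add: const_power_dvd_pol_iff[symmetric] pol_coeff)
  have 2: "[:pZ ^ N:] dvd hv z - hv z' \<longleftrightarrow> [:pZ ^ N:] dvd hw z - hw z' \<and> [:pZ ^ N:] dvd hu z - hu z'"
  proof
    assume *: "[:pZ ^ N:] dvd hw z - hw z' \<and> [:pZ ^ N:] dvd hu z - hu z'"
    have **: "Q dvd smult pZ Y" if "Q dvd Y" for Q Y :: "'p padic_int poly" using that by (rule dvd_smult)
    show "[:pZ ^ N:] dvd hv z - hv z'" unfolding hv_diff
      by (intro dvd_add dvd_mult2 dvd_mult ** conjunct1[OF *] conjunct2[OF *])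
  next
    show "[:pZ ^ N:] dvd hv z - hv z' \<Longrightarrow> [:pZ ^ N:] dvd hw z - hw z' \<and> [:pZ ^ N:] dvd hu z - hu z'"
    proof (induction N)
      case 0
      thus ?case by (simp add: const_poly_dvd_iff)
    next
      case (Suc N)
      have "[:pZ ^ N:] dvd [:pZ ^ Suc N :: 'p padic_int:]" by (simp add: const_poly_dvd_iff coeff_pCons split: nat.split)
      with Suc.prems have "[:pZ ^ N:] dvd hv z - hv z'" by (rule dvd_trans[rotated])
      from Suc.IH[OF this] obtain a b where ab: "hw z - hw z' = smult (pZ ^ N) a" "hu z - hu z' = smult (pZ ^ N) b"
        by (auto elim!: dvdE)
      define R where "R = Polynomial.monom 1 s * a * U0 + H * b + smult pZ (Polynomial.monom 1 s * (hw z * b + a * hu z'))"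
      have "hv z - hv z' = smult (pZ ^ N) R"
        unfolding hv_diff ab R_def by (simp add: algebra_simps smult_add_right)
      moreover obtain Q where "hv z - hv z' = smult (pZ ^ Suc N) Q" using Suc.prems by (auto elim!: dvdE)
      ultimately have "smult (pZ ^ N) R = smult (pZ ^ N) (smult pZ Q)" by (simp add: mult.commute)
      hence "R = smult pZ Q" by (auto simp: poly_eq_iff)
      hence "map_poly red R = 0" by (simp add: red_poly_eq_0_iff)
      moreover have "map_poly red (smult pZ Y) = 0" for Y :: "'p padic_int poly" by (simp add: red_poly_eq_0_iff)
      ultimately have "Polynomial.monom 1 s * map_poly red a * map_poly red U0 + map_poly red H * map_poly red b = 0"
        by (simp add: R_def redp.hom_add redp.hom_mult map_poly_monom)
      moreover have "coeff (map_poly red a) i = 0" if "i \<ge> k" for i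
      proof -
        have "coeff (smult (pZ ^ N) a) i = 0" unfolding ab(1)[symmetric] hw_def using that by simp
        thus ?thesis by simp
      qed
      moreover have "coeff (map_poly red b) i = 0" if "i \<ge> Suc n - k" for i
      proof -
        have "coeff (smult (pZ ^ N) b) i = 0" unfolding ab(2)[symmetric] hu_def using that by simp
        thus ?thesis by simp
      qed
      ultimately have "map_poly red a = 0 \<and> map_poly red b = 0" by (intro inj)
      then obtain a' b' where "a = smult pZ a'" "b = smult pZ b'" by (auto simp: red_poly_eq_0_iff elim!: dvdE)
      hence "hw z - hw z' = [:pZ ^ Suc N:] * a'" "hu z - hu z' = [:pZ ^ Suc N:] * b'" by (simp_all add: ab mult.commute)
      thus ?case by (metis dvd_triv_left)
    qed
  qed
  show "cong_level (Suc n) N (Psi z) (Psi z') \<longleftrightarrow> cong_level (Suc n) N z z'"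
    using 1 2 cong_level_iff_parts[of N z z'] by blast
qed

end

lemma monom_1_0 [simp]: "Polynomial.monom (1 :: 'a :: comm_semiring_1) 0 = 1"
  by (simp add: monom_0)

text \<open>Injectivity: the reduction of \<open>H\<close> divides \<open>a\<close> times that of
  \<open>U0\<close>, hence divides \<open>a\<close> by coprimality, while \<open>a\<close> has
  smaller degree.\<close>

lemma hensel_map_finite:
  fixes H U0 P0 :: "'p :: prime_card padic_int poly"
  assumes "lead_coeff H = 1" "degree H \<le> n" "degree U0 \<le> n - degree H" "degree P0 \<le> n"
    and "[:pZ:] dvd H * U0 - P0" and cop: "coprime (map_poly red H) (map_poly red U0)"
  shows "hensel_map n (degree H) 0 H U0 P0"
proof
  fix a b :: "'p mod_ring poly"
  assume a: "\<And>i. i \<ge> degree H \<Longrightarrow> coeff a i = 0"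
    and ab: "Polynomial.monom 1 0 * a * map_poly red U0 + map_poly red H * b = 0"
  have H: "coeff (map_poly red H) (degree H) = 1" using assms(1) by simp
  hence "map_poly red H \<noteq> 0" by (metis coeff_0 zero_neq_one)
  have degH: "degree (map_poly red H) = degree H"
    using H by (intro antisym degree_map_poly_le le_degree) simp
  have "a * map_poly red U0 = map_poly red H * (- b)" using ab by (simp add: eq_neg_iff_add_eq_0)
  hence "map_poly red H dvd a * map_poly red U0" by simp
  hence "map_poly red H dvd a" using cop by (simp add: coprime_dvd_mult_left_iff)
  hence "a = 0" using a degH using dvd_imp_degree_le[of "map_poly red H" a] by (metis leading_coeff_0_iff)
  thus "a = 0 \<and> b = 0" using ab \<open>map_poly red H \<noteq> 0\<close> by simp
qed (use assms in auto)

text \<open>Injectivity is a degree count: X a U0 has degree above n - k unless a = 0, whereas b has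
  degree at most n - k.\<close>

lemma hensel_map_infinite:
  fixes U0 P0 :: "'p :: prime_card padic_int poly"
  assumes "k \<le> n" "degree U0 \<le> n - k" "degree P0 \<le> n"
    and "[:pZ:] dvd U0 - P0" and top: "red (coeff U0 (n - k)) \<noteq> 0"
  shows "hensel_map n k 1 1 U0 P0"
proof
  fix a b :: "'p mod_ring poly"
  assume b: "\<And>i. i \<ge> Suc n - k \<Longrightarrow> coeff b i = 0"
    and ab: "Polynomial.monom 1 1 * a * map_poly red U0 + map_poly red 1 * b = 0"
  have "a = 0"
  proof (rule ccontr)
    assume "a \<noteq> 0"
    have U: "degree (map_poly red U0) \<ge> n - k" "map_poly red U0 \<noteq> 0"
      using top by (auto intro!: le_degree simp: poly_eq_iff)
    have m: "Polynomial.monom (1 :: 'p mod_ring) 1 \<noteq> 0" by simp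
    have "degree b = degree (- (Polynomial.monom 1 1 * a * map_poly red U0))"
      using ab by (intro arg_cong[where f = degree]) (simp add: eq_neg_iff_add_eq_0 add.commute)
    also have "\<dots> = 1 + degree a + degree (map_poly red U0)"
      using \<open>a \<noteq> 0\<close> U m by (simp add: degree_mult_eq degree_monom_eq)
    finally have "degree b \<ge> Suc n - k" "b \<noteq> 0" using U(1) assms(1) by auto
    thus False using b[of "degree b"] by simp
  qed
  thus "a = 0 \<and> b = 0" using ab by simp
qed (use assms in auto)

lemma map_poly_red_lift [simp]: "map_poly red (map_poly lift h) = h"
  by (simp add: poly_eq_iff coeff_map_poly)

lemma degree_map_poly_lift [simp]: "degree (map_poly lift h) = degree h"
  by (intro degree_map_poly) simp

lemma lead_coeff_unit_root_OC:
  assumes "poly (embp U) x = 0" "red (lead_coeff U) \<noteq> 0"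
  shows "x \<in> OC"
proof -
  obtain u' where u': "lead_coeff U * u' = 1" using red_neq_0_imp_unit assms by blast
  have "emb u' * (emb (lead_coeff U) * x) \<in> OC"
    using assms by (intro OC_mult lead_coeff_times_root_OC) auto
  also have "emb u' * (emb (lead_coeff U) * x) = emb (lead_coeff U * u') * x"
    by (simp add: emb.hom_mult mult_ac)
  finally show ?thesis by (simp add: u')
qed

text \<open>The valuation ring property, without extending the valuation. A primitive equation of
  \<open>x\<close> factors as (1 + p X w) U, where the leading coefficient of \<open>U\<close> is a
  unit. Roots of \<open>U\<close> are integral, and the reciprocal of a root of the other factor
  satisfies the reversed polynomial, which is monic.\<close>

lemma OC_or_inverse_OC:
  fixes x :: "'p :: prime_card padic_closure"
  shows "x \<in> OC \<or> (x \<noteq> 0 \<and> 1 / x \<in> OC)"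
proof -
  obtain F' :: "'p padic_int poly" where F': "F' \<noteq> 0" "poly (embp F') x = 0" by (rule algebraic_over_Z)
  obtain v F where F: "F' = smult (pZ ^ v) F" "map_poly red F \<noteq> 0" using primitive_decomp[OF F'(1)] .
  have root: "poly (embp F) x = 0" using F' F(1) by (simp add: embp_smult emb_power)
  define n where "n = degree F"
  define U0 where "U0 = map_poly lift (map_poly red F)"
  \<comment> \<open>The drop of degree under reduction counts the roots to be split off at
    infinity.\<close>
  define k where "k = n - degree (map_poly red F)"
  have k: "k \<le> n" "degree (map_poly red F) = n - k"
    using degree_map_poly_le[of red F] by (auto simp: k_def n_def)
  have "red (coeff U0 (n - k)) = coeff (map_poly red U0) (n - k)" by simp
  also have "\<dots> = lead_coeff (map_poly red F)" unfolding U0_def map_poly_red_lift k(2) ..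
  also have "\<dots> \<noteq> 0" using F(2) by (rule leading_coeff_neq_0)
  finally have U0: "red (coeff U0 (n - k)) \<noteq> 0" .
  interpret hensel_map n k 1 1 U0 F
    by (rule hensel_map_infinite) (use k U0 in \<open>auto simp: U0_def n_def redp.hom_minus simp flip: red_poly_eq_0_iff\<close>)
  \<comment> \<open>Surjectivity is applied to the zero vector, so that the product is
    \<open>F\<close> itself.\<close>
  obtain z where z: "z \<in> vecs (Suc n)" "Psi z = restrict (\<lambda>_. 0) {..<Suc n}"
    using isometry_surj[OF isometry_Psi, of "restrict (\<lambda>_. 0) {..<Suc n}"] by auto
  have "pol (Suc n) (Psi z) = pol (Suc n) (\<lambda>_. 0)" unfolding z(2) by (rule pol_cong) simp
  hence "pol (Suc n) (Psi z) = 0" by (simp add: pol_def)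
  hence eq: "F = (1 + smult pZ (Polynomial.monom 1 1 * pol k z)) * (U0 + smult pZ (hu z))"
    using hensel_eq[of z] by (simp add: hw_def)
  define U where "U = U0 + smult pZ (hu z)"
  have "red (coeff U (n - k)) \<noteq> 0" using U0 by (simp add: U_def red.hom_add red.hom_mult)
  moreover have "degree U \<le> n - k"
    unfolding U_def using degree_U0 degree_hu[of z] by (intro degree_add_le) (auto intro: order_trans[OF degree_smult_le])
  moreover have "degree U \<ge> n - k" using calculation(1) by (intro le_degree) auto
  ultimately have U: "red (lead_coeff U) \<noteq> 0" by (metis antisym)
  have "poly (embp U) x = 0 \<or> poly (embp (1 + smult pZ (Polynomial.monom 1 1 * pol k z))) x = 0"
    using root unfolding eq U_def[symmetric] embp_mult by auto
  thus ?thesis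
  proof
    assume "poly (embp U) x = 0"
    thus ?thesis using lead_coeff_unit_root_OC U by blast
  next
    assume "poly (embp (1 + smult pZ (Polynomial.monom 1 1 * pol k z))) x = 0"
    hence *: "1 + pC * (x * poly (embp (pol k z)) x) = 0"
      by (simp add: embp_add embp_smult embp_mult map_poly_monom poly_monom)
    have "x \<noteq> 0" using * by auto
    have "k \<noteq> 0"
    proof
      assume "k = 0"
      hence "pol k z = 0" by (simp add: pol_def)
      thus False using * by simp
    qed
    define y where "y = 1 / x"
    \<comment> \<open>Multiplication by y^k reverses the coefficients of the factor, and its
      constant term 1 becomes the leading one.\<close>
    have "0 = y ^ k * (1 + pC * (x * (\<Sum>i<k. emb (z i) * x ^ i)))"
    proof -
      have "poly (embp (pol k z)) x = (\<Sum>i<k. emb (z i) * x ^ i)"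
        by (simp add: pol_def embp.hom_sum poly_sum map_poly_monom poly_monom)
      thus ?thesis using * by simp
    qed
    also have "\<dots> = y ^ k + (\<Sum>i<k. emb (pZ * z i) * y ^ (k - 1 - i))"
    proof -
      have "y ^ k * (x * x ^ i) = y ^ (k - 1 - i)" if "i < k" for i
      proof -
        have "y ^ k = y ^ (k - 1 - i) * y ^ Suc i" using that by (subst power_add [symmetric]) simp
        moreover have "y ^ Suc i * x ^ Suc i = 1" using \<open>x \<noteq> 0\<close> by (simp add: y_def power_one_over)
        ultimately show ?thesis by (simp add: mult.assoc)
      qed
      hence "y ^ k * (pC * (x * (emb (z i) * x ^ i))) = emb (pZ * z i) * y ^ (k - 1 - i)" if "i < k" for i
        using that by (simp add: emb.hom_mult mult_ac)
      thus ?thesis by (simp add: distrib_left sum_distrib_left)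
    qed
    also have "(\<Sum>i<k. emb (pZ * z i) * y ^ (k - 1 - i)) = (\<Sum>i<k. emb (pZ * z (k - 1 - i)) * y ^ i)"
      by (rule sum.reindex_bij_witness[of _ "\<lambda>i. k - 1 - i" "\<lambda>i. k - 1 - i"]) auto
    also have "y ^ k + (\<Sum>i<k. emb (pZ * z (k - 1 - i)) * y ^ i) = poly (embp (Polynomial.monom 1 k + pol k (\<lambda>i. pZ * z (k - 1 - i)))) y"
      by (simp add: embp_add pol_def embp.hom_sum poly_sum map_poly_monom poly_monom emb.hom_mult)
    finally have "poly (embp (Polynomial.monom 1 k + pol k (\<lambda>i. pZ * z (k - 1 - i)))) y = 0" by simp
    moreover have "degree (Polynomial.monom 1 k + pol k (\<lambda>i. pZ * z (k - 1 - i))) = k"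
      by (intro antisym degree_le le_degree) auto
    hence "lead_coeff (Polynomial.monom 1 k + pol k (\<lambda>i. pZ * z (k - 1 - i))) = 1" by simp
    ultimately have "y \<in> OC" unfolding mem_OC_iff by blast
    thus ?thesis using \<open>x \<noteq> 0\<close> by (simp add: y_def)
  qed
qed

section \<open>Haar measure on coefficient vectors\<close>

definition cyl :: "nat \<Rightarrow> nat \<Rightarrow> (nat \<Rightarrow> 'p :: prime_card padic_int) \<Rightarrow> (nat \<Rightarrow> 'p padic_int) set" where
  "cyl D N a = {z \<in> vecs D. cong_level D N z a}"

text \<open>An intersection-stable generator of the product sigma-algebra: two balls are nested or
  disjoint, the latter giving the empty set. Starting at level 1 puts each ball inside one residue
  class modulo p, as \<open>emeasure_digits\<close> requires.\<close>

definition cyls :: "nat \<Rightarrow> (nat \<Rightarrow> 'p :: prime_card padic_int) set set" where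
  "cyls D = insert {} {cyl D N a | N a. N \<ge> 1}"

definition level_inv :: "nat \<Rightarrow> nat \<Rightarrow> (nat \<Rightarrow> 'p :: prime_card padic_int) set \<Rightarrow> bool" where
  "level_inv D N S \<longleftrightarrow> S \<subseteq> vecs D \<and> (\<forall>z\<in>S. \<forall>z'\<in>vecs D. cong_level D N z z' \<longrightarrow> z' \<in> S)"

lemma finite_level_reps:
  "\<exists>A :: (nat \<Rightarrow> 'p :: prime_card padic_int) set. finite A \<and> A \<subseteq> vecs D \<and> (\<forall>z. \<exists>a\<in>A. cong_level D N z a)"
proof -
  define A where "A = (\<lambda>a :: nat \<Rightarrow> int. restrict (\<lambda>i. of_int (a i) :: 'p padic_int) {..<D}) ` PiE {..<D} (\<lambda>_. {0..<int CARD('p) ^ N})"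
  have "\<exists>a\<in>A. cong_level D N z a" for z :: "nat \<Rightarrow> 'p padic_int"
  proof -
    define b where "b = restrict (\<lambda>i. residue (z i) N) {..<D}"
    have "b \<in> PiE {..<D} (\<lambda>_. {0..<int CARD('p) ^ N})"
      using residue_bounds[of _ N] by (auto simp: b_def)
    moreover have "cong_level D N z (restrict (\<lambda>i. of_int (b i)) {..<D})"
      by (simp add: cong_level_def residue_of_int_small residue_bounds b_def)
    ultimately show ?thesis unfolding A_def by (intro bexI[OF _ imageI])
  qed
  moreover have "finite A" unfolding A_def by (intro finite_imageI finite_PiE) auto
  moreover have "A \<subseteq> vecs D" by (auto simp: A_def)
  ultimately show ?thesis by blast
qed

lemma level_inv_Un_cyls:
  assumes "level_inv D N S" "N \<ge> 1"
  shows "\<exists>\<C>. finite \<C> \<and> \<C> \<subseteq> cyls D \<and> S = \<Union>\<C>"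
proof -
  obtain A :: "(nat \<Rightarrow> 'a padic_int) set" where A: "finite A" "A \<subseteq> vecs D" "\<And>z. \<exists>a\<in>A. cong_level D N z a"
    using finite_level_reps by metis
  have "S = \<Union>(cyl D N ` (A \<inter> S))"
  proof (intro equalityI subsetI)
    fix z assume z: "z \<in> S"
    obtain a where a: "a \<in> A" "cong_level D N z a" using A(3) by blast
    hence "a \<in> S" using assms(1) z A(2) by (auto simp: level_inv_def)
    moreover have "z \<in> vecs D" using assms(1) z by (auto simp: level_inv_def)
    ultimately show "z \<in> \<Union>(cyl D N ` (A \<inter> S))" using a by (auto simp: cyl_def)
  next
    fix z assume "z \<in> \<Union>(cyl D N ` (A \<inter> S))"
    then obtain a where a: "a \<in> S" "z \<in> vecs D" "cong_level D N z a" by (auto simp: cyl_def)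
    have "cong_level D N a z" using a(3) by (rule cong_level_sym)
    thus "z \<in> S" using a assms(1) by (auto simp: level_inv_def)
  qed
  moreover have "cyl D N ` (A \<inter> S) \<subseteq> cyls D" using assms(2) by (auto simp: cyls_def)
  moreover have "finite (cyl D N ` (A \<inter> S))" using A(1) by simp
  ultimately show ?thesis by (intro exI[of _ "cyl D N ` (A \<inter> S)"]) simp
qed

lemma level_inv_sigma_cyls: "level_inv D N S \<Longrightarrow> N \<ge> 1 \<Longrightarrow> S \<in> sigma_sets (vecs D) (cyls D)"
proof -
  assume "level_inv D N S" "N \<ge> 1"
  then obtain C where C: "finite C" "C \<subseteq> cyls D" "S = \<Union>C" using level_inv_Un_cyls[of D N S] by blast
  show ?thesis unfolding C(3)
    using C(1,2) by (intro sigma_sets_UNION countable_finite) (auto intro: sigma_sets.Basic)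
qed

lemma level_inv_vimage_cong:
  assumes "\<And>z z'. z \<in> vecs D \<Longrightarrow> z' \<in> vecs D \<Longrightarrow> cong_level D N z z' \<Longrightarrow> cong_level E N (f z) (f z')"
  shows "level_inv D N {z \<in> vecs D. cong_level E N (f z) a}"
  unfolding level_inv_def
proof (intro conjI ballI impI CollectI)
  fix z z' assume z: "z \<in> {z \<in> vecs D. cong_level E N (f z) a}" "z' \<in> vecs D" "cong_level D N z z'"
  hence "cong_level E N (f z) (f z')" using assms by simp
  thus "cong_level E N (f z') a" using z(1) by (simp add: cong_level_def)
qed auto

lemma open_residue: "open {y :: 'p :: prime_card padic_int. residue y N \<in> A}"
  unfolding open_padic_int_def by (intro ballI exI[of _ N]) auto

lemma finite_degree_le: "finite {h :: 'p :: prime_card mod_ring poly. degree h \<le> n}"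
proof (rule finite_subset)
  show "{h :: 'p mod_ring poly. degree h \<le> n} \<subseteq> Poly ` {xs. set xs \<subseteq> UNIV \<and> length xs \<le> Suc n}"
  proof
    fix h :: "'p mod_ring poly" assume "h \<in> {h. degree h \<le> n}"
    hence "length (coeffs h) \<le> Suc n" by (cases "h = 0") (auto simp: length_coeffs_degree)
    thus "h \<in> Poly ` {xs. set xs \<subseteq> UNIV \<and> length xs \<le> Suc n}"
      by (intro image_eqI[of _ _ "coeffs h"]) auto
  qed
  show "finite (Poly ` {xs :: 'p mod_ring list. set xs \<subseteq> UNIV \<and> length xs \<le> Suc n})"
    by (intro finite_imageI finite_lists_length_le) auto
qed

section \<open>The product of Haar probability measures\<close>

locale padic_haar =
  fixes \<mu> :: "'p :: prime_card padic_int measure"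
  assumes haar: "haar_probability \<mu>"
begin

abbreviation V :: "nat \<Rightarrow> (nat \<Rightarrow> 'p padic_int) measure" where "V D \<equiv> PiM {..<D} (\<lambda>_. \<mu>)"

sublocale prob_space \<mu> using haar by (simp add: haar_probability_def)

lemma sets_mu [measurable_cong, simp]: "sets \<mu> = sets borel" using haar by (simp add: haar_probability_def)

lemma space_mu [simp]: "space \<mu> = UNIV" using sets_eq_imp_space_eq[OF sets_mu] by simp

sublocale prod: product_prob_space "\<lambda>_ :: nat. \<mu>" "{..<D}" for D :: nat
  by unfold_locales

lemma prob_space_V: "prob_space (V D)"
  by (rule prob_space_PiM) unfold_locales

lemma space_V [simp]: "space (V D) = vecs D" by (simp add: space_PiM)

lemma ball_borel [measurable]: "{y :: 'p padic_int. residue y N = a} \<in> sets borel"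
  using borel_open[OF open_residue[of N "{a}"]] by simp

text \<open>The p^N balls of level \<open>N\<close> are translates of each other and partition a
  space of total mass 1.\<close>

lemma emeasure_ball:
  assumes "a \<in> {0..<int CARD('p) ^ N}"
  shows "emeasure \<mu> {y. residue y N = a} = ennreal (1 / real CARD('p) ^ N)"
proof -
  let ?p = "int CARD('p)"
  have transl: "emeasure \<mu> {y. residue y N = b} = emeasure \<mu> {y. residue y N = 0}" if b: "b \<in> {0..<?p ^ N}" for b
  proof -
    have m: "(\<lambda>x. of_int b + x) \<in> borel_measurable \<mu>"
    proof (rule borel_measurableI)
      fix S :: "'p padic_int set" assume "open S"
      have "open ((\<lambda>x. of_int b + x) -` S)"
        unfolding open_padic_int_def
      proof
        fix x assume "x \<in> (\<lambda>x. of_int b + x) -` S"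
        then obtain n where n: "\<And>y. residue y n = residue (of_int b + x) n \<Longrightarrow> y \<in> S"
          using \<open>open S\<close> by (auto simp: open_padic_int_def)
        show "\<exists>n. \<forall>y. residue y n = residue x n \<longrightarrow> y \<in> (\<lambda>x. of_int b + x) -` S"
          by (rule exI[of _ n]) (auto intro!: n simp: plus_padic_int.rep_eq)
      qed
      thus "(\<lambda>x. of_int b + x) -` S \<inter> space \<mu> \<in> sets \<mu>" by simp
    qed
    have "emeasure \<mu> {y. residue y N = b} = emeasure (distr \<mu> borel (\<lambda>x. of_int b + x)) {y. residue y N = b}"
      using haar by (simp add: haar_probability_def)
    also have "\<dots> = emeasure \<mu> ((\<lambda>x. of_int b + x) -` {y. residue y N = b} \<inter> space \<mu>)"
      using m by (intro emeasure_distr) auto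
    also have "(\<lambda>x. of_int b + x) -` {y. residue y N = b} \<inter> space \<mu> = {y. residue y N = 0}"
    proof -
      have "residue (of_int b + x) N = b \<longleftrightarrow> residue x N = 0" for x :: "'p padic_int"
      proof -
        have "residue (of_int b + x) N = b \<longleftrightarrow> residue (of_int b + x) N = residue (of_int b :: 'p padic_int) N"
          using b by (simp add: residue_of_int_small)
        also have "\<dots> \<longleftrightarrow> residue x N = 0" by (simp add: residue_eq_iff residue_eq_0_iff)
        finally show ?thesis .
      qed
      thus ?thesis by auto
    qed
    finally show ?thesis .
  qed
  have "1 = emeasure \<mu> (\<Union>b\<in>{0..<?p ^ N}. {y. residue y N = b})"
  proof -
    have "(\<Union>b\<in>{0..<?p ^ N}. {y :: 'p padic_int. residue y N = b}) = UNIV"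
      using residue_bounds[of _ N] by auto
    thus ?thesis using emeasure_space_1 by simp
  qed
  also have "\<dots> = (\<Sum>b\<in>{0..<?p ^ N}. emeasure \<mu> {y. residue y N = b})"
    by (rule sum_emeasure [symmetric]) (auto simp: disjoint_family_on_def)
  also have "\<dots> = (\<Sum>b\<in>{0..<?p ^ N}. emeasure \<mu> {y. residue y N = 0})"
    by (intro sum.cong refl transl)
  also have "\<dots> = of_nat (CARD('p) ^ N) * emeasure \<mu> {y. residue y N = 0}"
    by (simp add: nat_power_eq)
  also have "emeasure \<mu> {y. residue y N = 0} = ennreal (measure \<mu> {y. residue y N = 0})"
    by (rule emeasure_eq_measure)
  finally have "1 = ennreal (real CARD('p) ^ N * measure \<mu> {y. residue y N = 0})"
    by (simp add: ennreal_mult ennreal_of_nat_eq_real_of_nat)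
  hence "ennreal (real CARD('p) ^ N * measure \<mu> {y. residue y N = 0}) = 1" by (rule sym)
  hence "real CARD('p) ^ N * measure \<mu> {y. residue y N = 0} = 1"
    by (simp only: ennreal_eq_1)
  hence "measure \<mu> {y. residue y N = 0} = 1 / real CARD('p) ^ N" by (auto simp: field_simps)
  hence "emeasure \<mu> {y. residue y N = 0} = ennreal (1 / real CARD('p) ^ N)"
    by (simp only: emeasure_eq_measure)
  thus ?thesis using transl[OF assms] by (rule trans[rotated])
qed

lemma cyl_eq_PiE: "cyl D N a = PiE {..<D} (\<lambda>i. {y. residue y N = residue (a i) N})"
  by (rule Set.set_eqI, unfold cyl_def cong_level_def mem_Collect_eq PiE_iff, blast)

lemma cyl_sets [measurable]: "cyl D N a \<in> sets (V D)"
  unfolding cyl_eq_PiE by (intro sets_PiM_I_finite) auto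

lemma emeasure_cyl: "emeasure (V D) (cyl D N a) = ennreal (1 / real CARD('p) ^ (N * D))"
proof -
  have "emeasure (V D) (cyl D N a) = (\<Prod>i<D. emeasure \<mu> {y. residue y N = residue (a i) N})"
    unfolding cyl_eq_PiE by (subst prod.emeasure_PiM) auto
  also have "\<dots> = (\<Prod>i<D. ennreal (1 / real CARD('p) ^ N))"
    by (intro prod.cong refl emeasure_ball) (simp add: residue_bounds)
  also have "\<dots> = ennreal ((1 / real CARD('p) ^ N) ^ D)"
    by (simp add: ennreal_power)
  finally show ?thesis by (simp add: power_one_over power_mult)
qed

lemma Int_stable_cyls: "Int_stable (cyls D :: (nat \<Rightarrow> 'p padic_int) set set)"
proof (rule Int_stableI)
  have aux: "cyl D N a \<inter> cyl D M b \<in> cyls D" if "N \<ge> 1" "N \<le> M" for N M and a b :: "nat \<Rightarrow> 'p padic_int"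
  proof (cases "cong_level D N a b")
    case True
    hence "cyl D N a \<inter> cyl D M b = cyl D M b"
      using cong_level_trans[OF cong_level_mono[OF _ \<open>N \<le> M\<close>] cong_level_sym[OF True]] unfolding cyl_def by blast
    thus ?thesis using that by (auto simp: cyls_def)
  next
    case False
    hence "cyl D N a \<inter> cyl D M b = {}"
      using cong_level_trans[OF cong_level_sym cong_level_mono[OF _ \<open>N \<le> M\<close>]] unfolding cyl_def by blast
    thus ?thesis by (simp add: cyls_def)
  qed
  fix S T :: "(nat \<Rightarrow> 'p padic_int) set" assume ST: "S \<in> cyls D" "T \<in> cyls D"
  show "S \<inter> T \<in> cyls D"
  proof (cases "S = {} \<or> T = {}")
    case True
    thus ?thesis by (auto simp: cyls_def)
  next
    case False
    then obtain N a M b where "S = cyl D N a" "T = cyl D M b" "N \<ge> 1" "M \<ge> 1" using ST by (auto simp: cyls_def)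
    thus ?thesis using aux[of N M a b] aux[of M N b a] by (cases "N \<le> M") (auto simp: Int_commute)
  qed
qed

lemma cyls_subset: "cyls D \<subseteq> Pow (vecs D)"
  by (auto simp: cyls_def cyl_def)

lemma sets_V: "sets (V D) = sigma_sets (vecs D) (cyls D)"
proof (rule antisym)
  define M where "M = sigma (vecs D) (cyls D :: (nat \<Rightarrow> 'p padic_int) set set)"
  have M: "sets M = sigma_sets (vecs D) (cyls D)" "space M = vecs D"
    unfolding M_def using cyls_subset by (rule sets_measure_of) (rule space_measure_of[OF cyls_subset])
  have coord: "(\<lambda>z. z i) \<in> borel_measurable M" if "i < D" for i
  proof (rule borel_measurableI)
    fix S :: "'p padic_int set" assume S: "open S"
    \<comment> \<open>\<open>W N\<close> collects the points whose coordinate has its ball of level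
      N + 1 inside \<open>S\<close>. These sets are level-invariant, and openness of
      \<open>S\<close> makes its preimage their union.\<close>
    define W where "W = (\<lambda>N. {z :: nat \<Rightarrow> 'p padic_int. z \<in> vecs D \<and> (\<forall>y. residue y (Suc N) = residue (z i) (Suc N) \<longrightarrow> y \<in> S)})"
    have "(\<lambda>z. z i) -` S \<inter> space M = (\<Union>N. W N)"
    proof (intro equalityI subsetI)
      fix z assume z: "z \<in> (\<lambda>z. z i) -` S \<inter> space M"
      then obtain n where "\<forall>y. residue y n = residue (z i) n \<longrightarrow> y \<in> S"
        using S by (auto simp: open_padic_int_def)
      moreover have "residue y n = residue (z i) n" if "residue y (Suc n) = residue (z i) (Suc n)" for y :: "'p padic_int"
        using that residue_Suc[of y n] residue_Suc[of "z i" n] by simp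
      ultimately have "\<forall>y. residue y (Suc n) = residue (z i) (Suc n) \<longrightarrow> y \<in> S" by blast
      hence "z \<in> W n" using z M(2) by (simp add: W_def)
      thus "z \<in> (\<Union>N. W N)" by blast
    qed (use M in \<open>auto simp: W_def\<close>)
    moreover have "W N \<in> sets M" for N
      unfolding M(1) using that
      by (intro level_inv_sigma_cyls[of _ "Suc N"]) (auto simp: level_inv_def W_def cong_level_def)
    ultimately show "(\<lambda>z. z i) -` S \<inter> space M \<in> sets M" by auto
  qed
  have "(\<lambda>z. restrict z {..<D}) \<in> M \<rightarrow>\<^sub>M V D"
    using coord by (intro measurable_restrict) auto
  also have "?this \<longleftrightarrow> (\<lambda>z. z) \<in> M \<rightarrow>\<^sub>M V D"
    by (intro measurable_cong) (auto simp: M PiE_iff extensional_restrict)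
  finally have id: "(\<lambda>z. z) \<in> M \<rightarrow>\<^sub>M V D" .
  show "sets (V D) \<subseteq> sigma_sets (vecs D) (cyls D)"
  proof
    fix S assume S: "S \<in> sets (V D)"
    from measurable_sets[OF id S] sets.sets_into_space[OF S] show "S \<in> sigma_sets (vecs D) (cyls D)"
      by (simp add: M Int_absorb2)
  qed
  show "sigma_sets (vecs D) (cyls D) \<subseteq> sets (V D)"
  proof -
    have "cyls D \<subseteq> sets (V D)" by (auto simp: cyls_def)
    from sets.sigma_sets_subset[OF this] show ?thesis by simp
  qed
qed

lemma level_inv_sets: "level_inv D N S \<Longrightarrow> S \<in> sets (V D)"
proof -
  assume S: "level_inv D N S"
  have "level_inv D (Suc N) S"
    unfolding level_inv_def
  proof (intro conjI ballI impI)
    fix z z' assume "z \<in> S" "z' \<in> vecs D" "cong_level D (Suc N) z z'"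
    moreover from this(3) have "cong_level D N z z'" by (rule cong_level_mono) simp
    ultimately show "z' \<in> S" using S by (simp add: level_inv_def)
  qed (use S in \<open>simp add: level_inv_def\<close>)
  thus ?thesis unfolding sets_V by (rule level_inv_sigma_cyls) simp
qed

lemma measure_eqI_cyls:
  assumes "sets M1 = sets (V D)" "sets M2 = sets (V D)"
    and "\<And>N a. N \<ge> 1 \<Longrightarrow> a \<in> vecs D \<Longrightarrow> emeasure M1 (cyl D N a) = emeasure M2 (cyl D N a)"
    and "\<And>N a. N \<ge> 1 \<Longrightarrow> a \<in> vecs D \<Longrightarrow> emeasure M1 (cyl D N a) \<noteq> \<infinity>"
  shows "M1 = M2"
proof -
  obtain A :: "(nat \<Rightarrow> 'p padic_int) set" where A: "finite A" "A \<subseteq> vecs D" "\<And>z. \<exists>a\<in>A. cong_level D 1 z a"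
    using finite_level_reps by metis
  have restr: "cyl D N a = cyl D N (restrict a {..<D})" for N and a :: "nat \<Rightarrow> 'p padic_int"
    by (auto simp: cyl_def cong_level_def)
  show ?thesis
  proof (rule measure_eqI_generator_eq_countable[where A = "cyl D 1 ` A"])
    show "Int_stable (cyls D :: (nat \<Rightarrow> 'p padic_int) set set)" by (rule Int_stable_cyls)
    show "cyls D \<subseteq> Pow (vecs D)" by (rule cyls_subset)
    show "sets M1 = sigma_sets (vecs D) (cyls D)" "sets M2 = sigma_sets (vecs D) (cyls D)"
      using assms sets_V by auto
    show "cyl D 1 ` A \<subseteq> cyls D" by (auto simp: cyls_def)
    show "\<Union> (cyl D 1 ` A) = vecs D" using A by (auto simp: cyl_def)
    show "countable (cyl D 1 ` A)" using A by (intro countable_finite) auto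
    show "emeasure M1 S \<noteq> \<infinity>" if "S \<in> cyl D 1 ` A" for S using that A assms(4) by auto
    show "emeasure M1 S = emeasure M2 S" if S: "S \<in> cyls D" for S
    proof (cases "S = {}")
      case False
      then obtain N a where "N \<ge> 1" "S = cyl D N a" using S by (auto simp: cyls_def)
      thus ?thesis using assms(3)[of N "restrict a {..<D}"] restr[of N a] by auto
    qed auto
  qed
qed

lemma measurable_V_level:
  assumes "f ` vecs D \<subseteq> vecs E" "\<And>N a. N \<ge> 1 \<Longrightarrow> a \<in> vecs E \<Longrightarrow> level_inv D N {z \<in> vecs D. cong_level E N (f z) a}"
  shows "f \<in> V D \<rightarrow>\<^sub>M V E"
proof -
  have "f \<in> V D \<rightarrow>\<^sub>M sigma (vecs E) (cyls E)"
  proof (rule measurable_sigma_sets[OF sets_measure_of[OF cyls_subset] cyls_subset])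
    show "f \<in> space (V D) \<rightarrow> vecs E" using assms(1) by auto
    fix S :: "(nat \<Rightarrow> 'p padic_int) set" assume S: "S \<in> cyls E"
    show "f -` S \<inter> space (V D) \<in> sets (V D)"
    proof (cases "S = {}")
      case False
      then obtain N a where Na: "N \<ge> 1" "S = cyl E N a" using S by (auto simp: cyls_def)
      have "f -` S \<inter> space (V D) = {z \<in> vecs D. cong_level E N (f z) (restrict a {..<E})}"
        using assms(1) by (auto simp: Na cyl_def cong_level_def)
      also have "\<dots> \<in> sets (V D)" using assms(2) Na by (intro level_inv_sets[of _ N]) auto
      finally show ?thesis .
    qed auto
  qed
  also have "(V D \<rightarrow>\<^sub>M sigma (vecs E) (cyls E)) = (V D \<rightarrow>\<^sub>M V E)"
    by (intro measurable_cong_sets) (auto simp: sets_V sets_measure_of[OF cyls_subset])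
  finally show ?thesis .
qed

lemma isometry_measurable:
  assumes "isometry D \<Psi>"
  shows "\<Psi> \<in> V D \<rightarrow>\<^sub>M V D"
proof (rule measurable_V_level)
  show "\<Psi> ` vecs D \<subseteq> vecs D" using assms by (simp add: isometry_def)
  fix N a
  show "level_inv D N {z \<in> vecs D. cong_level D N (\<Psi> z) a}"
    by (rule level_inv_vimage_cong) (use assms in \<open>simp add: isometry_def\<close>)
qed

text \<open>The preimage of a ball is a ball of the same level around the preimage of its centre,
  and the mass of a ball depends only on its level.\<close>

lemma isometry_distr:
  assumes "isometry D \<Psi>"
  shows "distr (V D) (V D) \<Psi> = V D"
proof (rule measure_eqI_cyls)
  note [measurable] = isometry_measurable[OF assms]
  fix N and a :: "nat \<Rightarrow> 'p padic_int" assume a: "a \<in> vecs D"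
  then obtain b where b: "b \<in> vecs D" "\<Psi> b = a" using isometry_surj[OF assms] by blast
  have "emeasure (distr (V D) (V D) \<Psi>) (cyl D N a) = emeasure (V D) (\<Psi> -` cyl D N a \<inter> space (V D))"
    by (intro emeasure_distr) auto
  also have "\<Psi> -` cyl D N a \<inter> space (V D) = cyl D N b"
    using assms b unfolding isometry_def by (auto simp: cyl_def)
  also have "emeasure (V D) (cyl D N b) = emeasure (V D) (cyl D N a)" by (simp add: emeasure_cyl)
  finally show "emeasure (distr (V D) (V D) \<Psi>) (cyl D N a) = emeasure (V D) (cyl D N a)" .
  thus "emeasure (distr (V D) (V D) \<Psi>) (cyl D N a) \<noteq> \<infinity>" by (simp add: emeasure_cyl)
qed auto

text \<open>Measurability of \<open>f\<close> is recovered from that of the composite by means of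
  the inverse isometry. Later only the composite with the Hensel map is accessible directly.\<close>

lemma isometry_borel_measurable:
  fixes f :: "(nat \<Rightarrow> 'p padic_int) \<Rightarrow> ennreal"
  assumes iso: "isometry D \<Psi>" and "(\<lambda>z. f (\<Psi> z)) \<in> borel_measurable (V D)"
  shows "f \<in> borel_measurable (V D)"
proof -
  define \<Phi> where "\<Phi> = the_inv_into (vecs D) \<Psi>"
  have [measurable]: "\<Phi> \<in> V D \<rightarrow>\<^sub>M V D" unfolding \<Phi>_def by (intro isometry_measurable isometry_the_inv_into iso)
  have "(\<lambda>z. f (\<Psi> (\<Phi> z))) \<in> borel_measurable (V D)"
    using measurable_compose[OF \<open>\<Phi> \<in> _\<close> assms(2)] .
  also have "?this \<longleftrightarrow> ?thesis"
    using isometry_bij_betw[OF iso]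
    by (intro measurable_cong) (simp add: \<Phi>_def f_the_inv_into_f_bij_betw)
  finally show ?thesis .
qed

lemma isometry_nn_integral:
  fixes f :: "(nat \<Rightarrow> 'p padic_int) \<Rightarrow> ennreal"
  assumes iso: "isometry D \<Psi>" and "(\<lambda>z. f (\<Psi> z)) \<in> borel_measurable (V D)"
  shows "(\<integral>\<^sup>+z. f z \<partial>V D) = (\<integral>\<^sup>+z. f (\<Psi> z) \<partial>V D)"
  using isometry_borel_measurable[OF assms] isometry_measurable[OF iso]
  by (subst (1) isometry_distr[OF iso, symmetric]) (simp add: nn_integral_distr)

lemma nn_integral_restrict:
  fixes f :: "(nat \<Rightarrow> 'p padic_int) \<Rightarrow> ennreal"
  assumes "k \<le> D" and [measurable]: "f \<in> borel_measurable (V k)"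
  shows "(\<integral>\<^sup>+z. f (restrict z {..<k}) \<partial>V D) = (\<integral>\<^sup>+z. f z \<partial>V k)"
proof -
  have [measurable]: "(\<lambda>z. restrict z {..<k}) \<in> V D \<rightarrow>\<^sub>M V k"
    using assms(1) by (intro measurable_restrict_subset) auto
  have "(\<integral>\<^sup>+z. f z \<partial>V k) = (\<integral>\<^sup>+z. f z \<partial>distr (V D) (V k) (\<lambda>z. restrict z {..<k}))"
    using prod.distr_PiM_restrict_finite[of "{..<k}" D] assms(1) by simp
  thus ?thesis by (simp add: nn_integral_distr)
qed

text \<open>Parametrises the vectors that reduce to the coefficients of \<open>h\<close>. For Haar
  distributed \<open>z\<close> this is the random vector conditioned on its reduction.\<close>

definition digits :: "nat \<Rightarrow> 'p mod_ring poly \<Rightarrow> (nat \<Rightarrow> 'p padic_int) \<Rightarrow> nat \<Rightarrow> 'p padic_int" where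
  "digits D h z = restrict (\<lambda>i. lift (coeff h i) + pZ * z i) {..<D}"

lemma cong_level_1_iff: 
  fixes z z' :: "nat \<Rightarrow> 'q :: prime_card padic_int"
  shows "cong_level D 1 z z' \<longleftrightarrow> (\<forall>i<D. red (z i) = red (z' i))"
proof -
  have "residue x 1 = residue y 1 \<longleftrightarrow> red x = red y" for x y :: "'q padic_int"
    using residue_eq_iff[of x 1 y] red_eq_0_iff[of "x - y"] by (simp add: red.hom_minus)
  thus ?thesis by (simp only: cong_level_def)
qed

lemma digits_measurable [measurable]: "digits D h \<in> V D \<rightarrow>\<^sub>M V D"
proof (rule measurable_V_level)
  show "digits D h ` vecs D \<subseteq> vecs D" by (auto simp: digits_def)
  fix N a
  have "cong_level D N (digits D h z) (digits D h z')" if "cong_level D N z z'" for z z'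
    unfolding cong_level_def
  proof (intro allI impI)
    fix i assume i: "i < D"
    hence "pZ ^ N dvd z i - z' i" using that by (simp add: cong_level_def residue_eq_iff)
    hence "pZ ^ N dvd pZ * (z i - z' i)" by (rule dvd_mult)
    thus "residue (digits D h z i) N = residue (digits D h z' i) N"
      using i by (simp add: residue_eq_iff digits_def right_diff_distrib)
  qed
  thus "level_inv D N {z \<in> vecs D. cong_level D N (digits D h z) a}"
    by (intro level_inv_vimage_cong)
qed

text \<open>The map contracts by the factor p: a ball of level N inside the residue class pulls back
  to one of level N - 1, whose mass is larger by the factor p^D. Balls in other classes have empty
  preimage.\<close>

lemma emeasure_digits:
  assumes "N \<ge> 1" "a \<in> vecs D"
  shows "ennreal (1 / real CARD('p) ^ D) * emeasure (distr (V D) (V D) (digits D h)) (cyl D N a) =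
    emeasure (V D) (cyl D 1 (digits D h (\<lambda>_. 0)) \<inter> cyl D N a)"
proof (cases "cong_level D 1 a (digits D h (\<lambda>_. 0))")
  case True
  have "\<exists>b. a i = lift (coeff h i) + pZ * b" if "i < D" for i
  proof -
    have "red (a i - lift (coeff h i)) = 0"
      using that True[unfolded cong_level_1_iff] by (simp add: digits_def red.hom_minus)
    then obtain b where "a i - lift (coeff h i) = pZ * b" by (auto simp: red_eq_0_iff)
    thus ?thesis by (auto simp: algebra_simps)
  qed
  hence "\<forall>i\<in>{..<D}. \<exists>b. a i = lift (coeff h i) + pZ * b" by blast
  from bchoice[OF this] obtain b where b: "\<And>i. i < D \<Longrightarrow> a i = lift (coeff h i) + pZ * b i" by auto
  obtain M where M: "N = Suc M" using assms(1) by (cases N) auto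
  have iff: "cong_level D N (digits D h z) a \<longleftrightarrow> cong_level D M z b" for z
  proof -
    have "residue (digits D h z i) N = residue (a i) N \<longleftrightarrow> residue (z i) M = residue (b i) M" if "i < D" for i
    proof -
      have "digits D h z i - a i = pZ * (z i - b i)" using that b by (simp add: digits_def algebra_simps)
      thus ?thesis by (simp add: residue_eq_iff M)
    qed
    thus ?thesis by (simp add: cong_level_def)
  qed
  have "emeasure (distr (V D) (V D) (digits D h)) (cyl D N a) = emeasure (V D) (digits D h -` cyl D N a \<inter> space (V D))"
    by (intro emeasure_distr) auto
  also have "digits D h -` cyl D N a \<inter> space (V D) = cyl D M b"
    using iff by (auto simp: cyl_def) (auto simp: digits_def)
  also have "ennreal (1 / real CARD('p) ^ D) * emeasure (V D) (cyl D M b) = emeasure (V D) (cyl D N a)"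
    by (simp add: emeasure_cyl M ennreal_mult[symmetric] power_add)
  finally have "ennreal (1 / real CARD('p) ^ D) * emeasure (distr (V D) (V D) (digits D h)) (cyl D N a) =
    emeasure (V D) (cyl D N a)" .
  moreover have "cyl D 1 (digits D h (\<lambda>_. 0)) \<inter> cyl D N a = cyl D N a"
    using cong_level_trans[OF cong_level_mono[OF _ assms(1)] True] unfolding cyl_def by blast
  ultimately show ?thesis by simp
next
  case False
  have *: "cong_level D 1 (digits D h z) (digits D h (\<lambda>_. 0))" for z
    unfolding cong_level_1_iff by (simp add: digits_def red.hom_add red.hom_mult)
  have "\<not> cong_level D N (digits D h z) a" for z
  proof
    assume "cong_level D N (digits D h z) a"
    hence "cong_level D 1 (digits D h z) a" using assms(1) by (rule cong_level_mono)
    thus False using False *[of z] by (auto simp: cong_level_def)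
  qed
  hence "digits D h -` cyl D N a \<inter> space (V D) = {}" by (auto simp: cyl_def)
  moreover have "emeasure (distr (V D) (V D) (digits D h)) (cyl D N a) = emeasure (V D) (digits D h -` cyl D N a \<inter> space (V D))"
    by (intro emeasure_distr) auto
  moreover have "cyl D 1 (digits D h (\<lambda>_. 0)) \<inter> cyl D N a = {}"
    using False cong_level_trans[OF cong_level_sym[OF cong_level_mono[OF _ assms(1)]]] unfolding cyl_def by blast
  ultimately show ?thesis by simp
qed

lemma nn_integral_coset:
  fixes f :: "(nat \<Rightarrow> 'p padic_int) \<Rightarrow> ennreal"
  assumes [measurable]: "f \<in> borel_measurable (V D)"
  shows "(\<integral>\<^sup>+z. f z * indicator (cyl D 1 (digits D h (\<lambda>_. 0))) z \<partial>V D) =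
    ennreal (1 / real CARD('p) ^ D) * (\<integral>\<^sup>+z. f (digits D h z) \<partial>V D)"
proof -
  define C where "C = cyl D 1 (digits D h (\<lambda>_. 0))"
  have [measurable]: "C \<in> sets (V D)" by (simp add: C_def)
  have "scale_measure (ennreal (1 / real CARD('p) ^ D)) (distr (V D) (V D) (digits D h)) = density (V D) (indicator C)"
  proof (rule measure_eqI_cyls)
    fix N :: nat and a :: "nat \<Rightarrow> 'p padic_int" assume Na: "N \<ge> 1" "a \<in> vecs D"
    have "emeasure (density (V D) (indicator C)) (cyl D N a) = emeasure (V D) (C \<inter> cyl D N a)"
      by (subst emeasure_density) (auto simp flip: indicator_inter_arith)
    thus "emeasure (scale_measure (ennreal (1 / real CARD('p) ^ D)) (distr (V D) (V D) (digits D h))) (cyl D N a) =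
      emeasure (density (V D) (indicator C)) (cyl D N a)"
      using emeasure_digits[OF Na, of h] by (simp add: C_def)
    have "emeasure (V D) (C \<inter> cyl D N a) \<le> emeasure (V D) (cyl D N a)" by (intro emeasure_mono) auto
    also have "\<dots> < \<infinity>" by (simp add: emeasure_cyl)
    finally show "emeasure (scale_measure (ennreal (1 / real CARD('p) ^ D)) (distr (V D) (V D) (digits D h))) (cyl D N a) \<noteq> \<infinity>"
      using emeasure_digits[OF Na, of h] by (simp add: C_def)
  qed auto
  hence "(\<integral>\<^sup>+z. f z \<partial>density (V D) (indicator C)) = ennreal (1 / real CARD('p) ^ D) * (\<integral>\<^sup>+z. f z \<partial>distr (V D) (V D) (digits D h))"
    by (metis nn_integral_scale_measure assms measurable_distr_eq1)
  thus ?thesis by (simp add: nn_integral_density nn_integral_distr C_def mult.commute)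
qed

text \<open>Total expectation over the p^(n+1) equally likely reductions \<open>h\<close>.\<close>

lemma nn_integral_split_digits:
  fixes f :: "(nat \<Rightarrow> 'p padic_int) \<Rightarrow> ennreal"
  assumes [measurable]: "f \<in> borel_measurable (V (Suc n))"
  shows "(\<integral>\<^sup>+z. f z \<partial>V (Suc n)) =
    ennreal (1 / real CARD('p) ^ Suc n) * (\<Sum>h | degree h \<le> n. \<integral>\<^sup>+z. f (digits (Suc n) h z) \<partial>V (Suc n))"
proof -
  let ?C = "\<lambda>h. cyl (Suc n) 1 (digits (Suc n) h (\<lambda>_. 0))"
  have "(\<Sum>h | degree h \<le> n. indicator (?C h) z :: ennreal) = 1" if z: "z \<in> vecs (Suc n)" for z
  proof -
    define h0 where "h0 = map_poly red (pol (Suc n) z)"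
    have h0: "degree h0 \<le> n" unfolding h0_def by (rule order_trans[OF degree_map_poly_le degree_pol_le])
    have "z \<in> ?C h \<longleftrightarrow> h = h0" if "degree h \<le> n" for h
    proof -
      have "z \<in> ?C h \<longleftrightarrow> (\<forall>i<Suc n. red (z i) = coeff h i)"
        using z unfolding cyl_def cong_level_1_iff by (auto simp: digits_def)
      also have "\<dots> \<longleftrightarrow> (\<forall>i<Suc n. coeff h0 i = coeff h i)" by (simp add: h0_def)
      also have "\<dots> \<longleftrightarrow> h = h0" 
      proof
        assume *: "\<forall>i<Suc n. coeff h0 i = coeff h i"
        show "h = h0"
        proof (rule poly_eqI)
          fix i show "coeff h i = coeff h0 i"
            using * that h0 by (cases "i < Suc n") (auto simp: coeff_eq_0)
        qed
      qed auto
      finally show ?thesis .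
    qed
    hence "(\<Sum>h | degree h \<le> n. indicator (?C h) z :: ennreal) = (\<Sum>h | degree h \<le> n. if h = h0 then 1 else 0)"
      by (intro sum.cong) (auto simp: indicator_def)
    also have "\<dots> = 1" using h0 finite_degree_le[where ?'p = 'p, of n] by (simp add: sum.delta)
    finally show ?thesis .
  qed
  hence "(\<integral>\<^sup>+z. f z \<partial>V (Suc n)) = (\<integral>\<^sup>+z. (\<Sum>h | degree h \<le> n. f z * indicator (?C h) z) \<partial>V (Suc n))"
    by (intro nn_integral_cong) (simp add: sum_distrib_left[symmetric])
  also have "\<dots> = (\<Sum>h | degree h \<le> n. \<integral>\<^sup>+z. f z * indicator (?C h) z \<partial>V (Suc n))"
    by (intro nn_integral_sum) auto
  also have "\<dots> = (\<Sum>h | degree h \<le> n. ennreal (1 / real CARD('p) ^ Suc n) * (\<integral>\<^sup>+z. f (digits (Suc n) h z) \<partial>V (Suc n)))"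
    by (intro sum.cong refl nn_integral_coset) auto
  finally show ?thesis by (simp add: sum_distrib_left)
qed

end

section \<open>Teichmueller digits\<close>

text \<open>The maximal ideal of the local ring \<open>OC\<close>. Zero is listed separately because
  1 / 0 = 0 is integral.\<close>

definition NU :: "'p :: prime_card padic_closure \<Rightarrow> bool" where
  "NU x \<longleftrightarrow> x \<in> OC \<and> (x = 0 \<or> 1 / x \<notin> OC)"

lemma NU_0 [simp]: "NU 0" by (simp add: NU_def)

lemma not_NU_1 [simp]: "\<not> NU 1" by (simp add: NU_def)

lemma NU_pC: "NU (pC :: 'p :: prime_card padic_closure)"
  using OC_pC_inverse by (simp add: NU_def)

lemma NU_mult:
  assumes "NU x" "c \<in> OC"
  shows "NU (c * x)"
proof (cases "c * x = 0")
  case False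
  hence nz: "c \<noteq> 0" "x \<noteq> 0" by auto
  have "1 / (c * x) \<notin> OC"
  proof
    assume "1 / (c * x) \<in> OC"
    hence "c * (1 / (c * x)) \<in> OC" using assms by (intro OC_mult)
    also have "c * (1 / (c * x)) = 1 / x" using nz by simp
    finally show False using assms(1) nz by (simp add: NU_def)
  qed
  thus ?thesis using assms by (simp add: NU_def OC_mult)
qed (auto simp: NU_def)

lemma NU_mult': "NU x \<Longrightarrow> c \<in> OC \<Longrightarrow> NU (x * c)"
  using NU_mult[of x c] by (simp add: mult.commute)

text \<open>Of two nonzero elements one divides the other in \<open>OC\<close>; factoring out the
  divisor reduces the sum to an integral multiple of a nonunit.\<close>

lemma NU_add:
  assumes "NU x" "NU y"
  shows "NU (x + y)"
proof -
  have *: "NU (x + y)" if "NU x" "NU y" "y \<noteq> 0" "x / y \<in> OC" for x y :: "'a padic_closure"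
  proof -
    have "x + y = (x / y + 1) * y" using that by (simp add: field_simps)
    thus ?thesis using that by (simp add: NU_mult OC_add)
  qed
  show ?thesis
  proof (cases "x = 0 \<or> y = 0")
    case False
    show ?thesis
    proof (cases "x / y \<in> OC")
      case True
      thus ?thesis using *[of x y] assms False by blast
    next
      case False
      hence "1 / (x / y) \<in> OC" using OC_or_inverse_OC[of "x / y"] by blast
      hence "y / x \<in> OC" by simp
      thus ?thesis using *[of y x] assms \<open>\<not> (x = 0 \<or> y = 0)\<close> by (simp add: add.commute)
    qed
  qed (use assms in auto)
qed

lemma NU_uminus: "NU x \<Longrightarrow> NU (- x)"
  using NU_mult[of x "-1"] OC_uminus[OF OC_1] by simp

lemma NU_diff: "NU x \<Longrightarrow> NU y \<Longrightarrow> NU (x - y)"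
  using NU_add[of x "- y"] NU_uminus[of y] by simp

lemma NU_sum: "(\<And>i. i \<in> I \<Longrightarrow> NU (f i)) \<Longrightarrow> NU (sum f I)"
  by (induction I rule: infinite_finite_induct) (simp_all add: NU_add)

lemma not_NU_imp_unit: "x \<in> OC \<Longrightarrow> \<not> NU x \<Longrightarrow> x \<noteq> 0 \<and> 1 / x \<in> OC"
  by (auto simp: NU_def)

lemma unit_imp_not_NU: "x \<in> OC \<Longrightarrow> y \<in> OC \<Longrightarrow> x * y = 1 \<Longrightarrow> \<not> NU x"
  using NU_mult'[of x y] not_NU_1 by metis

lemma not_NU_mult: "x \<in> OC \<Longrightarrow> y \<in> OC \<Longrightarrow> \<not> NU x \<Longrightarrow> \<not> NU y \<Longrightarrow> \<not> NU (x * y)"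
  using not_NU_imp_unit[of x] not_NU_imp_unit[of y]
  by (intro unit_imp_not_NU[of _ "(1 / x) * (1 / y)"] OC_mult) auto

lemma not_NU_prod: "finite I \<Longrightarrow> (\<And>i. i \<in> I \<Longrightarrow> f i \<in> OC \<and> \<not> NU (f i)) \<Longrightarrow> \<not> NU (prod f I)"
  by (induction I rule: finite_induct) (simp_all add: not_NU_mult OC_prod)

lemma not_NU_power: "x \<in> OC \<Longrightarrow> \<not> NU x \<Longrightarrow> \<not> NU (x ^ n)"
  by (induction n) (simp_all add: not_NU_mult OC_power)

lemma NU_pC_mult: "x \<in> OC \<Longrightarrow> NU (pC * x)"
  using NU_mult'[OF NU_pC] .

section \<open>Divisibility by powers of p in the integral closure\<close>

definition pdiv :: "nat \<Rightarrow> 'p :: prime_card padic_closure \<Rightarrow> bool" where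
  "pdiv N x \<longleftrightarrow> x / pC ^ N \<in> OC"

lemma pdiv_0 [simp]: "pdiv 0 x \<longleftrightarrow> x \<in> OC" by (simp add: pdiv_def)

lemma pdiv_zero [simp]: "pdiv N 0" by (simp add: pdiv_def)

lemma pdiv_add: "pdiv N x \<Longrightarrow> pdiv N y \<Longrightarrow> pdiv N (x + y)"
  unfolding pdiv_def add_divide_distrib by (rule OC_add)

lemma pdiv_diff: "pdiv N x \<Longrightarrow> pdiv N y \<Longrightarrow> pdiv N (x - y)"
  unfolding pdiv_def diff_divide_distrib by (rule OC_diff)

lemma pdiv_sum: "(\<And>i. i \<in> I \<Longrightarrow> pdiv N (f i)) \<Longrightarrow> pdiv N (sum f I)"
  by (induction I rule: infinite_finite_induct) (auto intro: pdiv_add)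

lemma pdiv_mult: "pdiv N x \<Longrightarrow> c \<in> OC \<Longrightarrow> pdiv N (c * x)"
  unfolding pdiv_def using OC_mult[of c "x / pC ^ N"] by simp

lemma pdiv_mult': "pdiv N x \<Longrightarrow> c \<in> OC \<Longrightarrow> pdiv N (x * c)"
  using pdiv_mult[of N x c] by (simp add: mult.commute)

lemma pdiv_pC_power_mult: "pdiv (M + N) (pC ^ M * x) \<longleftrightarrow> pdiv N x"
  by (simp add: pdiv_def power_add)

lemma pdiv_pC_mult: "pdiv (Suc N) (pC * x) \<longleftrightarrow> pdiv N x"
  using pdiv_pC_power_mult[of 1 N x] by simp

lemma pdiv_mono: "pdiv N x \<Longrightarrow> M \<le> N \<Longrightarrow> pdiv M x"
proof -
  assume "pdiv N x" "M \<le> N"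
  hence "pC ^ (N - M) * (x / pC ^ N) \<in> OC" unfolding pdiv_def by (intro OC_mult OC_power OC_of_nat)
  also have "pC ^ (N - M) * (x / pC ^ N) = x / pC ^ M" using \<open>M \<le> N\<close> by (simp add: power_diff)
  finally show ?thesis by (simp add: pdiv_def)
qed

lemma pdiv_all_imp_0: "(\<And>N. pdiv N x) \<Longrightarrow> x = 0"
  unfolding pdiv_def by (rule all_pC_power_divide_OC_imp_0)

lemma pdiv_imp_NU: "pdiv (Suc N) x \<Longrightarrow> NU x"
proof -
  assume "pdiv (Suc N) x"
  hence "pdiv 1 x" by (rule pdiv_mono) simp
  hence "NU (pC * (x / pC))" by (intro NU_pC_mult) (simp add: pdiv_def)
  thus "NU x" by simp
qed

lemma pdiv_unit_mult_cancel: "pdiv N (u * x) \<Longrightarrow> u \<in> OC \<Longrightarrow> \<not> NU u \<Longrightarrow> pdiv N x"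
  using pdiv_mult[of N "u * x" "1 / u"] not_NU_imp_unit[of u] by simp

lemma pdiv_emb:
  assumes "pZ ^ N dvd a"
  shows "pdiv N (emb a)"
proof -
  obtain b where "a = pZ ^ N * b" using assms by (rule dvdE)
  thus ?thesis by (simp add: pdiv_def emb.hom_mult emb_power)
qed

section \<open>Teichmueller representatives as the roots of X^q - X\<close>

definition muq :: "nat \<Rightarrow> 'p :: prime_card padic_closure set" where
  "muq q = {\<tau>. \<tau> ^ q = \<tau>}"

definition good_q :: "'p :: prime_card itself \<Rightarrow> nat \<Rightarrow> bool" where
  "good_q _ q \<longleftrightarrow> (\<exists>e>0. q = CARD('p) ^ e)"

lemma good_q_ge_2:
  assumes "good_q TYPE('p :: prime_card) q"
  shows "q \<ge> 2"
proof -
  obtain e where e: "e > 0" "q = CARD('p) ^ e" using assms by (auto simp: good_q_def)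
  have "2 \<le> CARD('p)" using padic_card_gt_1[where 'p = 'p] by simp
  also have "\<dots> \<le> CARD('p) ^ e" using e(1) by (intro self_le_power) auto
  finally show ?thesis by (simp add: e)
qed

lemma pdiv_of_good_q:
  assumes "good_q TYPE('p :: prime_card) q"
  shows "(of_nat q :: 'p padic_closure) = pC * of_nat (q div CARD('p))"
proof -
  obtain e where "q = CARD('p) ^ Suc e" using assms by (auto simp: good_q_def gr0_conv_Suc)
  thus ?thesis by simp
qed

lemma muq_OC:
  fixes \<tau> :: "'p :: prime_card padic_closure"
  assumes "good_q TYPE('p) q" "\<tau> \<in> muq q"
  shows "\<tau> \<in> OC"
proof (cases "\<tau> = 0")
  case False
  have q: "q - 1 > 0" using good_q_ge_2[OF assms(1)] by auto
  have "\<tau> * \<tau> ^ (q - 1) = \<tau> ^ q" using q by (cases q) simp_all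
  hence "\<tau> * \<tau> ^ (q - 1) = \<tau>" using assms(2) by (simp add: muq_def)
  hence "\<tau> ^ (q - 1) = 1" using False by simp
  hence "poly (embp (Polynomial.monom 1 (q - 1) - 1)) \<tau> = 0"
    by (simp add: embp.hom_minus map_poly_monom poly_monom)
  moreover have "degree (Polynomial.monom 1 (q - 1) - 1 :: 'p padic_int poly) = q - 1"
    using q by (intro antisym degree_le le_degree) auto
  hence "lead_coeff (Polynomial.monom 1 (q - 1) - 1 :: 'p padic_int poly) = 1" using q by simp
  ultimately show ?thesis unfolding mem_OC_iff by blast
qed auto

lemma zero_in_muq: "q \<ge> 2 \<Longrightarrow> 0 \<in> muq q" by (simp add: muq_def)

lemma muq_mult: "\<sigma> \<in> muq q \<Longrightarrow> \<tau> \<in> muq q \<Longrightarrow> \<sigma> * \<tau> \<in> muq q"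
  by (simp add: muq_def power_mult_distrib)

lemma muq_nonzero_unit:
  fixes \<tau> :: "'p :: prime_card padic_closure"
  assumes "good_q TYPE('p) q" "\<tau> \<in> muq q" "\<tau> \<noteq> 0"
  shows "\<tau> * \<tau> ^ (q - 2) = 1" "\<not> NU \<tau>"
proof -
  obtain m where m: "q = 2 + m" using good_q_ge_2[OF assms(1)] le_Suc_ex by blast
  have "\<tau> * (\<tau> * \<tau> ^ (q - 2)) = \<tau> ^ q" by (simp add: m)
  hence "\<tau> * (\<tau> * \<tau> ^ (q - 2)) = \<tau>" using assms(2) by (simp add: muq_def)
  thus *: "\<tau> * \<tau> ^ (q - 2) = 1" using assms(3) by simp
  show "\<not> NU \<tau>" using muq_OC[OF assms(1,2)] by (intro unit_imp_not_NU[OF _ _ *] OC_power)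
qed

text \<open>The geometric sum S with \<tau>^q - \<sigma>^q = (\<tau> - \<sigma>) S equals 1 here. If
  \<tau> and \<sigma> were congruent, S would be congruent to q \<sigma>^(q-1) and hence a
  nonunit.\<close>

lemma muq_diff_unit:
  fixes \<tau> \<sigma> :: "'p :: prime_card padic_closure"
  assumes q: "good_q TYPE('p) q" and mem: "\<tau> \<in> muq q" "\<sigma> \<in> muq q" and ne: "\<tau> \<noteq> \<sigma>"
  shows "\<not> NU (\<tau> - \<sigma>)"
proof
  assume NU: "NU (\<tau> - \<sigma>)"
  note OC = muq_OC[OF q mem(1)] muq_OC[OF q mem(2)]
  define S where "S = (\<Sum>i<q. \<sigma> ^ (q - Suc i) * \<tau> ^ i)"
  have "\<tau> - \<sigma> = (\<tau> - \<sigma>) * S"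
    using power_diff_sumr2[of \<tau> q \<sigma>] mem by (simp add: muq_def S_def)
  hence "S = 1" using ne by simp
  have "NU (\<sigma> ^ (q - Suc i) * (\<tau> ^ i - \<sigma> ^ i))" for i
    unfolding power_diff_sumr2[of \<tau> i \<sigma>]
    using OC by (intro NU_mult OC_power NU_mult'[OF NU] OC_sum OC_mult)
  hence NU1: "NU (\<Sum>i<q. \<sigma> ^ (q - Suc i) * (\<tau> ^ i - \<sigma> ^ i))"
    by (intro NU_sum)
  have "S = (\<Sum>i<q. \<sigma> ^ (q - Suc i) * (\<tau> ^ i - \<sigma> ^ i)) + (\<Sum>i<q. \<sigma> ^ (q - Suc i) * \<sigma> ^ i)"
    unfolding S_def sum.distrib[symmetric] by (intro sum.cong) (auto simp: algebra_simps)
  also have "(\<Sum>i<q. \<sigma> ^ (q - Suc i) * \<sigma> ^ i) = (\<Sum>i<q. \<sigma> ^ (q - 1))"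
    by (intro sum.cong refl) (simp flip: power_add)
  also have "\<dots> = pC * (of_nat (q div CARD('p)) * \<sigma> ^ (q - 1))"
    using pdiv_of_good_q[OF q] by (simp add: mult.assoc)
  finally have "NU S"
    using OC by (simp only:) (intro NU_add NU1 NU_pC_mult OC_mult OC_of_nat OC_power)
  thus False using \<open>S = 1\<close> by simp
qed

text \<open>X^q - X splits into distinct linear factors: at a double root the derivative would give
  q x^(q-1) = 1, although p divides q.\<close>

lemma muq_factorization:
  fixes w :: "'p :: prime_card padic_closure"
  assumes q: "good_q TYPE('p) q"
  shows "finite (muq q :: 'p padic_closure set)" "w ^ q - w = (\<Prod>\<tau>\<in>muq q. (w - \<tau>))"
proof -
  define G where "G = (Polynomial.monom 1 q - Polynomial.monom 1 1 :: 'p padic_closure poly)"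
  note q2 = good_q_ge_2[OF q]
  have deg: "degree G = q" unfolding G_def using q2 by (intro antisym degree_le le_degree) auto
  have lc: "lead_coeff G = 1" using deg q2 by (simp add: G_def)
  hence "G \<noteq> 0" by auto
  have polyG: "poly G x = x ^ q - x" for x by (simp add: G_def poly_monom)
  obtain A where A: "G = (\<Prod>x\<in>#A. [:-x, 1:])"
    using alg_closed_imp_factorization[OF \<open>G \<noteq> 0\<close>] lc by auto
  have "poly G x = (\<Prod>a\<in>#A. (x - a))" for x unfolding A by (simp add: poly_prod_mset)
  hence "poly G x = 0 \<longleftrightarrow> x \<in># A" for x
    by (simp only: prod_mset_zero_iff) (auto simp: image_iff)
  moreover have "poly G x = 0 \<longleftrightarrow> x \<in> muq q" for x by (simp add: polyG muq_def)
  ultimately have roots: "x \<in># A \<longleftrightarrow> x \<in> muq q" for x by blast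
  have setA: "set_mset A = muq q" using roots by blast
  show "finite (muq q :: 'p padic_closure set)" unfolding setA[symmetric] by simp
  have count: "count A x = 1" if "x \<in># A" for x
  proof (rule ccontr)
    assume "count A x \<noteq> 1"
    moreover have "count A x \<noteq> 0" using that by simp
    ultimately have "2 \<le> count A x" by linarith
    then obtain B where "A = replicate_mset 2 x + B"
      by (auto simp: count_le_replicate_mset_subset_eq subset_mset.le_iff_add)
    hence "A = add_mset x (add_mset x B)" by (simp add: numeral_2_eq_2)
    hence G: "G = [:-x, 1:] * ([:-x, 1:] * (\<Prod>x\<in>#B. [:-x, 1:]))" by (simp add: A)
    have "poly (pderiv G) x = 0" unfolding G pderiv_mult poly_add poly_mult by simp
    moreover have "poly (pderiv G) x = of_nat q * x ^ (q - 1) - 1"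
      by (simp add: G_def pderiv_diff pderiv_monom poly_monom)
    ultimately have "pC * (of_nat (q div CARD('p)) * x ^ (q - 1)) = 1"
      using pdiv_of_good_q[OF q] by (simp add: mult.assoc)
    moreover have "NU (pC * (of_nat (q div CARD('p)) * x ^ (q - 1)))"
      using muq_OC[OF q] roots that by (intro NU_pC_mult OC_mult OC_of_nat OC_power) auto
    ultimately show False by simp
  qed
  have "A = mset_set (set_mset A)"
  proof (rule multiset_eqI)
    fix x show "count A x = count (mset_set (set_mset A)) x"
      using count[of x] by (cases "x \<in># A") (auto simp: not_in_iff)
  qed
  hence "A = mset_set (muq q)" by (simp only: setA)
  hence "G = (\<Prod>\<tau>\<in>muq q. [:-\<tau>, 1:])" unfolding A by (simp add: prod_unfold_prod_mset)
  thus "w ^ q - w = (\<Prod>\<tau>\<in>muq q. (w - \<tau>))" using polyG[of w] by (simp add: poly_prod)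
qed

text \<open>In the product of all w - \<tau> exactly one factor is a nonunit, since distinct \<tau>
  are incongruent. The whole divisibility by p^(N+1) therefore falls on that factor: Hensel's lemma
  for X^q - X.\<close>

lemma muq_approx:
  fixes w :: "'p :: prime_card padic_closure"
  assumes q: "good_q TYPE('p) q" and w: "w \<in> OC" and N: "pdiv (Suc N) (w ^ q - w)"
  obtains \<tau> where "\<tau> \<in> muq q" "pdiv (Suc N) (w - \<tau>)"
proof -
  note fact = muq_factorization[OF q]
  have OC: "w - \<tau> \<in> OC" if "\<tau> \<in> muq q" for \<tau> using muq_OC[OF q that] w by (intro OC_diff)
  have "NU (\<Prod>\<tau>\<in>muq q. (w - \<tau>))" using pdiv_imp_NU[OF N] fact by simp
  then obtain \<tau> where \<tau>: "\<tau> \<in> muq q" "NU (w - \<tau>)"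
    using not_NU_prod[OF fact(1), of "\<lambda>\<tau>. w - \<tau>"] OC by blast
  have "\<not> NU (\<Prod>\<sigma>\<in>muq q - {\<tau>}. (w - \<sigma>))"
  proof (rule not_NU_prod, use fact in simp, safe)
    fix \<sigma> :: "'p padic_closure" assume \<sigma>: "\<sigma> \<in> muq q" "\<sigma> \<noteq> \<tau>"
    show "w - \<sigma> \<in> OC" using OC \<sigma> by blast
    assume "NU (w - \<sigma>)"
    hence "NU ((w - \<tau>) - (w - \<sigma>))" by (rule NU_diff[OF \<tau>(2)])
    hence "NU (\<sigma> - \<tau>)" by simp
    thus False using muq_diff_unit[OF q \<sigma>(1) \<tau>(1) \<sigma>(2)] by simp
  qed
  moreover have "pdiv (Suc N) ((\<Prod>\<sigma>\<in>muq q - {\<tau>}. (w - \<sigma>)) * (w - \<tau>))"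
    using N fact(2)[of w] prod.remove[OF fact(1) \<tau>(1), of "\<lambda>\<sigma>. w - \<sigma>"] by (simp add: mult.commute)
  moreover have "(\<Prod>\<sigma>\<in>muq q - {\<tau>}. (w - \<sigma>)) \<in> OC" by (rule OC_prod) (use OC in blast)
  ultimately have "pdiv (Suc N) (w - \<tau>)" by (intro pdiv_unit_mult_cancel[of "Suc N" _ "w - \<tau>"])
  thus ?thesis using that \<tau> by blast
qed

section \<open>Subrings on which the q-power map is trivial modulo p\<close>

locale integral_subring =
  fixes A :: "'p :: prime_card padic_closure set"
  assumes A_OC: "A \<subseteq> OC" and A_1: "1 \<in> A"
    and A_diff: "\<And>x y. x \<in> A \<Longrightarrow> y \<in> A \<Longrightarrow> x - y \<in> A"
    and A_mult: "\<And>x y. x \<in> A \<Longrightarrow> y \<in> A \<Longrightarrow> x * y \<in> A"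
begin

lemma A_0: "0 \<in> A" using A_diff[OF A_1 A_1] by simp

lemma A_add: "x \<in> A \<Longrightarrow> y \<in> A \<Longrightarrow> x + y \<in> A"
  using A_diff[of x "0 - y"] A_diff[OF A_0, of y] by simp

lemma A_power: "x \<in> A \<Longrightarrow> x ^ n \<in> A"
  by (induction n) (auto intro: A_1 A_mult)

lemma A_sum: "(\<And>i. i \<in> I \<Longrightarrow> f i \<in> A) \<Longrightarrow> sum f I \<in> A"
  by (induction I rule: infinite_finite_induct) (auto intro: A_0 A_add)

lemma A_of_nat: "of_nat n \<in> A"
  by (induction n) (auto intro: A_0 A_1 A_add)

text \<open>Additivity of the p^e-power map modulo p. The point is that the quotient by p stays in
  \<open>A\<close>, which is stronger than being integral.\<close>

lemma freshman_power:
  assumes "a \<in> A" "b \<in> A"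
  shows "((a + b) ^ (CARD('p) ^ e) - a ^ (CARD('p) ^ e) - b ^ (CARD('p) ^ e)) / pC \<in> A"
  using assms
proof (induction e arbitrary: a b)
  case 0
  thus ?case by (simp add: A_0)
next
  case (Suc e)
  let ?p = "CARD('p)"
  have p: "prime ?p" by (rule prime_card)
  hence "?p \<ge> 2" by (rule prime_ge_2_nat)
  then obtain m where "?p = 2 + m" using le_Suc_ex by blast
  hence m: "?p = Suc (Suc m)" by simp
  define S where "S = (\<Sum>k<Suc m. of_nat ((?p choose Suc k) div ?p) * a ^ Suc k * b ^ (?p - Suc k))"
  have "(a + b) ^ ?p = (\<Sum>k\<le>?p. of_nat (?p choose k) * a ^ k * b ^ (?p - k))" by (rule binomial_ring)
  also have "\<dots> = b ^ ?p + (\<Sum>k<Suc m. of_nat (?p choose Suc k) * a ^ Suc k * b ^ (?p - Suc k)) + a ^ ?p"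
    unfolding m lessThan_Suc_atMost[symmetric] by (subst sum.lessThan_Suc_shift) (simp add: binomial_eq_0)
  also have "(\<Sum>k<Suc m. of_nat (?p choose Suc k) * a ^ Suc k * b ^ (?p - Suc k)) = pC * S"
    unfolding S_def sum_distrib_left
  proof (intro sum.cong refl)
    fix k assume "k \<in> {..<Suc m}"
    hence "?p dvd ?p choose Suc k" using p m by (intro Primes.dvd_choose_prime) auto
    hence "of_nat (?p choose Suc k) = pC * (of_nat ((?p choose Suc k) div ?p) :: 'p padic_closure)"
      by (metis dvd_mult_div_cancel of_nat_mult)
    thus "of_nat (?p choose Suc k) * a ^ Suc k * b ^ (?p - Suc k) =
      pC * (of_nat ((?p choose Suc k) div ?p) * a ^ Suc k * b ^ (?p - Suc k))" by (simp add: mult.assoc)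
  qed
  finally have ab: "(a + b) ^ ?p = a ^ ?p + b ^ ?p + pC * S" by simp
  have S: "S \<in> A" unfolding S_def using Suc.prems by (intro A_sum A_mult A_of_nat A_power)
  define u where "u = a ^ ?p + b ^ ?p"
  have u: "u \<in> A" using Suc.prems by (simp add: u_def A_add A_power)
  define T where "T = (\<Sum>i<?p ^ e. u ^ (?p ^ e - Suc i) * (u + pC * S) ^ i)"
  have "T \<in> A" unfolding T_def using u S by (intro A_sum A_mult A_power A_add A_of_nat)
  \<comment> \<open>One p-th power is taken first; its error p S remains a multiple of p under the
    remaining p^e-th power.\<close>
  have "(a + b) ^ (?p ^ Suc e) = (u + pC * S) ^ (?p ^ e)"
    by (simp add: power_mult ab u_def)
  also have "\<dots> = u ^ (?p ^ e) + pC * S * T"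
    using power_diff_sumr2[of "u + pC * S" "?p ^ e" u] by (simp add: T_def algebra_simps)
  finally have "((a + b) ^ (?p ^ Suc e) - a ^ (?p ^ Suc e) - b ^ (?p ^ Suc e)) / pC =
    (u ^ (?p ^ e) - (a ^ ?p) ^ (?p ^ e) - (b ^ ?p) ^ (?p ^ e)) / pC + S * T"
    by (simp add: power_mult[symmetric] diff_divide_distrib add_divide_distrib)
  also have "\<dots> \<in> A"
    unfolding u_def using Suc.prems S \<open>T \<in> A\<close> by (intro A_add Suc.IH A_mult A_power)
  finally show ?case .
qed

lemma frob_add:
  assumes q: "good_q TYPE('p) q" and "a \<in> A" "b \<in> A" "(a ^ q - a) / pC \<in> A" "(b ^ q - b) / pC \<in> A"
  shows "((a + b) ^ q - (a + b)) / pC \<in> A"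
proof -
  obtain e where "q = CARD('p) ^ e" using q by (auto simp: good_q_def)
  hence "((a + b) ^ q - a ^ q - b ^ q) / pC + (a ^ q - a) / pC + (b ^ q - b) / pC \<in> A"
    using assms freshman_power[of a b e] by (intro A_add) auto
  thus ?thesis by (simp add: add_divide_distrib[symmetric] algebra_simps)
qed

lemma frob_mult:
  assumes "a \<in> A" "b \<in> A" "(a ^ q - a) / pC \<in> A" "(b ^ q - b) / pC \<in> A"
  shows "((a * b) ^ q - a * b) / pC \<in> A"
proof -
  have "((a * b) ^ q - a * b) / pC = a ^ q * ((b ^ q - b) / pC) + (a ^ q - a) / pC * b"
    by (simp add: power_mult_distrib diff_divide_distrib algebra_simps)
  moreover have "a ^ q * ((b ^ q - b) / pC) + (a ^ q - a) / pC * b \<in> A"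
    by (intro A_add A_mult A_power assms)
  ultimately show ?thesis by (simp only:)
qed

end

lemma frob_emb:
  fixes a :: "'p :: prime_card padic_int"
  assumes q: "good_q TYPE('p) q"
  shows "\<exists>b. (emb a ^ q - emb a) / pC = emb b"
proof -
  obtain e where "q = CARD('p) ^ e" using q by (auto simp: good_q_def)
  hence "red (a ^ q - a) = 0" by (simp add: red.hom_minus red.hom_power)
  then obtain b where "a ^ q - a = pZ * b" by (auto simp: red_eq_0_iff)
  hence "emb a ^ q - emb a = pC * emb b" by (metis emb.hom_minus emb.hom_mult emb_of_nat emb_power)
  thus ?thesis by auto
qed

text \<open>The q-power map is the identity on A/pA. This is the working form of being unramified
  with residue field inside F_q: rings of integers of unramified fields satisfy it for suitable q,
  and it can be verified on generators.\<close>

locale frobenius_ring = integral_subring A for A :: "'p :: prime_card padic_closure set" +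
  fixes q :: nat
  assumes q: "good_q TYPE('p) q"
    and A_frob: "\<And>y. y \<in> A \<Longrightarrow> (y ^ q - y) / pC \<in> A"
begin

text \<open>The q-th power improves a congruence by one power of p: the cofactor of a - b in a^q -
  b^q is congruent to q b^(q-1) modulo p, hence divisible by p.\<close>

lemma power_q_cong:
  assumes "a \<in> A" "b \<in> A" "(a - b) / pC ^ Suc j \<in> A"
  shows "(a ^ q - b ^ q) / pC ^ Suc (Suc j) \<in> A"
proof -
  define c where "c = (a - b) / pC ^ Suc j"
  have ab: "a - b = pC ^ Suc j * c" by (simp add: c_def)
  define S where "S = (\<Sum>i<q. b ^ (q - Suc i) * a ^ i)"
  have c: "c \<in> A" using assms(3) by (simp add: c_def)
  have "b ^ (q - Suc i) * (a ^ i - b ^ i) / pC \<in> A" for i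
  proof -
    have "b ^ (q - Suc i) * (a ^ i - b ^ i) / pC =
      b ^ (q - Suc i) * (of_nat (CARD('p) ^ j) * c * (\<Sum>k<i. b ^ (i - Suc k) * a ^ k))"
      unfolding power_diff_sumr2[of a i b] ab by simp
    also have "\<dots> \<in> A" using assms c by (intro A_mult A_power A_sum A_of_nat)
    finally show ?thesis .
  qed
  hence 1: "(\<Sum>i<q. b ^ (q - Suc i) * (a ^ i - b ^ i) / pC) \<in> A" by (intro A_sum)
  have "S = (\<Sum>i<q. b ^ (q - Suc i) * (a ^ i - b ^ i)) + (\<Sum>i<q. b ^ (q - Suc i) * b ^ i)"
    unfolding S_def sum.distrib[symmetric] by (intro sum.cong) (auto simp: algebra_simps)
  also have "(\<Sum>i<q. b ^ (q - Suc i) * b ^ i) = (\<Sum>i<q. b ^ (q - 1))"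
    by (intro sum.cong refl) (simp flip: power_add)
  also have "\<dots> = pC * (of_nat (q div CARD('p)) * b ^ (q - 1))"
    using pdiv_of_good_q[OF q] by (simp add: mult.assoc)
  finally have "S / pC = (\<Sum>i<q. b ^ (q - Suc i) * (a ^ i - b ^ i) / pC) + of_nat (q div CARD('p)) * b ^ (q - 1)"
    by (simp add: add_divide_distrib sum_divide_distrib)
  also have "\<dots> \<in> A" using assms by (intro A_add 1 A_mult A_of_nat A_power)
  finally have "S / pC \<in> A" .
  moreover have "(a ^ q - b ^ q) / pC ^ Suc (Suc j) = c * (S / pC)"
    using power_diff_sumr2[of a q b] ab by (simp add: S_def)
  ultimately show ?thesis using c by (simp only: A_mult)
qed

text \<open>The powers y^(q^j) thus approach the Teichmueller representative of y.\<close>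

lemma frob_iter_cong: "y \<in> A \<Longrightarrow> ((y ^ q ^ j) ^ q - y ^ q ^ j) / pC ^ Suc j \<in> A"
proof (induction j)
  case 0
  thus ?case using A_frob by simp
next
  case (Suc j)
  have "(((y ^ q ^ j) ^ q) ^ q - (y ^ q ^ j) ^ q) / pC ^ Suc (Suc j) \<in> A"
    using Suc by (intro power_q_cong A_power) auto
  thus ?case by (simp add: power_mult[symmetric] mult.commute)
qed

lemma frob_iter_diff: "y \<in> A \<Longrightarrow> (y - y ^ q ^ N) / pC \<in> A"
proof (induction N)
  case (Suc N)
  have "(y - y ^ q ^ Suc N) / pC = (y - y ^ q ^ N) / pC - ((y ^ q ^ N) ^ q - y ^ q ^ N) / pC"
    by (simp add: power_mult[symmetric] mult.commute diff_divide_distrib)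
  also have "\<dots> \<in> A" using Suc by (intro A_diff A_frob A_power)
  finally show ?case .
qed (simp add: A_0)

text \<open>The leading digit is the representative near y^(q^N), which almost solves X^q = X by
  \<open>frob_iter_cong\<close>. Since y - y^(q^N) divided by p is again in \<open>A\<close>, the
  remaining digits come from the same statement with one digit less.\<close>

lemma digit_expansion:
  "y \<in> A \<Longrightarrow> \<exists>\<tau>. (\<forall>i. \<tau> i \<in> muq q) \<and> pdiv N (y - (\<Sum>i<N. pC ^ i * \<tau> i))"
proof (induction N arbitrary: y)
  case 0
  thus ?case using A_OC zero_in_muq[OF good_q_ge_2[OF q]] by (auto intro!: exI[of _ "\<lambda>_. 0"])
next
  case (Suc N)
  define w where "w = y ^ q ^ N"
  define z where "z = (y - w) / pC"
  have "w \<in> A" using Suc.prems by (auto simp: w_def intro: A_power)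
  have "pdiv (Suc N) (w ^ q - w)"
    using frob_iter_cong[OF Suc.prems, of N] A_OC by (auto simp: pdiv_def w_def)
  then obtain \<tau>0 where \<tau>0: "\<tau>0 \<in> muq q" "pdiv (Suc N) (w - \<tau>0)"
    using muq_approx[OF q] \<open>w \<in> A\<close> A_OC by blast
  have "z \<in> A" using frob_iter_diff[OF Suc.prems, of N] by (simp add: z_def w_def)
  from Suc.IH[OF this] obtain \<tau> where \<tau>: "\<And>i. \<tau> i \<in> muq q" "pdiv N (z - (\<Sum>i<N. pC ^ i * \<tau> i))"
    by blast
  define \<sigma> where "\<sigma> = case_nat \<tau>0 \<tau>"
  have "(\<Sum>i<Suc N. pC ^ i * \<sigma> i) = \<tau>0 + pC * (\<Sum>i<N. pC ^ i * \<tau> i)"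
    by (subst sum.lessThan_Suc_shift) (simp add: \<sigma>_def sum_distrib_left mult.assoc)
  moreover have "y = w + pC * z" by (simp add: z_def)
  ultimately have "y - (\<Sum>i<Suc N. pC ^ i * \<sigma> i) = (w - \<tau>0) + pC * (z - (\<Sum>i<N. pC ^ i * \<tau> i))"
    by (simp add: algebra_simps)
  hence "pdiv (Suc N) (y - (\<Sum>i<Suc N. pC ^ i * \<sigma> i))"
    using \<tau>0(2) \<tau>(2) by (auto intro: pdiv_add simp: pdiv_pC_mult)
  moreover have "\<sigma> i \<in> muq q" for i using \<tau>0 \<tau> by (cases i) (auto simp: \<sigma>_def)
  ultimately show ?case by blast
qed

end

text \<open>Subfields containing Q_p by bare closure conditions; as \<open>inverse 0 = 0\<close>,
  zero needs no exception. The link to the structures in the definition of unramified extensions is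
  \<open>subfield_iff_fieldset\<close>.\<close>

definition fieldset :: "'p :: prime_card padic_closure set \<Rightarrow> bool" where
  "fieldset L \<longleftrightarrow> range to_ac \<subseteq> L \<and> (\<forall>x\<in>L. \<forall>y\<in>L. x - y \<in> L \<and> x * y \<in> L) \<and> (\<forall>x\<in>L. inverse x \<in> L)"

lemma fieldset_emb: "fieldset L \<Longrightarrow> emb a \<in> L"
  by (auto simp: fieldset_def padic_int_embed_def)

lemma fieldset_of_nat: "fieldset L \<Longrightarrow> of_nat n \<in> L"
  using fieldset_emb[of L "of_nat n"] by simp

lemma fieldset_0: "fieldset L \<Longrightarrow> 0 \<in> L" and fieldset_1: "fieldset L \<Longrightarrow> 1 \<in> L"
  using fieldset_of_nat[of L 0] fieldset_of_nat[of L 1] by simp_all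

lemma fieldset_diff: "fieldset L \<Longrightarrow> x \<in> L \<Longrightarrow> y \<in> L \<Longrightarrow> x - y \<in> L"
  and fieldset_mult: "fieldset L \<Longrightarrow> x \<in> L \<Longrightarrow> y \<in> L \<Longrightarrow> x * y \<in> L"
  and fieldset_inverse: "fieldset L \<Longrightarrow> x \<in> L \<Longrightarrow> inverse x \<in> L"
  by (simp_all add: fieldset_def)

lemma fieldset_uminus: "fieldset L \<Longrightarrow> x \<in> L \<Longrightarrow> - x \<in> L"
  using fieldset_diff[of L 0 x] fieldset_0[of L] by simp

lemma fieldset_add: "fieldset L \<Longrightarrow> x \<in> L \<Longrightarrow> y \<in> L \<Longrightarrow> x + y \<in> L"
  using fieldset_diff[of L x "- y"] fieldset_uminus[of L y] by simp

lemma fieldset_divide: "fieldset L \<Longrightarrow> x \<in> L \<Longrightarrow> y \<in> L \<Longrightarrow> x / y \<in> L"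
  unfolding divide_inverse by (intro fieldset_mult fieldset_inverse)

lemma fieldset_power: "fieldset L \<Longrightarrow> x \<in> L \<Longrightarrow> x ^ n \<in> L"
  by (induction n) (auto intro: fieldset_mult fieldset_1)

lemma fieldset_sum: "fieldset L \<Longrightarrow> (\<And>i. i \<in> I \<Longrightarrow> f i \<in> L) \<Longrightarrow> sum f I \<in> L"
  by (induction I rule: infinite_finite_induct) (auto intro: fieldset_0 fieldset_add)

definition polys_over :: "'p :: prime_card padic_closure set \<Rightarrow> 'p padic_closure poly set" where
  "polys_over L = {h. \<forall>i. coeff h i \<in> L}"

lemma polys_over_diff: "fieldset L \<Longrightarrow> f \<in> polys_over L \<Longrightarrow> g \<in> polys_over L \<Longrightarrow> f - g \<in> polys_over L"
  by (auto simp: polys_over_def intro: fieldset_diff)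

lemma polys_over_mult: "fieldset L \<Longrightarrow> f \<in> polys_over L \<Longrightarrow> g \<in> polys_over L \<Longrightarrow> f * g \<in> polys_over L"
  by (auto simp: polys_over_def coeff_mult intro!: fieldset_sum fieldset_mult)

lemma polys_over_pcompose_embp:
  assumes "fieldset L" "g \<in> polys_over L"
  shows "pcompose (embp f) g \<in> polys_over L"
proof (induction f)
  case 0
  thus ?case using assms by (simp add: polys_over_def fieldset_0)
next
  case (pCons a f)
  have "embp (pCons a f) = pCons (emb a) (embp f)"
    by (rule poly_eqI) (simp add: coeff_pCons split: nat.split)
  hence "pcompose (embp (pCons a f)) g = [:emb a:] - (0 - g * pcompose (embp f) g)"
    by (simp add: pcompose_pCons)
  moreover have "[:emb a:] \<in> polys_over L" "0 \<in> polys_over L"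
    using assms(1) by (auto simp: polys_over_def coeff_pCons fieldset_emb fieldset_0 split: nat.split)
  moreover have "[:emb a:] - (0 - g * pcompose (embp f) g) \<in> polys_over L"
    by (rule polys_over_diff[OF assms(1) _ polys_over_diff[OF assms(1) _ polys_over_mult[OF assms pCons.IH]]]) fact+
  ultimately show ?case by simp
qed

text \<open>If \<open>x\<close> is approximated by elements of \<open>L\<close>, then each conjugate \<open>x'\<close> of \<open>x\<close> over \<open>L\<close> is
  approximated by the same elements, whence \<open>x' = x\<close>.\<close>

lemma fieldset_closed:
  fixes x :: "'p :: prime_card padic_closure"
  assumes L: "fieldset L" and approx: "\<And>N. \<exists>t\<in>L. pdiv N (x - t)"
  shows "x \<in> L"
proof -
  define Ps where "Ps = {h. h \<in> polys_over L \<and> h \<noteq> 0 \<and> poly h x = 0}"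
  obtain P :: "'p padic poly" where P: "P \<noteq> 0" "poly (map_poly to_ac P) x = 0" by (rule alg_closure_algebraic)
  have "map_poly to_ac P \<in> Ps"
    using P L by (auto simp: Ps_def polys_over_def fieldset_def coeff_map_poly poly_eq_iff)
  hence ex: "\<exists>h. h \<in> Ps" by blast
  define G0 where "G0 = arg_min degree (\<lambda>h. h \<in> Ps)"
  have G0: "G0 \<in> Ps" "\<And>h. h \<in> Ps \<Longrightarrow> degree G0 \<le> degree h"
    using arg_min_nat_lemma[of "\<lambda>h. h \<in> Ps", where m = degree] ex unfolding G0_def by blast+
  \<comment> \<open>Normalised, this is the minimal polynomial of \<open>x\<close> over
    \<open>L\<close>.\<close>
  define G where "G = smult (inverse (lead_coeff G0)) G0"
  have G0': "G0 \<noteq> 0" using G0(1) by (simp add: Ps_def)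
  have "inverse (lead_coeff G0) \<in> L"
    using G0(1) L by (intro fieldset_inverse) (auto simp: Ps_def polys_over_def)
  hence G: "G \<in> polys_over L" "poly G x = 0" "lead_coeff G = 1" "degree G = degree G0"
    using G0(1) G0' L by (simp_all add: G_def Ps_def polys_over_def fieldset_mult)
  have dvd: "G dvd h" if "h \<in> polys_over L" "poly h x = 0" for h
    using that
  proof (induction "degree h" arbitrary: h rule: less_induct)
    case less
    show ?case
    proof (cases "h = 0")
      case False
      hence "degree G \<le> degree h" using less.prems G0(2)[of h] by (simp add: Ps_def G(4))
      define h' where "h' = h - Polynomial.monom (lead_coeff h) (degree h - degree G) * G"
      have h'L: "h' \<in> polys_over L"
        unfolding h'_def using less.prems L
        by (intro polys_over_diff polys_over_mult G(1)) (auto simp: polys_over_def fieldset_0)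
      have h'0: "poly h' x = 0" using less.prems G(2) by (simp add: h'_def)
      have "G dvd h'"
      proof (cases "h' = 0")
        case False
        have "coeff (Polynomial.monom (lead_coeff h) (degree h - degree G) * G) (degree h) = lead_coeff h"
          using \<open>degree G \<le> degree h\<close> G(3) by (simp add: coeff_monom_mult)
        hence "coeff h' (degree h) = 0" by (simp add: h'_def)
        moreover have "degree (Polynomial.monom (lead_coeff h) (degree h - degree G) * G) \<le> degree h"
          using \<open>degree G \<le> degree h\<close> degree_mult_le[of "Polynomial.monom (lead_coeff h) (degree h - degree G)" G]
            degree_monom_le[of "lead_coeff h" "degree h - degree G"] by linarith
        hence "degree h' \<le> degree h" unfolding h'_def by (intro degree_diff_le) auto
        ultimately have "degree h' < degree h" using False by (metis leading_coeff_neq_0 le_neq_implies_less)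
        thus ?thesis using less.hyps h'L h'0 by blast
      qed simp
      hence "G dvd h' + Polynomial.monom (lead_coeff h) (degree h - degree G) * G" by (intro dvd_add dvd_triv_right)
      thus ?thesis by (simp add: h'_def)
    qed simp
  qed
  have conj: "a = x" if a: "poly G a = 0" for a
  proof -
    have "pdiv N (x - a)" for N
    proof -
      obtain t where t: "t \<in> L" "pdiv N (x - t)" using approx by blast
      \<comment> \<open>The integral equation of (x - t)/p^N, composed with a linear polynomial over
        \<open>L\<close>, is a multiple of the minimal polynomial. Hence it also holds at every
        other root \<open>a\<close>, which is thus as close to \<open>t\<close> as \<open>x\<close>
        is.\<close>
      obtain g where g: "lead_coeff g = 1" "poly (embp g) ((x - t) / pC ^ N) = 0"
        using t(2) by (auto simp: pdiv_def mem_OC_iff)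
      define l where "l = [:- t / pC ^ N, 1 / pC ^ N :: 'p padic_closure:]"
      have "l \<in> polys_over L"
        using t(1) L by (auto simp: l_def polys_over_def coeff_pCons fieldset_0 fieldset_1 split: nat.split
            intro!: fieldset_divide fieldset_uminus fieldset_power fieldset_of_nat)
      hence "pcompose (embp g) l \<in> polys_over L" by (intro polys_over_pcompose_embp L)
      moreover have pl: "poly l b = (b - t) / pC ^ N" for b by (simp add: l_def field_simps)
      have "poly (pcompose (embp g) l) x = 0" using g(2) by (simp add: poly_pcompose pl)
      ultimately have "G dvd pcompose (embp g) l" by (intro dvd)
      hence "poly (pcompose (embp g) l) a = 0" using a by (auto elim!: dvdE)
      hence "poly (embp g) ((a - t) / pC ^ N) = 0" by (simp add: poly_pcompose pl)
      hence "pdiv N (a - t)" using g(1) unfolding pdiv_def mem_OC_iff by blast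
      hence "pdiv N ((x - t) - (a - t))" by (rule pdiv_diff[OF t(2)])
      thus ?thesis by simp
    qed
    hence "x - a = 0" by (rule pdiv_all_imp_0)
    thus ?thesis by simp
  qed
  define n where "n = degree G"
  have "n > 0"
  proof (rule ccontr)
    assume "\<not> n > 0"
    then obtain c where "G = [:c:]" unfolding n_def by (metis degree_eq_zeroE gr0I)
    thus False using G(2,3) by auto
  qed
  have "G \<noteq> 0" using G(3) by auto
  then obtain A where A: "size A = n" "G = smult (lead_coeff G) (\<Prod>a\<in>#A. [:-a, 1:])"
    unfolding n_def using alg_closed_imp_factorization by blast
  note A = A(1) A(2)[unfolded G(3) smult_1_left]
  have "\<forall>a. a \<in># A \<longrightarrow> a = x"
  proof (intro allI impI conj)
    fix a assume "a \<in># A"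
    thus "poly G a = 0" by (auto simp: A(2) poly_prod_mset prod_mset_zero_iff)
  qed
  hence "set_mset A \<subseteq> {x}" by blast
  hence "A = replicate_mset n x" unfolding A(1)[symmetric] by (rule set_mset_subset_singletonD)
  hence Gx: "G = [:-x, 1:] ^ n" using A(2) by simp
  \<comment> \<open>With all roots equal to \<open>x\<close>, the second highest coefficient of the
    minimal polynomial is -n x, and characteristic 0 allows division by n.\<close>
  have "coeff ([:-x, 1:] ^ Suc m) m = - of_nat (Suc m) * x" for m
  proof (induction m)
    case (Suc m)
    have "[:-x, 1:] ^ Suc (Suc m) = smult (-x) ([:-x, 1:] ^ Suc m) + pCons 0 ([:-x, 1:] ^ Suc m)"
      by simp
    hence "coeff ([:-x, 1:] ^ Suc (Suc m)) (Suc m) = - x * coeff ([:-x, 1:] ^ Suc m) (Suc m) + coeff ([:-x, 1:] ^ Suc m) m"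
      by (simp del: power_Suc)
    also have "coeff ([:-x, 1:] ^ Suc m) (Suc m) = 1"
      by (rule coeff_linear_power)
    finally show ?case unfolding Suc.IH by (simp add: algebra_simps)
  qed simp
  from this[of "n - 1"] have "coeff G (n - 1) = - of_nat n * x" using \<open>n > 0\<close> by (simp add: Gx)
  hence "x = - (coeff G (n - 1) / of_nat n)" using \<open>n > 0\<close> by (simp add: field_simps)
  also have "\<dots> \<in> L"
    using G(1) L by (intro fieldset_uminus fieldset_divide fieldset_of_nat) (auto simp: polys_over_def)
  finally show ?thesis .
qed

lemma embp_pCons [simp]: "embp (pCons a f) = pCons (emb a) (embp f)"
  by (rule poly_eqI) (simp add: coeff_pCons split: nat.split)

lemma muq_Zspan_integral_subring:
  fixes q :: nat
  assumes q: "good_q TYPE('p :: prime_card) q"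
  shows "integral_subring (Zspan (muq q) :: 'p padic_closure set)"
proof
  note fin = muq_factorization(1)[OF q]
  show "Zspan (muq q) \<subseteq> (OC :: 'p padic_closure set)"
    using muq_OC[OF q] by (auto simp: Zspan_def intro!: OC_sum OC_mult)
  show "1 \<in> (Zspan (muq q) :: 'p padic_closure set)" by (intro Zspan_base fin) (simp add: muq_def)
  fix x y :: "'p padic_closure" assume x: "x \<in> Zspan (muq q)" and y: "y \<in> Zspan (muq q)"
  show "x - y \<in> Zspan (muq q)" using x y by (rule Zspan_diff)
  have "\<tau> * y \<in> Zspan (muq q)" if "\<tau> \<in> muq q" for \<tau>
    by (rule Zspan_mult[OF _ y]) (intro Zspan_base fin muq_mult that)
  hence "y * \<tau> \<in> Zspan (muq q)" if "\<tau> \<in> muq q" for \<tau> using that by (simp add: mult.commute)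
  hence "y * x \<in> Zspan (muq q)" by (rule Zspan_mult[OF _ x])
  thus "x * y \<in> Zspan (muq q)" by (simp add: mult.commute)
qed

text \<open>For a multiple a \<tau> the congruence reduces to that of a^q and a, because \<tau>^q =
  \<tau>; \<open>frob_add\<close> extends it to sums.\<close>

lemma frobenius_ring_muq:
  assumes q: "good_q TYPE('p :: prime_card) q"
  shows "frobenius_ring (Zspan (muq q) :: 'p padic_closure set) q"
proof -
  note fin = muq_factorization(1)[OF q]
  interpret integral_subring "Zspan (muq q) :: 'p padic_closure set" by (rule muq_Zspan_integral_subring[OF q])
  show ?thesis
  proof
    fix y :: "'p padic_closure" assume "y \<in> Zspan (muq q)"
    then obtain c where y: "y = (\<Sum>\<tau>\<in>muq q. emb (c \<tau>) * \<tau>)" by (auto simp: Zspan_def)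
    have summand: "emb a * \<tau> \<in> Zspan (muq q) \<and> ((emb a * \<tau>) ^ q - emb a * \<tau>) / pC \<in> Zspan (muq q)" if \<tau>: "\<tau> \<in> muq q" for a :: "'p padic_int" and \<tau>
    proof -
      obtain b where b: "(emb a ^ q - emb a) / pC = emb b" using frob_emb[OF q] by blast
      have "((emb a * \<tau>) ^ q - emb a * \<tau>) / pC = (emb a ^ q - emb a) / pC * \<tau>"
        using \<tau> by (simp add: power_mult_distrib muq_def algebra_simps)
      also have "\<dots> \<in> Zspan (muq q)" unfolding b by (intro Zspan_scale Zspan_base fin \<tau>)
      finally show ?thesis using \<tau> by (auto intro: Zspan_scale Zspan_base fin)
    qed
    have "(\<Sum>\<tau>\<in>B. emb (c \<tau>) * \<tau>) \<in> Zspan (muq q) \<and>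
      ((\<Sum>\<tau>\<in>B. emb (c \<tau>) * \<tau>) ^ q - (\<Sum>\<tau>\<in>B. emb (c \<tau>) * \<tau>)) / pC \<in> Zspan (muq q)" if "B \<subseteq> muq q" for B
      using finite_subset[OF that fin] that
    proof (induction B rule: finite_induct)
      case empty
      thus ?case using good_q_ge_2[OF q] by (simp add: A_0 power_0_left)
    next
      case (insert \<tau> B)
      thus ?case using summand[of \<tau> "c \<tau>"] by (simp add: A_add frob_add[OF q])
    qed
    thus "(y ^ q - y) / pC \<in> Zspan (muq q)" using y by blast
  qed (rule q)
qed

text \<open>Elements satisfying the Frobenius congruence are closed under sums and products, so it
  suffices to have it for Z_p and for the generator \<open>x\<close>.\<close>

lemma frobenius_ring_adjoin:
  fixes x :: "'p :: prime_card padic_closure"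
  assumes q: "good_q TYPE('p) q" and x: "x \<in> OC" and g: "x ^ q - x = pC * poly (embp g) x"
  shows "frobenius_ring (range (\<lambda>f. poly (embp f) x)) q"
proof -
  let ?A = "range (\<lambda>f. poly (embp f) x)"
  interpret integral_subring ?A
  proof
    show "?A \<subseteq> OC" using OC_poly_embp[OF x] by auto
    show "1 \<in> ?A" by (rule image_eqI[of _ _ 1]) auto
    fix y z assume "y \<in> ?A" "z \<in> ?A"
    then obtain f h where "y = poly (embp f) x" "z = poly (embp h) x" by auto
    hence "y - z = poly (embp (f - h)) x" "y * z = poly (embp (f * h)) x"
      by (simp_all add: embp.hom_minus embp_mult)
    thus "y - z \<in> ?A" "y * z \<in> ?A" by auto
  qed
  have e: "emb a \<in> ?A" for a by (rule image_eqI[of _ _ "[:a:]"]) auto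
  have xA: "x \<in> ?A" by (rule image_eqI[of _ _ "Polynomial.monom 1 1"]) (auto simp: map_poly_monom poly_monom)
  have fx: "(x ^ q - x) / pC \<in> ?A" unfolding g by simp
  show ?thesis
  proof
    fix y assume "y \<in> ?A"
    then obtain f where y: "y = poly (embp f) x" by auto
    have "(poly (embp f) x ^ q - poly (embp f) x) / pC \<in> ?A"
    proof (induction f)
      case 0
      thus ?case using good_q_ge_2[OF q] A_0 by (simp add: power_0_left)
    next
      case (pCons a f)
      have eq: "poly (embp (pCons a f)) x = emb a + x * poly (embp f) x" by simp
      obtain b where b: "(emb a ^ q - emb a) / pC = emb b" using frob_emb[OF q] by blast
      have fA: "poly (embp f) x \<in> ?A" by blast
      have ea: "(emb a ^ q - emb a) / pC \<in> ?A" unfolding b by (rule e)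
      show ?case unfolding eq
        by (rule frob_add[OF q e A_mult[OF xA fA] ea frob_mult[OF xA fA fx pCons.IH]])
    qed
    thus "(y ^ q - y) / pC \<in> ?A" unfolding y .
  qed (rule q)
qed

text \<open>The field generated over Q_p by the roots of unity of order dividing q - 1, written as
  the Z_p-span of \<open>muq q\<close> with p inverted.\<close>

definition Sq :: "nat \<Rightarrow> 'p :: prime_card padic_closure set" where
  "Sq q = {z / pC ^ k |z k. z \<in> Zspan (muq q)}"

lemma Sq_fieldset:
  assumes q: "good_q TYPE('p :: prime_card) q"
  shows "fieldset (Sq q :: 'p padic_closure set)"
proof -
  let ?S = "Sq q :: 'p padic_closure set"
  interpret integral_subring "Zspan (muq q) :: 'p padic_closure set" by (rule muq_Zspan_integral_subring[OF q])
  have embZ: "emb a \<in> (Zspan (muq q) :: 'p padic_closure set)" for a :: "'p padic_int"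
    using Zspan_scale[OF A_1, of a] by simp
  have embS: "emb a * x \<in> ?S" if xS: "x \<in> ?S" for a x
  proof -
    obtain z k where z: "z \<in> Zspan (muq q)" "x = z / pC ^ k" using xS by (auto simp: Sq_def)
    have "emb a * x = (emb a * z) / pC ^ k" using z by simp
    thus ?thesis using Zspan_scale[OF z(1), of a] unfolding Sq_def by blast
  qed
  have divS: "x / emb a \<in> ?S" if xS: "x \<in> ?S" for a x
  proof (cases "a = 0")
    case True
    have "0 / pC ^ 0 \<in> ?S" using A_0 unfolding Sq_def by blast
    thus ?thesis using True by simp
  next
    case False
    obtain k u u' where u: "a = pZ ^ k * u" "u * u' = 1" using pZ_power_unit_decomp[OF False] .
    obtain z l where z: "z \<in> Zspan (muq q)" "x = z / pC ^ l" using xS by (auto simp: Sq_def)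
    have "emb u * emb u' = 1" using u(2) by (metis emb.hom_mult emb.hom_one)
    moreover from this have "emb u \<noteq> 0" by auto
    ultimately have "emb u' = 1 / emb u" by (simp add: field_simps)
    hence "x / emb a = (emb u' * z) / pC ^ (k + l)"
      by (simp add: u(1) z(2) emb.hom_mult emb_power power_add)
    thus ?thesis using Zspan_scale[OF z(1), of u'] unfolding Sq_def by blast
  qed
  have one: "1 \<in> ?S"
  proof -
    have "1 / pC ^ 0 \<in> ?S" using A_1 unfolding Sq_def by blast
    thus ?thesis by simp
  qed
  have diff: "x - y \<in> ?S" and mult: "x * y \<in> ?S" if xy: "x \<in> ?S" "y \<in> ?S" for x y
  proof -
    obtain z k where z: "z \<in> Zspan (muq q)" "x = z / pC ^ k" using xy by (auto simp: Sq_def)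
    obtain w l where w: "w \<in> Zspan (muq q)" "y = w / pC ^ l" using xy by (auto simp: Sq_def)
    have "x - y = (of_nat (CARD('p) ^ l) * z - of_nat (CARD('p) ^ k) * w) / pC ^ (k + l)"
      by (simp add: z(2) w(2) power_add field_simps)
    moreover have "of_nat (CARD('p) ^ l) * z - of_nat (CARD('p) ^ k) * w \<in> Zspan (muq q)"
      by (intro A_diff A_mult A_of_nat z w)
    ultimately show "x - y \<in> ?S" unfolding Sq_def by blast
    have "x * y = (z * w) / pC ^ (k + l)" by (simp add: z(2) w(2) power_add)
    thus "x * y \<in> ?S" using A_mult[OF z(1) w(1)] unfolding Sq_def by blast
  qed
  have zero: "0 \<in> ?S" using diff[OF one one] by simp
  have add: "x + y \<in> ?S" if "x \<in> ?S" "y \<in> ?S" for x y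
    using diff[OF that(1) diff[OF zero that(2)]] by simp
  have polyS: "poly (embp f) x \<in> ?S" if "x \<in> ?S" for f x
  proof (induction f)
    case 0
    thus ?case using zero by simp
  next
    case (pCons a f)
    have eq: "poly (embp (pCons a f)) x = emb a * 1 + x * poly (embp f) x" by simp
    show ?case unfolding eq by (intro add embS one mult that pCons.IH)
  qed
  have inv: "inverse x \<in> ?S" if x: "x \<in> ?S" for x
  proof (cases "x = 0")
    case False
    \<comment> \<open>Factors X are removed from an annihilating polynomial until the constant term
      is nonzero; that equation is then solved for 1/x.\<close>
    have "F \<noteq> 0 \<Longrightarrow> poly (embp F) x = 0 \<Longrightarrow> inverse x \<in> ?S" for F
    proof (induction F)
      case (pCons a f)
      have eq: "emb a + x * poly (embp f) x = 0" using pCons.prems by simp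
      show ?case
      proof (cases "a = 0")
        case True
        thus ?thesis using pCons False eq by auto
      next
        case a: False
        have "inverse x = (0 - poly (embp f) x) / emb a"
          using eq a False by (simp add: field_simps) (simp add: eq_neg_iff_add_eq_0 add.commute)
        also have "\<dots> \<in> ?S" by (intro divS diff zero polyS x)
        finally show ?thesis .
      qed
    qed simp
    moreover obtain F where "F \<noteq> 0" "poly (embp F) x = 0" by (rule algebraic_over_Z)
    ultimately show ?thesis by blast
  qed (use zero in auto)
  have "to_ac a \<in> ?S" for a :: "'p padic"
  proof (cases a)
    case (Fract b c)
    have "Fract b c = Fract b 1 / Fract c 1" by simp
    hence "to_ac a = (emb b * 1) / emb c" unfolding Fract padic_int_embed_def by (simp only: to_ac_divide mult_1_right)
    also have "\<dots> \<in> ?S" by (intro divS embS one)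
    finally show ?thesis .
  qed
  thus ?thesis unfolding fieldset_def using diff mult inv by blast
qed

lemma muq_subset_Sq:
  assumes q: "good_q TYPE('p :: prime_card) q"
  shows "Zspan (muq q) \<subseteq> (Sq q :: 'p padic_closure set)"
proof
  fix z :: "'p padic_closure" assume "z \<in> Zspan (muq q)"
  hence "z / pC ^ 0 \<in> Sq q" unfolding Sq_def by blast
  thus "z \<in> Sq q" by simp
qed

text \<open>Truncated digit expansions lie in \<open>Sq q\<close> and approximate \<open>y\<close>
  to every order; by \<open>fieldset_closed\<close> such a \<open>y\<close> already belongs to the
  field.\<close>

lemma frobenius_ring_subset_Sq:
  assumes "frobenius_ring A q"
  shows "A \<subseteq> Sq q"
proof
  interpret frobenius_ring A q by fact
  note fin = muq_factorization(1)[OF q]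
  fix y assume y: "y \<in> A"
  show "y \<in> Sq q"
  proof (rule fieldset_closed[OF Sq_fieldset[OF q]])
    fix N
    obtain \<tau> where \<tau>: "\<And>i. \<tau> i \<in> muq q" "pdiv N (y - (\<Sum>i<N. pC ^ i * \<tau> i))"
      using digit_expansion[OF y] by blast
    have "(\<Sum>i<N. pC ^ i * \<tau> i) \<in> Sq q"
      using \<tau>(1) muq_subset_Sq[OF q] Zspan_base[OF fin]
      by (intro fieldset_sum fieldset_mult fieldset_power fieldset_of_nat Sq_fieldset[OF q]) auto
    thus "\<exists>t\<in>Sq q. pdiv N (y - t)" using \<tau>(2) by blast
  qed
qed

text \<open>After clearing the denominator, the expansion of p^k y must start at digit k: an earlier
  nonzero digit is a unit and would contradict divisibility by p^k. Digit k is then the residue of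
  \<open>y\<close>, so \<open>muq q\<close> represents the residue field of
  \<open>Sq q\<close>.\<close>

lemma Sq_integer_digit:
  fixes y :: "'p :: prime_card padic_closure"
  assumes q: "good_q TYPE('p) q" and y: "y \<in> Sq q" "y \<in> OC"
  obtains \<tau> where "\<tau> \<in> muq q" "pdiv 1 (y - \<tau>)"
proof -
  interpret frobenius_ring "Zspan (muq q) :: 'p padic_closure set" q by (rule frobenius_ring_muq[OF q])
  obtain z k where z: "z \<in> Zspan (muq q)" "y = z / pC ^ k" using y by (auto simp: Sq_def)
  obtain \<tau> where \<tau>: "\<And>i. \<tau> i \<in> muq q" "pdiv (Suc k) (z - (\<Sum>i<Suc k. pC ^ i * \<tau> i))"
    using digit_expansion[OF z(1)] by blast
  have zy: "z = pC ^ k * y" using z by simp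
  have "\<tau> i = 0" if "i < k" for i
    using that
  proof (induction i rule: less_induct)
    case (less i)
    have "(\<Sum>j<Suc k. pC ^ j * \<tau> j) = (\<Sum>j<Suc i. pC ^ j * \<tau> j) + (\<Sum>j\<in>{Suc i..<Suc k}. pC ^ j * \<tau> j)"
      using less.prems by (simp only: atLeast0LessThan[symmetric]) (rule sum.atLeastLessThan_concat[symmetric], auto)
    also have "(\<Sum>j<Suc i. pC ^ j * \<tau> j) = pC ^ i * \<tau> i" using less by simp
    finally have eq: "pC ^ i * \<tau> i = z - (\<Sum>j\<in>{Suc i..<Suc k}. pC ^ j * \<tau> j) - (z - (\<Sum>j<Suc k. pC ^ j * \<tau> j))" by simp
    have m: "pdiv (Suc i) (pC ^ j * x)" if "Suc i \<le> j" "x \<in> OC" for j and x :: "'p padic_closure"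
      using pdiv_pC_power_mult[of j 0 x] that(2) by (intro pdiv_mono[OF _ that(1)]) simp
    have "pdiv (Suc i) z" unfolding zy using m[of k y] less.prems y by simp
    moreover have "pdiv (Suc i) (\<Sum>j\<in>{Suc i..<Suc k}. pC ^ j * \<tau> j)"
      using m muq_OC[OF q \<tau>(1)] by (intro pdiv_sum) simp
    moreover have "pdiv (Suc i) (z - (\<Sum>j<Suc k. pC ^ j * \<tau> j))"
      by (rule pdiv_mono[OF \<tau>(2)]) (use less.prems in simp)
    ultimately have "pdiv (Suc i) (pC ^ i * \<tau> i)" unfolding eq by (rule pdiv_diff[OF pdiv_diff])
    hence "pdiv (i + 1) (pC ^ i * \<tau> i)" by simp
    hence "pdiv 1 (\<tau> i)" by (simp only: pdiv_pC_power_mult)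
    hence "NU (\<tau> i)" using pdiv_imp_NU[of 0] by simp
    thus ?case using muq_nonzero_unit(2)[OF q \<tau>(1)[of i]] by blast
  qed
  hence "(\<Sum>i<Suc k. pC ^ i * \<tau> i) = pC ^ k * \<tau> k" by simp
  hence "pdiv (k + 1) (pC ^ k * (y - \<tau> k))" using \<tau>(2) by (simp add: zy right_diff_distrib)
  hence "pdiv 1 (y - \<tau> k)" by (simp only: pdiv_pC_power_mult)
  thus ?thesis using that \<tau>(1) by blast
qed

section \<open>Translation to the algebraic structures of the definition\<close>

abbreviation KC :: "'p :: prime_card padic_closure ring" where
  "KC \<equiv> ring_of_type_algebra"

lemma KC_simps [simp]:
  "carrier KC = UNIV" "x \<otimes>\<^bsub>KC\<^esub> y = x * y" "x \<oplus>\<^bsub>KC\<^esub> y = x + y" "\<one>\<^bsub>KC\<^esub> = 1" "\<zero>\<^bsub>KC\<^esub> = 0"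
  by (simp_all add: ring_of_type_algebra_def)

interpretation KC: cring "KC :: 'p :: prime_card padic_closure ring"
  by (rule cring_from_type_algebra)

lemma KC_uminus [simp]: "\<ominus>\<^bsub>KC\<^esub> (x :: 'p :: prime_card padic_closure) = - x"
  by (rule KC.minus_equality) auto

lemma KC_inv [simp]: "x \<noteq> 0 \<Longrightarrow> inv\<^bsub>KC\<^esub> (x :: 'p :: prime_card padic_closure) = inverse x"
  by (rule KC.comm_inv_char) auto

lemma subfield_iff_fieldset:
  fixes L :: "'p :: prime_card padic_closure set"
  shows "subfield L KC \<and> range to_ac \<subseteq> L \<longleftrightarrow> fieldset L"
proof
  assume L: "subfield L KC \<and> range to_ac \<subseteq> L"
  note sub = subringE[OF subfieldE(1)[OF conjunct1[OF L]]]
  have "x - y \<in> L" if "x \<in> L" "y \<in> L" for x y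
    using sub(7)[OF that(1) sub(5)[OF that(2)]] by simp
  moreover have "x * y \<in> L" if "x \<in> L" "y \<in> L" for x y using sub(6)[OF that] by simp
  moreover have "inverse x \<in> L" if "x \<in> L" for x
    using KC.subfield_m_inv(1)[OF conjunct1[OF L], of x] that by (cases "x = 0") auto
  ultimately show "fieldset L" unfolding fieldset_def using L by blast
next
  assume L: "fieldset L"
  have "subring L KC"
    by (rule KC.subringI) (simp_all add: L fieldset_1 fieldset_uminus fieldset_add fieldset_mult)
  hence "subfield L KC"
    by (rule field.subfieldI'[OF field_from_type_algebra]) (simp add: L fieldset_inverse)
  thus "subfield L KC \<and> range to_ac \<subseteq> L" by (rule conjI[OF _ conjunct1[OF L[unfolded fieldset_def]]])
qed

lemma fieldset_range_to_ac: "fieldset (range to_ac :: 'p :: prime_card padic_closure set)"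
  unfolding fieldset_def by (auto simp flip: to_ac_diff to_ac_mult to_ac_inverse)

lemma subfield_range_to_ac: "subfield (range to_ac) (KC :: 'p :: prime_card padic_closure ring)"
  using subfield_iff_fieldset fieldset_range_to_ac by blast

lemma KC_combine: "KC.combine (map f xs) (map g xs) = (\<Sum>x\<leftarrow>xs. f x * (g x :: 'p :: prime_card padic_closure))"
  by (induction xs) auto

lemma ring_of_integers_eq: "ring_of_integers L = L \<inter> OC"
  by (auto simp: ring_of_integers_def)

lemma integers_cring:
  fixes L :: "'p :: prime_card padic_closure set"
  assumes "fieldset L"
  shows "cring (KC\<lparr>carrier := ring_of_integers L\<rparr>)"
proof -
  have "subring (ring_of_integers L) KC"
    unfolding ring_of_integers_eq[of L]
    by (rule KC.subringI)
       (simp_all add: assms fieldset_1 fieldset_uminus fieldset_add fieldset_mult OC_uminus OC_add OC_mult)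
  hence "subcring (ring_of_integers L) KC" by (rule KC.subcringI')
  thus ?thesis by (rule KC.subcring_iff[THEN iffD1, rotated]) simp
qed

lemma PIdl_pC_iff:
  fixes L :: "'p :: prime_card padic_closure set"
  assumes "fieldset L"
  shows "y \<in> PIdl\<^bsub>KC\<lparr>carrier := ring_of_integers L\<rparr>\<^esub> pC \<longleftrightarrow> y \<in> L \<and> pdiv 1 y"
proof -
  have "y \<in> PIdl\<^bsub>KC\<lparr>carrier := ring_of_integers L\<rparr>\<^esub> pC \<longleftrightarrow> (\<exists>x. x \<in> L \<and> x \<in> OC \<and> y = x * pC)"
    by (auto simp: cgenideal_def ring_of_integers_eq[of L])
  also have "\<dots> \<longleftrightarrow> y / pC \<in> L \<and> y / pC \<in> OC"
    by (auto intro!: exI[of _ "y / pC"])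
  also have "y / pC \<in> L \<longleftrightarrow> y \<in> L"
  proof
    assume "y / pC \<in> L"
    hence "(y / pC) * pC \<in> L" by (intro fieldset_mult assms fieldset_of_nat)
    thus "y \<in> L" by simp
  qed (intro fieldset_divide assms fieldset_of_nat)
  finally show ?thesis by (simp add: pdiv_def)
qed

text \<open>Finite dimension holds because the finite set \<open>muq q\<close> spans. For
  maximality, an integer outside (p) is congruent to a nonzero \<tau>, whose inverse is
  \<tau>^(q-2), so together with p it generates the unit ideal.\<close>

lemma unramified_Sq:
  assumes q: "good_q TYPE('p :: prime_card) q"
  shows "unramified_extension (Sq q :: 'p padic_closure set)"
proof -
  let ?S = "Sq q :: 'p padic_closure set"
  let ?OL = "KC\<lparr>carrier := ring_of_integers ?S\<rparr>"
  note S = Sq_fieldset[OF q]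
  note fin = muq_factorization(1)[OF q]
  interpret OL: cring ?OL by (rule integers_cring[OF S])
  obtain xs :: "'p padic_closure list" where xs: "set xs = muq q" "distinct xs"
    using finite_distinct_list[OF fin] by blast
  have "KC.Span (range to_ac) xs = ?S"
  proof (intro equalityI subsetI)
    fix y assume "y \<in> KC.Span (range to_ac) xs"
    then obtain Ks where Ks: "y = KC.combine Ks xs" "set Ks \<subseteq> range to_ac"
      using KC.Span_eq_combine_set[OF subfield_range_to_ac, of xs] by auto
    have "set xs \<subseteq> ?S" using xs muq_subset_Sq[OF q] Zspan_base[OF fin] by auto
    thus "y \<in> ?S" using Ks(2) unfolding Ks(1)
    proof (induction Ks xs rule: KC.combine.induct)
      case (1 k Ks u Us)
      have "k \<in> ?S" using 1 S by (auto simp: fieldset_def)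
      thus ?case using 1 by (auto intro!: fieldset_add fieldset_mult S)
    qed (auto intro: fieldset_0 S)
  next
    fix y assume "y \<in> ?S"
    then obtain c k where y: "y = (\<Sum>\<tau>\<in>muq q. emb (c \<tau>) * \<tau>) / pC ^ k" by (auto simp: Sq_def Zspan_def)
    define f where "f = (\<lambda>\<tau>. emb (c \<tau>) / pC ^ k)"
    have "y = (\<Sum>\<tau>\<in>muq q. f \<tau> * \<tau>)" by (simp add: y f_def sum_divide_distrib)
    also have "\<dots> = (\<Sum>\<tau>\<leftarrow>xs. f \<tau> * \<tau>)" using xs by (simp add: sum_list_distinct_conv_sum_set)
    also have "\<dots> = KC.combine (map f xs) xs" using KC_combine[of f xs "\<lambda>x. x"] by simp
    finally have "y = KC.combine (map f xs) xs" .
    moreover have "f \<tau> \<in> range to_ac" for \<tau>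
      unfolding f_def by (intro fieldset_divide fieldset_emb fieldset_power fieldset_of_nat fieldset_range_to_ac)
    hence "set (map f xs) \<subseteq> range to_ac" by auto
    ultimately have "y \<in> {KC.combine Ks xs |Ks. set Ks \<subseteq> range to_ac}" by blast
    thus "y \<in> KC.Span (range to_ac) xs"
      using KC.Span_eq_combine_set[OF subfield_range_to_ac, of xs] by simp
  qed
  hence dim: "KC.finite_dimension (range to_ac) ?S"
    using KC.Span_finite_dimension[OF subfield_range_to_ac, of xs] by simp
  have "pC \<in> ?S" "pC \<in> (OC :: 'p padic_closure set)" by (rule fieldset_of_nat[OF S], rule OC_of_nat)
  hence pOL: "pC \<in> carrier ?OL" unfolding ring_of_integers_eq[of ?S] by simp
  have "maximalideal (PIdl\<^bsub>?OL\<^esub> pC) ?OL"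
  proof (rule maximalidealI)
    show "ideal (PIdl\<^bsub>?OL\<^esub> pC) ?OL" by (rule OL.cgenideal_ideal[OF pOL])
    have "1 \<notin> PIdl\<^bsub>?OL\<^esub> pC"
      unfolding PIdl_pC_iff[OF S] using OC_pC_inverse[where 'p = 'p] by (simp add: pdiv_def)
    moreover have "1 \<in> carrier ?OL" by (simp add: ring_of_integers_eq[of ?S] fieldset_1 S)
    ultimately show "carrier ?OL \<noteq> PIdl\<^bsub>?OL\<^esub> pC" by blast
    fix J assume J: "ideal J ?OL" "PIdl\<^bsub>?OL\<^esub> pC \<subseteq> J" "J \<subseteq> carrier ?OL"
    show "J = PIdl\<^bsub>?OL\<^esub> pC \<or> J = carrier ?OL"
    proof (cases "J \<subseteq> PIdl\<^bsub>?OL\<^esub> pC")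
      case False
      then obtain z where z: "z \<in> J" "z \<notin> PIdl\<^bsub>?OL\<^esub> pC" by blast
      have zS: "z \<in> ?S" "z \<in> OC" using z J(3) by (auto simp: ring_of_integers_eq[of ?S])
      then obtain \<tau> where \<tau>: "\<tau> \<in> muq q" "pdiv 1 (z - \<tau>)" using Sq_integer_digit[OF q] by blast
      have "\<tau> \<noteq> 0" using \<tau> z(2) zS by (auto simp: PIdl_pC_iff[OF S])
      note \<tau>1 = muq_nonzero_unit(1)[OF q \<tau>(1) this]
      define \<sigma> where "\<sigma> = \<tau> ^ (q - 2)"
      have \<tau>S: "\<tau> \<in> ?S" using muq_subset_Sq[OF q] Zspan_base[OF fin \<tau>(1)] by blast
      have \<sigma>: "\<sigma> \<in> ?S" "\<sigma> \<in> OC"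
        using \<tau>S muq_OC[OF q \<tau>(1)] by (auto simp: \<sigma>_def intro: fieldset_power S OC_power)
      have "1 - \<sigma> * z = - \<sigma> * (z - \<tau>)" using \<tau>1 by (simp add: \<sigma>_def algebra_simps)
      moreover have "pdiv 1 (- \<sigma> * (z - \<tau>))" using \<tau>(2) \<sigma> by (intro pdiv_mult OC_uminus)
      ultimately have "pdiv 1 (1 - \<sigma> * z)" by simp
      hence "1 - \<sigma> * z \<in> PIdl\<^bsub>?OL\<^esub> pC"
        using \<sigma> zS by (simp add: PIdl_pC_iff[OF S] fieldset_diff fieldset_mult fieldset_1 S)
      hence 1: "1 - \<sigma> * z \<in> J" using J(2) by blast
      have 2: "\<sigma> \<otimes>\<^bsub>?OL\<^esub> z \<in> J"
        using ideal.I_l_closed[OF J(1) z(1), of \<sigma>] \<sigma> by (simp add: ring_of_integers_eq[of ?S])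
      have "(1 - \<sigma> * z) \<oplus>\<^bsub>?OL\<^esub> (\<sigma> \<otimes>\<^bsub>?OL\<^esub> z) \<in> J"
        by (rule additive_subgroup.a_closed[OF ideal.axioms(1)[OF J(1)] 1 2])
      hence "\<one>\<^bsub>?OL\<^esub> \<in> J" by simp
      hence "J = carrier ?OL" by (rule ideal.one_imp_carrier[OF J(1)])
      thus ?thesis ..
    qed (use J in blast)
  qed
  thus ?thesis unfolding unramified_extension_def Let_def using dim subfield_iff_fieldset S by blast
qed

section \<open>Unramified elements\<close>

text \<open>The field F_p[X]/f has p^(degree f) elements, which is the case e = degree f; iterating
  the power map covers multiples of it.\<close>

lemma irreducible_dvd_Frobenius:
  fixes f :: "'p :: prime_card mod_ring poly"
  assumes f: "irreducible f" and d: "degree f dvd e"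
  shows "f dvd (Polynomial.monom 1 1) ^ (CARD('p) ^ e) - Polynomial.monom 1 1"
proof -
  obtain k where e: "e = degree f * k" using d by (rule dvdE)
  define Q where "Q = CARD('p) ^ degree f"
  define t where "t = (Polynomial.monom 1 1 :: 'p mod_ring poly)"
  have base: "f dvd t ^ Q - t" unfolding Q_def t_def by (rule degree_divisor1[OF f refl])
  have "f dvd t ^ (Q ^ k) - t"
  proof (induction k)
    case (Suc k)
    have "t ^ (Q ^ k) - t dvd (t ^ (Q ^ k)) ^ Q - t ^ Q"
      unfolding power_diff_sumr2[of "t ^ (Q ^ k)" Q t] by (rule dvd_triv_left)
    hence "f dvd (t ^ (Q ^ k)) ^ Q - t ^ Q" using Suc by (rule dvd_trans[rotated])
    hence "f dvd ((t ^ (Q ^ k)) ^ Q - t ^ Q) + (t ^ Q - t)" using base by (rule dvd_add)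
    thus ?case by (simp add: power_mult[symmetric] mult.commute)
  qed simp
  thus ?thesis by (simp add: e Q_def t_def power_mult)
qed

text \<open>Every irreducible factor of \<open>g\<close> has degree at most D, hence dividing D!,
  and so divides X^(p^(D!)) - X. There are at most \<open>degree g\<close> such factors, which gives
  the exponent.\<close>

lemma dvd_Frobenius_power:
  fixes g :: "'p :: prime_card mod_ring poly"
  assumes "g \<noteq> 0" "degree g \<le> D"
  shows "g dvd ((Polynomial.monom 1 1) ^ (CARD('p) ^ fact D) - Polynomial.monom 1 1) ^ degree g"
  using assms
proof (induction "degree g" arbitrary: g rule: less_induct)
  case less
  define t where "t = ((Polynomial.monom 1 1) ^ (CARD('p) ^ fact D) - Polynomial.monom 1 1 :: 'p mod_ring poly)"
  show ?case
  proof (cases "degree g = 0")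
    case True
    hence "is_unit g" using less.prems(1) by (simp add: is_unit_iff_degree)
    thus ?thesis by (rule unit_imp_dvd)
  next
    case False
    hence "\<not> is_unit g" using less.prems(1) by (simp add: is_unit_iff_degree)
    then obtain f where f: "f dvd g" "prime f" using prime_divisor_exists[OF less.prems(1)] by blast
    have irr: "irreducible f" by (rule prime_elem_imp_irreducible[OF prime_imp_prime_elem[OF f(2)]])
    obtain h where h: "g = f * h" using f(1) by (rule dvdE)
    have nz: "f \<noteq> 0" "h \<noteq> 0" using h less.prems(1) by auto
    have deg: "degree g = degree f + degree h" using nz by (simp add: h degree_mult_eq)
    have "\<not> is_unit f" using irr by (rule irreducible_not_unit)
    hence df: "degree f > 0" using nz by (simp add: is_unit_iff_degree)
    have "degree f dvd fact D" using df deg less.prems(2) by (intro dvd_fact) auto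
    hence "f dvd t" unfolding t_def by (rule irreducible_dvd_Frobenius[OF irr])
    moreover have "h dvd t ^ degree h"
      unfolding t_def using deg df nz less.prems(2) by (intro less.hyps) auto
    ultimately have "g dvd t * t ^ degree h" unfolding h by (rule mult_dvd_mono)
    also have "t * t ^ degree h = t ^ Suc (degree h)" by simp
    also have "\<dots> dvd t ^ degree g" using df deg by (intro le_imp_power_dvd) simp
    finally show ?thesis by (simp add: t_def)
  qed
qed

lemma red_eq_imp_cong:
  assumes "map_poly red A = map_poly red B"
  obtains R where "A = B + smult pZ R"
proof -
  have "map_poly red (A - B) = 0" using assms by (simp add: redp.hom_minus)
  then obtain R where "A - B = smult pZ R" by (auto simp: red_poly_eq_0_iff elim!: dvdE)
  thus ?thesis using that[of R] by (simp add: algebra_simps)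
qed

abbreviation frob_poly :: "nat \<Rightarrow> 'a :: comm_ring_1 poly" where
  "frob_poly q \<equiv> (Polynomial.monom 1 1) ^ q - Polynomial.monom 1 1"

lemma poly_frob_poly: "poly (embp (frob_poly q)) x = x ^ q - x"
  by (simp add: embp.hom_minus embp_power map_poly_monom poly_monom)

lemma red_frob_poly: "map_poly red (frob_poly q) = frob_poly q"
  by (simp add: redp.hom_minus redp.hom_power map_poly_monom)

lemma red_dvd_imp:
  fixes G T :: "'p :: prime_card padic_int poly"
  assumes "map_poly red G dvd map_poly red T"
  obtains S R where "T = G * S + smult pZ R"
proof -
  obtain s where "map_poly red T = map_poly red G * s" using assms by (rule dvdE)
  hence "map_poly red T = map_poly red (G * map_poly lift s)" by (simp add: redp.hom_mult)
  then obtain R where "T = G * map_poly lift s + smult pZ R" by (rule red_eq_imp_cong)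
  thus ?thesis by (rule that)
qed

text \<open>The D + 1 powers 1, y, ..., y^D are dependent over Q_p. Clearing denominators and then
  the content makes the relation nonzero modulo p, at the price of a leading coefficient that may
  fail to be a unit.\<close>

lemma finite_dimension_annihilator:
  fixes L :: "'p :: prime_card padic_closure set"
  assumes "KC.dimension D (range to_ac) L" "fieldset L" "y \<in> L"
  obtains G :: "'p padic_int poly" where "map_poly red G \<noteq> 0" "degree G \<le> D" "poly (embp G) y = 0"
proof -
  define Us where "Us = map (\<lambda>i. y ^ i) [0..<Suc D]"
  have "set Us \<subseteq> L" using assms by (auto simp: Us_def intro: fieldset_power)
  moreover have "length Us = Suc D" by (simp add: Us_def)
  ultimately have "\<not> KC.independent (range to_ac) Us"
    using KC.independent_length_le_dimension[OF subfield_range_to_ac assms(1), of Us] by auto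
  then obtain Ks where Ks: "length Ks = length Us" "KC.combine Ks Us = 0" "set Ks \<subseteq> range to_ac" "set Ks \<noteq> {0}"
    using KC.dependent_imp_non_trivial_combine[OF subfield_range_to_ac, of Us] by (metis KC_simps(1) KC_simps(5) subset_UNIV)
  define f where "f = (\<lambda>i. of_ac (Ks ! i))"
  have len: "length Ks = Suc D" using Ks(1) by (simp add: Us_def)
  have f: "to_ac (f i) = Ks ! i" if "i < Suc D" for i
  proof -
    have "Ks ! i \<in> set Ks" using that len by simp
    hence "Ks ! i \<in> range to_ac" using Ks(3) by blast
    thus ?thesis unfolding f_def by (rule to_ac_of_ac)
  qed
  define P where "P = pol (Suc D) f"
  have Ks_eq: "Ks = map (\<lambda>i. to_ac (f i)) [0..<Suc D]"
    by (rule nth_equalityI) (use len f in \<open>auto simp del: upt_Suc\<close>)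
  have P0: "poly (map_poly to_ac P) y = 0"
  proof -
    have "poly (map_poly to_ac P) y = (\<Sum>i<Suc D. to_ac (f i) * y ^ i)"
    proof -
      have "map_poly to_ac P = pol (Suc D) (\<lambda>i. to_ac (f i))"
        by (rule poly_eqI) (simp add: P_def coeff_map_poly)
      thus ?thesis by (simp add: pol_def poly_sum poly_monom)
    qed
    also have "\<dots> = (\<Sum>i\<leftarrow>[0..<Suc D]. to_ac (f i) * y ^ i)"
      by (subst sum_list_distinct_conv_sum_set) (auto simp: atLeast0LessThan)
    also have "\<dots> = KC.combine Ks Us" unfolding Ks_eq Us_def by (rule KC_combine[symmetric])
    finally show ?thesis using Ks(2) by simp
  qed
  have "P \<noteq> 0"
  proof
    assume "P = 0"
    hence "f i = 0" if "i < Suc D" for i using that coeff_pol[of "Suc D" f i] by (simp add: P_def)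
    hence "\<forall>x\<in>set Ks. x = 0" unfolding Ks_eq by (simp del: upt_Suc)
    hence "set Ks \<subseteq> {0}" by (intro subsetI) simp
    moreover have "set Ks \<noteq> {}" using len by auto
    ultimately have "set Ks = {0}" using subset_singletonD[of "set Ks" 0] by simp
    thus False using Ks(4) by simp
  qed
  obtain d F where dF: "d \<noteq> 0" "smult (emb d) (map_poly to_ac P) = embp F" using emb_clear_denominators by blast
  have degP: "degree (map_poly to_ac P) = degree P" by (rule degree_map_poly) simp
  have "map_poly to_ac P \<noteq> 0" using \<open>P \<noteq> 0\<close> by (simp add: poly_eq_iff coeff_map_poly)
  hence "embp F \<noteq> 0" using dF(1) by (simp flip: dF(2))
  hence "F \<noteq> 0" by auto
  then obtain v G where G: "F = smult (pZ ^ v) G" "map_poly red G \<noteq> 0" by (rule primitive_decomp)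
  have "degree G = degree (embp F)" using G(1) by simp
  also have "\<dots> = degree P" using dF(1) degP by (simp flip: dF(2))
  also have "\<dots> \<le> D" unfolding P_def by (rule degree_pol_le)
  finally have "degree G \<le> D" .
  moreover have "poly (embp F) y = 0" using P0 by (simp flip: dF(2))
  hence "poly (embp G) y = 0" by (simp add: G(1) embp_smult emb_power)
  ultimately show ?thesis using that G(2) by blast
qed

text \<open>A nonzero reduction of degree at most D divides a power of X^q - X for q = p^(D!), so
  for each integer y of \<open>L\<close> some power of y^q - y is divisible by p. As (p) is a prime
  ideal, y^q - y is divisible itself, and the ring of integers is a Frobenius ring.\<close>

lemma unramified_subset_Sq:
  fixes L :: "'p :: prime_card padic_closure set"
  assumes L: "unramified_extension L"
  obtains e where "e > 0" "L \<subseteq> Sq (CARD('p) ^ e)"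
proof -
  let ?OL = "KC\<lparr>carrier := ring_of_integers L\<rparr>"
  have fs: "fieldset L" and dim: "KC.finite_dimension (range to_ac) L" and max: "maximalideal (PIdl\<^bsub>?OL\<^esub> pC) ?OL"
    using L subfield_iff_fieldset[of L] unfolding unramified_extension_def Let_def by blast+
  interpret OL: cring ?OL by (rule integers_cring[OF fs])
  have prime: "primeideal (PIdl\<^bsub>?OL\<^esub> pC) ?OL" by (rule OL.maximalideal_prime[OF max])
  obtain D where D: "KC.dimension D (range to_ac) L" using dim unfolding KC.finite_dimension_def by blast
  define q where "q = CARD('p) ^ fact D"
  have q: "good_q TYPE('p) q" unfolding good_q_def q_def by (intro exI[of _ "fact D"]) simp
  have OLmem: "x \<in> carrier ?OL \<longleftrightarrow> x \<in> L \<and> x \<in> OC" for x using ring_of_integers_eq[of L] by simp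
  have frob: "pdiv 1 (y ^ q - y)" if y: "y \<in> L" "y \<in> OC" for y
  proof -
    obtain G where G: "map_poly red G \<noteq> 0" "degree G \<le> D" "poly (embp G) y = 0"
      using finite_dimension_annihilator[OF D fs y(1)] by blast
    define m where "m = degree (map_poly red G)"
    have "m \<le> D" using G(2) degree_map_poly_le[of red G] by (simp add: m_def)
    hence "map_poly red G dvd frob_poly q ^ m" unfolding q_def m_def by (intro dvd_Frobenius_power G)
    hence "map_poly red G dvd map_poly red (frob_poly q ^ m)" unfolding redp.hom_power red_frob_poly .
    then obtain S R where SR: "frob_poly q ^ m = G * S + smult pZ R" by (rule red_dvd_imp)
    define w where "w = y ^ q - y"
    have "poly (embp (frob_poly q ^ m)) y = poly (embp (G * S + smult pZ R)) y" by (simp only: SR)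
    hence "w ^ m = pC * poly (embp R) y"
      unfolding embp_power poly_power poly_frob_poly w_def[symmetric] using G(3) by (simp add: embp_add embp_mult embp_smult)
    hence pm: "pdiv 1 (w ^ m)" using OC_poly_embp[OF y(2), of R] by (simp add: pdiv_def)
    have w: "w \<in> L" "w \<in> OC" using y fs by (auto simp: w_def intro: fieldset_diff fieldset_power OC_diff OC_power)
    have "pdiv 1 (w ^ j) \<Longrightarrow> pdiv 1 w" for j
    proof (induction j)
      case 0
      hence "1 / pC \<in> (OC :: 'p padic_closure set)" by (simp add: pdiv_def)
      thus ?case using OC_pC_inverse by blast
    next
      case (Suc j)
      have wj: "w ^ j \<in> L" "w ^ j \<in> OC" using w fs by (auto intro: fieldset_power OC_power)
      have "w \<otimes>\<^bsub>?OL\<^esub> w ^ j \<in> PIdl\<^bsub>?OL\<^esub> pC"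
        unfolding PIdl_pC_iff[OF fs] using Suc.prems w wj fs by (simp add: fieldset_mult)
      hence "w \<in> PIdl\<^bsub>?OL\<^esub> pC \<or> w ^ j \<in> PIdl\<^bsub>?OL\<^esub> pC"
        using primeideal.I_prime[OF prime] OLmem w wj by blast
      thus ?case using Suc.IH unfolding PIdl_pC_iff[OF fs] by blast
    qed
    thus ?thesis using pm unfolding w_def by blast
  qed
  have "frobenius_ring (ring_of_integers L) q"
  proof
    note eq = ring_of_integers_eq[of L]
    show "ring_of_integers L \<subseteq> OC" using eq by blast
    show "1 \<in> ring_of_integers L" unfolding eq using fs by (simp add: fieldset_1)
    fix x y assume xy: "x \<in> ring_of_integers L" "y \<in> ring_of_integers L"
    thus "x - y \<in> ring_of_integers L" "x * y \<in> ring_of_integers L"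
      unfolding eq using fs by (simp_all add: fieldset_diff fieldset_mult OC_diff OC_mult)
  next
    show "good_q TYPE('p) q" by (rule q)
    fix y assume "y \<in> ring_of_integers L"
    hence y: "y \<in> L" "y \<in> OC" using ring_of_integers_eq[of L] by auto
    have "(y ^ q - y) / pC \<in> L" using y fs
      by (intro fieldset_divide fieldset_diff fieldset_power fieldset_of_nat)
    moreover have "(y ^ q - y) / pC \<in> OC" using frob[OF y] by (simp add: pdiv_def)
    ultimately show "(y ^ q - y) / pC \<in> ring_of_integers L" using ring_of_integers_eq[of L] by simp
  qed
  from frobenius_ring_subset_Sq[OF this] have sub: "L \<inter> OC \<subseteq> Sq q" using ring_of_integers_eq[of L] by simp
  have "L \<subseteq> Sq q"
  proof
    fix x assume x: "x \<in> L"
    obtain k where k: "pC ^ k * x \<in> OC" by (rule pC_power_times_OC)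
    have "pC ^ k * x \<in> L" by (intro fieldset_mult fieldset_power fieldset_of_nat fs x)
    hence "pC ^ k * x \<in> Sq q" using k sub by blast
    hence "(pC ^ k * x) / pC ^ k \<in> Sq q" by (intro fieldset_divide fieldset_power fieldset_of_nat Sq_fieldset[OF q])
    thus "x \<in> Sq q" by simp
  qed
  thus ?thesis using that[of "fact D"] by (simp add: q_def)
qed

lemma good_q_power: "e > 0 \<Longrightarrow> good_q TYPE('p :: prime_card) (CARD('p) ^ e)"
  by (auto simp: good_q_def)

lemma padic_unramified_iff:
  fixes x :: "'p :: prime_card padic_closure"
  shows "x \<in> padic_unramified \<longleftrightarrow> (\<exists>e>0. x \<in> Sq (CARD('p) ^ e))"
proof
  assume "x \<in> padic_unramified"
  then obtain L where L: "unramified_extension L" "x \<in> L" by (auto simp: padic_unramified_def)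
  obtain e where "e > 0" "L \<subseteq> Sq (CARD('p) ^ e)" using unramified_subset_Sq[OF L(1)] by blast
  thus "\<exists>e>0. x \<in> Sq (CARD('p) ^ e)" using L(2) by blast
next
  assume "\<exists>e>0. x \<in> Sq (CARD('p) ^ e)"
  thus "x \<in> padic_unramified"
    unfolding padic_unramified_def using unramified_Sq good_q_power by blast
qed

section \<open>Exhaustion of the unramified closure\<close>

lemma Zspan_mono:
  assumes "finite W" "V \<subseteq> W"
  shows "Zspan V \<subseteq> Zspan W"
proof
  fix x assume "x \<in> Zspan V"
  then obtain c where "x = (\<Sum>v\<in>V. emb (c v) * v)" by (auto simp: Zspan_def)
  also have "\<dots> \<in> Zspan W" using assms by (intro Zspan_sum Zspan_scale Zspan_base) auto
  finally show "x \<in> Zspan W" .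
qed

lemma muq_mono:
  assumes "e dvd e'"
  shows "muq (CARD('p) ^ e) \<subseteq> (muq (CARD('p) ^ e') :: 'p :: prime_card padic_closure set)"
proof
  fix \<tau> :: "'p padic_closure" assume \<tau>: "\<tau> \<in> muq (CARD('p) ^ e)"
  obtain k where k: "e' = e * k" using assms by (rule dvdE)
  have "\<tau> ^ ((CARD('p) ^ e) ^ k) = \<tau>"
    using \<tau> by (induction k) (simp_all add: muq_def power_mult)
  thus "\<tau> \<in> muq (CARD('p) ^ e')" by (simp add: muq_def k power_mult)
qed

text \<open>A countable exhaustion of the unramified closure by compact \<open>\<int>\<^sub>p\<close>-modules.\<close>

definition un_level :: "nat \<Rightarrow> 'p :: prime_card padic_closure set" where
  "un_level i = {z / pC ^ i |z. z \<in> Zspan (muq (CARD('p) ^ fact i))}"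

lemma good_q_fact: "good_q TYPE('p :: prime_card) (CARD('p) ^ fact i)"
  by (intro good_q_power) simp

text \<open>Factorials make the exponents divide one another, so the sets \<open>muq\<close> grow
  along with the denominators.\<close>

lemma un_level_mono:
  assumes "i \<le> j"
  shows "un_level i \<subseteq> (un_level j :: 'p :: prime_card padic_closure set)"
proof
  fix x :: "'p padic_closure" assume "x \<in> un_level i"
  then obtain z where z: "z \<in> Zspan (muq (CARD('p) ^ fact i))" "x = z / pC ^ i" by (auto simp: un_level_def)
  have "z \<in> Zspan (muq (CARD('p) ^ fact j))"
    using z(1) Zspan_mono[OF muq_factorization(1)[OF good_q_fact] muq_mono[OF fact_dvd[OF assms]]] by blast
  hence "emb (pZ ^ (j - i)) * z \<in> Zspan (muq (CARD('p) ^ fact j))" by (rule Zspan_scale)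
  moreover have "x = (emb (pZ ^ (j - i)) * z) / pC ^ j"
    using assms by (simp add: z(2) emb_power power_diff)
  ultimately show "x \<in> un_level j" unfolding un_level_def by blast
qed

lemma padic_unramified_eq_UN: "padic_unramified = (\<Union>i. un_level i :: 'p :: prime_card padic_closure set)"
proof (intro equalityI subsetI)
  fix x :: "'p padic_closure" assume "x \<in> padic_unramified"
  then obtain e z k where z: "e > 0" "z \<in> Zspan (muq (CARD('p) ^ e))" "x = z / pC ^ k"
    by (auto simp: padic_unramified_iff Sq_def)
  define i where "i = max e k"
  have "e dvd fact i" using z(1) by (intro dvd_fact) (auto simp: i_def)
  hence "z \<in> Zspan (muq (CARD('p) ^ fact i))"
    using z(2) Zspan_mono[OF muq_factorization(1)[OF good_q_fact] muq_mono] by blast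
  hence "emb (pZ ^ (i - k)) * z \<in> Zspan (muq (CARD('p) ^ fact i))" by (rule Zspan_scale)
  moreover have "x = (emb (pZ ^ (i - k)) * z) / pC ^ i"
    by (simp add: z(3) emb_power power_diff i_def)
  ultimately have "x \<in> un_level i" unfolding un_level_def by blast
  thus "x \<in> (\<Union>i. un_level i)" by blast
next
  fix x :: "'p padic_closure" assume "x \<in> (\<Union>i. un_level i)"
  then obtain i where "x \<in> un_level i" by blast
  hence "x \<in> Sq (CARD('p) ^ fact i)" by (auto simp: un_level_def Sq_def)
  thus "x \<in> padic_unramified" unfolding padic_unramified_iff by (intro exI[of _ "fact i"]) simp
qed

text \<open>Used when a polynomial is made monic, which multiplies its roots by the leading
  coefficient.\<close>

lemma unramified_emb_mult_iff:
  fixes x :: "'p :: prime_card padic_closure"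
  assumes "a \<noteq> 0"
  shows "emb a * x \<in> padic_unramified \<longleftrightarrow> x \<in> padic_unramified"
proof -
  have "emb a * x \<in> Sq (CARD('p) ^ e) \<longleftrightarrow> x \<in> Sq (CARD('p) ^ e)" if "e > 0" for e
  proof
    note S = Sq_fieldset[OF good_q_power[OF that]]
    show "x \<in> Sq (CARD('p) ^ e) \<Longrightarrow> emb a * x \<in> Sq (CARD('p) ^ e)"
      by (intro fieldset_mult fieldset_emb S)
    assume "emb a * x \<in> Sq (CARD('p) ^ e)"
    hence "(emb a * x) / emb a \<in> Sq (CARD('p) ^ e)" by (intro fieldset_divide fieldset_emb S)
    thus "x \<in> Sq (CARD('p) ^ e)" using assms by simp
  qed
  thus ?thesis by (auto simp: padic_unramified_iff)
qed

lemma unramified_div_emb: "emb b / emb a \<in> (padic_unramified :: 'p :: prime_card padic_closure set)"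
proof -
  have "emb b / emb a \<in> (Sq (CARD('p) ^ 1) :: 'p padic_closure set)"
    by (intro fieldset_divide fieldset_emb Sq_fieldset good_q_power) simp_all
  thus ?thesis unfolding padic_unramified_iff by (intro exI[of _ 1]) simp
qed

text \<open>The reduction of \<open>W\<close> divides X^q - X for q = p^e, e its degree. Hence x^q -
  x is p times a polynomial in \<open>x\<close> over Z_p, and the ring generated by \<open>x\<close>
  is a Frobenius ring.\<close>

lemma irreducible_reduction_root_unramified:
  fixes W :: "'p :: prime_card padic_int poly"
  assumes lc: "lead_coeff W = 1" and irr: "irreducible (map_poly red W)" and root: "poly (embp W) x = 0"
  shows "x \<in> padic_unramified"
proof -
  have xO: "x \<in> OC" using lc root unfolding mem_OC_iff by blast
  define e where "e = degree (map_poly red W)"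
  have "\<not> is_unit (map_poly red W)" "map_poly red W \<noteq> 0"
    using irr by (rule irreducible_not_unit) (use irr in auto)
  hence e: "e > 0" by (simp add: e_def is_unit_iff_degree)
  define q where "q = CARD('p) ^ e"
  have q: "good_q TYPE('p) q" unfolding q_def by (rule good_q_power[OF e])
  have "map_poly red W dvd frob_poly q"
    unfolding q_def e_def by (rule irreducible_dvd_Frobenius[OF irr]) simp
  hence "map_poly red W dvd map_poly red (frob_poly q)" unfolding red_frob_poly .
  then obtain S R where SR: "frob_poly q = W * S + smult pZ R" by (rule red_dvd_imp)
  have "poly (embp (frob_poly q)) x = poly (embp (W * S + smult pZ R)) x" by (simp only: SR)
  hence eq: "x ^ q - x = pC * poly (embp R) x"
    unfolding poly_frob_poly using root by (simp add: embp_add embp_mult embp_smult)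
  have "frobenius_ring (range (\<lambda>f. poly (embp f) x)) q" by (rule frobenius_ring_adjoin[OF q xO eq])
  from frobenius_ring_subset_Sq[OF this] have "poly (embp (Polynomial.monom 1 1)) x \<in> Sq q" by blast
  hence "x \<in> Sq q" by (simp add: map_poly_monom poly_monom)
  thus ?thesis unfolding padic_unramified_iff q_def using e by blast
qed

section \<open>Measurability of the number of ramified roots\<close>

instance fract :: ("{idom, ring_char_0}") field_char_0
proof
  show "inj (of_nat :: nat \<Rightarrow> 'a fract)"
  proof (rule injI)
    fix m n :: nat assume "(of_nat m :: 'a fract) = of_nat n"
    hence "Fract (of_nat m :: 'a) 1 = Fract (of_nat n) 1" by (simp add: of_nat_fract)
    thus "m = n" by (simp add: eq_fract)
  qed
qed

section \<open>Root multisets and root counts\<close>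

abbreviation rts :: "'p :: prime_card padic_int poly \<Rightarrow> 'p padic_closure multiset" where
  "rts P \<equiv> proots (embp P)"

definition lin :: "'a :: comm_ring_1 \<Rightarrow> 'a poly" where
  "lin x = [:-x, 1:]"

lemma lin_neq_0 [simp]: "lin x \<noteq> 0" by (simp add: lin_def)

lemma poly_lin [simp]: "poly (lin x) y = y - x" by (simp add: lin_def)

lemma lead_coeff_lin [simp]: "lead_coeff (lin x) = 1" by (simp add: lin_def)

lemma proots_lin: "proots (lin x) = {#x :: 'a :: idom#}"
  using proots_linear_factor[of "-x"] by (simp only: lin_def minus_minus)

lemma proots_prod_linear: "proots (\<Prod>x\<in>#A. lin (x)) = (A :: 'a :: idom multiset)"
proof (induction A)
  case (add a A)
  have "(\<Prod>x\<in>#A. lin (x)) \<noteq> 0" by (auto simp: prod_mset_zero_iff)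
  thus ?case using add by (simp add: proots_mult proots_lin)
qed simp

lemma alg_closed_proots_factorization:
  fixes F :: "'a :: alg_closed_field poly"
  assumes "F \<noteq> 0"
  shows "F = smult (lead_coeff F) (\<Prod>x\<in>#proots F. lin (x))" "size (proots F) = degree F"
proof -
  obtain A where A: "size A = degree F" "F = smult (lead_coeff F) (\<Prod>x\<in>#A. lin (x))"
    using alg_closed_imp_factorization[OF assms] unfolding lin_def by blast
  have "proots F = A"
    by (subst A(2)) (use assms in \<open>simp add: proots_prod_linear\<close>)
  thus "F = smult (lead_coeff F) (\<Prod>x\<in>#proots F. lin (x))" "size (proots F) = degree F" using A by simp_all
qed

lemma num_roots_in_mult:
  assumes "P \<noteq> 0" "Q \<noteq> 0"
  shows "num_roots_in U (P * Q) = num_roots_in U P + num_roots_in U Q"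
  using assms by (simp add: num_roots_in_def embp_mult proots_mult)

lemma num_roots_in_smult: "c \<noteq> 0 \<Longrightarrow> num_roots_in U (smult c P) = num_roots_in U P"
  by (simp add: num_roots_in_def embp_smult)

lemma num_roots_in_le: "num_roots_in U P \<le> degree P"
  unfolding num_roots_in_def using size_proots_le[of "embp P"]
  by (intro order_trans[OF size_filter_mset_lesseq]) simp

lemma num_roots_in_Compl:
  assumes "P \<noteq> 0"
  shows "num_roots_in (- U) P + num_roots_in U P = degree P"
proof -
  have "size (rts P) = degree P" using alg_closed_proots_factorization(2)[of "embp P"] assms by simp
  moreover have "size (rts P) = size ({#x \<in># rts P. x \<in> U#} + {#x \<in># rts P. x \<notin> U#})"
    by (rule arg_cong[OF multiset_partition])
  ultimately have "degree P = size ({#x \<in># rts P. x \<in> U#} + {#x \<in># rts P. x \<notin> U#})"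
    by (rule trans[OF sym])
  thus ?thesis unfolding num_roots_in_def Compl_iff size_union by linarith
qed

text \<open>A multiset is finite, so one member of the chain already contains all of its elements
  that lie in the union.\<close>

lemma size_filter_UN_chain:
  assumes mono: "\<And>i j :: nat. i \<le> j \<Longrightarrow> T i \<subseteq> T j"
  shows "k \<le> size {#x \<in># A. x \<in> (\<Union>i. T i)#} \<longleftrightarrow> (\<exists>i. k \<le> size {#x \<in># A. x \<in> T i#})"
proof
  assume k: "k \<le> size {#x \<in># A. x \<in> (\<Union>i. T i)#}"
  have "\<forall>x\<in>set_mset A. \<exists>i. x \<in> (\<Union>i. T i) \<longrightarrow> x \<in> T i" by blast
  from bchoice[OF this] obtain f where f: "\<And>x. x \<in># A \<Longrightarrow> x \<in> (\<Union>i. T i) \<Longrightarrow> x \<in> T (f x)" by blast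
  define m where "m = Max (insert 0 (f ` set_mset A))"
  have "x \<in> T m" if "x \<in># A" "x \<in> (\<Union>i. T i)" for x
  proof -
    have "f x \<le> m" unfolding m_def using that(1) by (intro Max_ge) auto
    thus ?thesis using f[OF that] mono[of "f x" m] by blast
  qed
  hence "{#x \<in># A. x \<in> (\<Union>i. T i)#} = {#x \<in># A. x \<in> T m#}"
    by (intro filter_mset_cong refl) blast
  thus "\<exists>i. k \<le> size {#x \<in># A. x \<in> T i#}" using k by auto
next
  assume "\<exists>i. k \<le> size {#x \<in># A. x \<in> T i#}"
  then obtain i where "k \<le> size {#x \<in># A. x \<in> T i#}" by blast
  also have "\<dots> \<le> size {#x \<in># A. x \<in> (\<Union>i. T i)#}"
    by (intro size_mset_mono) (auto simp: subseteq_mset_def)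
  finally show "k \<le> size {#x \<in># A. x \<in> (\<Union>i. T i)#}" .
qed

text \<open>Sequential compactness of Z_p^D. Infinite index sets are refined by pigeonhole over the
  finitely many residue classes of each level, and completeness provides the limit.\<close>

lemma cong_level_seq_compact:
  fixes c :: "nat \<Rightarrow> nat \<Rightarrow> 'p :: prime_card padic_int"
  shows "\<exists>l. \<forall>N. \<exists>N'\<ge>N. cong_level D N (c N') l"
proof -
  define P where "P = (\<lambda>N (I :: nat set). infinite I \<and> (\<exists>a. \<forall>n\<in>I. cong_level D N (c n) a))"
  have "P 0 UNIV" by (auto simp: P_def)
  hence ex0: "\<exists>I. P 0 I" by blast
  have step: "\<exists>J. P (Suc N) J \<and> J \<subseteq> I" if "P N I" for N I
  proof -
    obtain A :: "(nat \<Rightarrow> 'p padic_int) set" where A: "finite A" "\<And>z. \<exists>a\<in>A. cong_level D (Suc N) z a"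
      using finite_level_reps[of D "Suc N"] by blast
    have "I \<subseteq> (\<Union>a\<in>A. {n\<in>I. cong_level D (Suc N) (c n) a})" using A(2) by blast
    moreover have "infinite I" using that by (simp add: P_def)
    ultimately have "infinite (\<Union>a\<in>A. {n\<in>I. cong_level D (Suc N) (c n) a})" by (rule infinite_super)
    hence "\<exists>a\<in>A. infinite {n\<in>I. cong_level D (Suc N) (c n) a}" using A(1) by auto
    then obtain a where "infinite {n\<in>I. cong_level D (Suc N) (c n) a}" by blast
    hence "P (Suc N) {n\<in>I. cong_level D (Suc N) (c n) a}" unfolding P_def by blast
    thus ?thesis by blast
  qed
  obtain I where I: "\<And>N. P N (I N)" "\<And>N. I (Suc N) \<subseteq> I N"
    using dependent_nat_choice[of P "\<lambda>_ I J. J \<subseteq> I", OF ex0 step] by blast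
  have "\<forall>N. \<exists>a. \<forall>n\<in>I N. cong_level D N (c n) a" using I(1) by (simp add: P_def)
  from choice[OF this] obtain a where a: "\<And>N n. n \<in> I N \<Longrightarrow> cong_level D N (c n) (a N)" by blast
  have "cong_level D N (a (Suc N)) (a N)" for N
  proof -
    have "I (Suc N) \<noteq> {}" using I(1)[of "Suc N"] by (auto simp: P_def)
    then obtain n where n: "n \<in> I (Suc N)" by blast
    have "cong_level D N (c n) (a (Suc N))" by (rule cong_level_mono[OF a[OF n]]) simp
    moreover have "cong_level D N (c n) (a N)" using a n I(2) by blast
    ultimately show ?thesis by (simp add: cong_level_def)
  qed
  from cong_level_limit[OF this] obtain l where l: "\<And>N. cong_level D N l (a N)" by blast
  have "\<exists>N'\<ge>N. cong_level D N (c N') l" for N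
  proof -
    have "infinite (I N)" using I(1) by (simp add: P_def)
    then obtain n where "n \<in> I N" "n \<ge> N" unfolding infinite_nat_iff_unbounded_le by blast
    thus ?thesis using a[of n N] l[of N] by (intro exI[of _ n]) (simp add: cong_level_def)
  qed
  thus ?thesis by blast
qed

section \<open>Congruences between polynomials over the closure\<close>

definition pdivp :: "nat \<Rightarrow> 'p :: prime_card padic_closure poly \<Rightarrow> bool" where
  "pdivp N h \<longleftrightarrow> (\<forall>i. pdiv N (coeff h i))"

lemma pdivp_add: "pdivp N f \<Longrightarrow> pdivp N g \<Longrightarrow> pdivp N (f + g)"
  and pdivp_diff: "pdivp N f \<Longrightarrow> pdivp N g \<Longrightarrow> pdivp N (f - g)"
  and pdivp_0 [simp]: "pdivp N 0"
  by (simp_all add: pdivp_def pdiv_add pdiv_diff)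

lemma pdivp_mult: "pdivp N f \<Longrightarrow> pdivp 0 g \<Longrightarrow> pdivp N (f * g)"
  unfolding pdivp_def coeff_mult by (intro allI pdiv_sum pdiv_mult') auto

lemma pdivp_mult': "pdivp 0 f \<Longrightarrow> pdivp N g \<Longrightarrow> pdivp N (f * g)"
  using pdivp_mult[of N g f] by (simp add: mult.commute)

lemma pdivp_pCons: "pdiv N a \<Longrightarrow> pdivp N f \<Longrightarrow> pdivp N (pCons a f)"
  unfolding pdivp_def
proof
  fix i assume "pdiv N a" "\<forall>i. pdiv N (coeff f i)"
  thus "pdiv N (coeff (pCons a f) i)" by (cases i) (simp_all only: coeff_pCons_0 coeff_pCons_Suc)
qed

lemma pdivp_linear: "x \<in> OC \<Longrightarrow> pdivp 0 (lin x)"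
  unfolding lin_def by (intro pdivp_pCons pdivp_0) (simp_all only: pdiv_0 OC_uminus OC_1)

lemma pdivp_1: "pdivp 0 1"
  unfolding one_pCons by (intro pdivp_pCons pdivp_0) (simp only: pdiv_0 OC_1)

lemma pdivp_prod_mset: "(\<And>x. x \<in># A \<Longrightarrow> x \<in> OC) \<Longrightarrow> pdivp 0 (\<Prod>x\<in>#A. lin (x))"
proof (induction A)
  case (add a A)
  have "pdivp 0 (lin (a) * (\<Prod>x\<in>#A. lin (x)))"
    using add by (intro pdivp_mult pdivp_linear) auto
  thus ?case by simp
qed (simp add: pdivp_1)

lemma pdivp_prod_linear: "(\<And>i. i < (k :: nat) \<Longrightarrow> x i \<in> OC) \<Longrightarrow> pdivp 0 (\<Prod>i<k. lin (x i))"
  by (induction k) (auto intro!: pdivp_mult pdivp_linear pdivp_1)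

text \<open>Telescoping: one linear factor is exchanged at a time.\<close>

lemma pdivp_prod_linear_diff:
  fixes x y :: "nat \<Rightarrow> 'p :: prime_card padic_closure"
  assumes "\<And>i. i < k \<Longrightarrow> x i \<in> OC \<and> y i \<in> OC \<and> pdiv N (x i - y i)"
  shows "pdivp N ((\<Prod>i<k. lin (x i)) - (\<Prod>i<k. lin (y i)))"
  using assms
proof (induction k)
  case (Suc k)
  define A B where "A = (\<Prod>i<k. lin (x i))" and "B = (\<Prod>i<k. lin (y i))"
  have "A * lin (x k) - B * lin (y k) = (A - B) * lin (x k) + B * (lin (x k) - lin (y k))"
    by (simp add: algebra_simps)
  moreover have "pdivp N (lin (x k) - lin (y k))"
  proof -
    have "pdiv N (0 - (x k - y k))" by (rule pdiv_diff[OF pdiv_zero]) (use Suc.prems in simp)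
    moreover have "lin (x k) - lin (y k) = [:0 - (x k - y k):]" by (simp add: lin_def)
    ultimately show ?thesis by (simp only:) (intro pdivp_pCons pdivp_0)
  qed
  moreover have "pdivp N (A - B)" unfolding A_def B_def using Suc by simp
  moreover have "pdivp 0 B" unfolding B_def using Suc.prems by (intro pdivp_prod_linear) simp
  ultimately have "pdivp N (A * lin (x k) - B * lin (y k))"
    using Suc.prems[of k] by (simp only:) (intro pdivp_add pdivp_mult[OF _ pdivp_linear] pdivp_mult'; simp)
  thus ?case by (simp add: A_def B_def)
qed simp

text \<open>Long division by a monic polynomial never divides coefficients, so every subtraction
  step preserves divisibility by p^N.\<close>

lemma pdivp_mod_monic:
  fixes W D :: "'p :: prime_card padic_closure poly"
  assumes D: "lead_coeff D = 1" "pdivp 0 D" and W: "pdivp N W"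
  shows "pdivp N (W mod D)"
  using W
proof (induction "degree W" arbitrary: W rule: less_induct)
  case less
  show ?case
  proof (cases "degree W < degree D \<or> W = 0")
    case True
    hence "W mod D = W" by (auto simp: mod_poly_less)
    thus ?thesis using less.prems by simp
  next
    case False
    define m where "m = Polynomial.monom (lead_coeff W) (degree W - degree D)"
    define W' where "W' = W - m * D"
    have m: "pdivp N m" using less.prems by (simp add: m_def pdivp_def)
    have W': "pdivp N W'" unfolding W'_def by (intro pdivp_diff pdivp_mult m less.prems D)
    have "W mod D = W' mod D" by (simp add: W'_def mod_diff_eq[symmetric])
    moreover have "pdivp N (W' mod D)"
    proof (cases "W' = 0")
      case nz: False
      have "coeff (m * D) (degree W) = lead_coeff W"
        using False D(1) by (simp add: m_def coeff_monom_mult)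
      hence "coeff W' (degree W) = 0" by (simp add: W'_def)
      moreover have "degree (m * D) \<le> degree W"
        using False degree_mult_le[of m D] degree_monom_le[of "lead_coeff W" "degree W - degree D"]
        unfolding m_def by linarith
      hence "degree W' \<le> degree W" unfolding W'_def by (intro degree_diff_le) auto
      ultimately have "degree W' < degree W" using nz by (metis leading_coeff_neq_0 le_neq_implies_less)
      thus ?thesis using less.hyps W' by blast
    qed simp
    ultimately show ?thesis by simp
  qed
qed

abbreviation monp :: "nat \<Rightarrow> (nat \<Rightarrow> 'a) \<Rightarrow> 'a :: comm_ring_1 poly" where
  "monp n z \<equiv> Polynomial.monom 1 n + pol n z"

lemma degree_monp [simp]: "degree (monp n z) = n"
  by (intro antisym degree_le le_degree) auto

lemma lead_coeff_monp: "lead_coeff (monp n z) = 1" by simp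

lemma monp_neq_0 [simp]: "monp n z \<noteq> 0"
  using lead_coeff_monp[of n z] by (metis leading_coeff_0_iff zero_neq_one)

lemma rts_monp_OC: "x \<in># rts (monp n z) \<Longrightarrow> x \<in> OC"
  unfolding mem_OC_iff using lead_coeff_monp[of n z] by (intro exI[of _ "monp n z"]) simp

text \<open>A closedness statement. The \<open>k\<close> roots of each approximating polynomial are
  recorded by their coordinates in Z_p. A limit point of these coordinates gives \<open>k\<close>
  elements of the same set, and the product of their linear factors divides the limit polynomial
  because the remainder is divisible by every p^N. Working with a divisor rather than with single
  roots accounts for multiplicities.\<close>

lemma roots_in_Zspan_closed:
  fixes V :: "'p :: prime_card padic_closure set"
  assumes fin: "finite V" and V: "V \<subseteq> OC" and z: "z \<in> vecs n"
    and approx: "\<And>N. \<exists>z'. cong_level n N z' z \<and> k \<le> size {#x \<in># rts (monp n z'). x \<in> (\<lambda>v. v / pC ^ l) ` Zspan V#}"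
  shows "k \<le> size {#x \<in># rts (monp n z). x \<in> (\<lambda>v. v / pC ^ l) ` Zspan V#}"
proof -
  let ?T = "(\<lambda>v. v / pC ^ l) ` Zspan V"
  obtain vs where vs: "set vs = V" "distinct vs" using finite_distinct_list[OF fin] by blast
  define r where "r = length vs"
  \<comment> \<open>The i-th root is read from the block of \<open>r\<close> coordinates starting at
    i r; the denominator p^l is common to all.\<close>
  define pt where "pt = (\<lambda>(c :: nat \<Rightarrow> 'p padic_int) i. (\<Sum>j<r. emb (c (i * r + j)) * vs ! j) / pC ^ l)"
  have ptT: "pt c i \<in> ?T" for c i
  proof -
    have "(\<Sum>j<r. emb (c (i * r + j)) * vs ! j) \<in> Zspan V"
      using vs fin by (intro Zspan_sum Zspan_scale Zspan_base) (auto simp: r_def)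
    thus ?thesis by (simp add: pt_def)
  qed
  have ex: "\<exists>z' c Q. cong_level n N z' z \<and> (\<forall>i<k. pt c i \<in> OC) \<and> pdivp 0 Q \<and>
      embp (monp n z') = (\<Prod>i<k. lin (pt c i)) * Q" for N
  proof -
    obtain z' where z': "cong_level n N z' z" "k \<le> size {#x \<in># rts (monp n z'). x \<in> ?T#}" using approx by blast
    obtain xs where xs: "mset xs = {#x \<in># rts (monp n z'). x \<in> ?T#}" using ex_mset by blast
    have len: "k \<le> length xs" using z'(2) by (simp flip: xs)
    have set_xs: "x \<in> ?T \<and> x \<in># rts (monp n z')" if "x \<in> set xs" for x
      using that xs by (metis (no_types, lifting) mem_Collect_eq set_mset_filter set_mset_mset)
    define A where "A = mset (drop k xs) + {#x \<in># rts (monp n z'). x \<notin> ?T#}"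
    have "rts (monp n z') = mset xs + {#x \<in># rts (monp n z'). x \<notin> ?T#}"
      unfolding xs by (rule multiset_partition)
    also have "mset xs = mset (take k xs) + mset (drop k xs)"
      by (metis append_take_drop_id mset_append)
    also have "mset (take k xs) + mset (drop k xs) + {#x \<in># rts (monp n z'). x \<notin> ?T#} = mset (take k xs) + A"
      by (simp only: A_def add.assoc)
    finally have rts_eq: "rts (monp n z') = mset (take k xs) + A" .
    have "lead_coeff (embp (monp n z')) = 1" by simp
    hence fact: "embp (monp n z') = (\<Prod>x\<in>#mset (take k xs) + A. lin (x))"
      using alg_closed_proots_factorization(1)[of "embp (monp n z')"] monp_neq_0[of n z'] rts_eq by simp
    have "\<exists>c :: nat \<Rightarrow> 'p padic_int. xs ! i = (\<Sum>j<r. emb (c j) * vs ! j) / pC ^ l" if "i < k" for i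
    proof -
      have "xs ! i \<in> set xs" using that len by simp
      then obtain v where v: "v \<in> Zspan V" "xs ! i = v / pC ^ l" using set_xs by blast
      obtain d where "v = (\<Sum>w\<in>V. emb (d w) * w)" using v(1) by (auto simp: Zspan_def)
      also have "\<dots> = (\<Sum>j<r. emb (d (vs ! j)) * vs ! j)"
        using vs by (intro sum.reindex_bij_betw[symmetric, OF bij_betw_nth]) (auto simp: r_def)
      finally show ?thesis using v(2) by (intro exI[of _ "\<lambda>j. d (vs ! j)"]) simp
    qed
    hence "\<forall>i\<in>{..<k}. \<exists>c :: nat \<Rightarrow> 'p padic_int. xs ! i = (\<Sum>j<r. emb (c j) * vs ! j) / pC ^ l" by blast
    from bchoice[OF this] obtain cc :: "nat \<Rightarrow> nat \<Rightarrow> 'p padic_int"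
      where cc: "\<And>i. i < k \<Longrightarrow> xs ! i = (\<Sum>j<r. emb (cc i j) * vs ! j) / pC ^ l" by auto
    define c where "c = (\<lambda>m. cc (m div r) (m mod r))"
    have pt: "pt c i = xs ! i" if "i < k" for i
    proof -
      have "c (i * r + j) = cc i j" if "j < r" for j using that by (simp add: c_def)
      thus ?thesis by (simp add: pt_def cc[OF that])
    qed
    have "pt c i \<in> OC" if "i < k" for i
    proof -
      have "xs ! i \<in> set xs" using that len by simp
      hence "xs ! i \<in># rts (monp n z')" using set_xs by blast
      thus ?thesis unfolding pt[OF that] by (rule rts_monp_OC)
    qed
    moreover have "pdivp 0 (\<Prod>x\<in>#A. lin (x))"
      using rts_eq rts_monp_OC[of _ n z'] by (intro pdivp_prod_mset) simp
    moreover have "embp (monp n z') = (\<Prod>i<k. lin (pt c i)) * (\<Prod>x\<in>#A. lin (x))"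
    proof -
      have "take k xs = map (pt c) [0..<k]" using len pt by (intro nth_equalityI) auto
      hence tk: "mset (take k xs) = image_mset (pt c) (mset_set {..<k})" by (simp add: atLeast0LessThan)
      show ?thesis unfolding fact tk
        by (simp add: image_mset.compositionality o_def prod_unfold_prod_mset)
    qed
    ultimately show ?thesis using z'(1) by blast
  qed
  obtain zz cs Qs where seq: "\<And>N. cong_level n N (zz N) z" "\<And>N i. i < k \<Longrightarrow> pt (cs N) i \<in> OC"
    "\<And>N. pdivp 0 (Qs N)" "\<And>N. embp (monp n (zz N)) = (\<Prod>i<k. lin (pt (cs N) i)) * Qs N"
  proof -
    define R where "R = (\<lambda>N z' c Q. cong_level n N z' z \<and> (\<forall>i<k. pt c i \<in> OC) \<and> pdivp 0 Q \<and>
      embp (monp n z') = (\<Prod>i<k. lin (pt c i)) * Q)"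
    have "\<forall>N. \<exists>s. R N (fst s) (fst (snd s)) (snd (snd s))" using ex by (simp add: R_def)
    from choice[OF this] obtain s where "\<And>N. R N (fst (s N)) (fst (snd (s N))) (snd (snd (s N)))" by blast
    thus ?thesis by (intro that[of "\<lambda>N. fst (s N)" "\<lambda>N. fst (snd (s N))" "\<lambda>N. snd (snd (s N))"]) (simp_all add: R_def)
  qed
  obtain c where c: "\<And>N. \<exists>N'\<ge>N. cong_level (k * r) N (cs N') c"
    using cong_level_seq_compact[of "k * r" cs] by blast
  define D where "D = (\<Prod>i<k. lin (pt c i))"
  \<comment> \<open>Division by p^l costs \<open>l\<close> digits, so the coordinates are compared
    at level N + l.\<close>
  have diff: "pdiv N (pt c i - pt c' i)" if "cong_level (k * r) (N + l) c' c" "i < k" for c' N i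
  proof -
    have "pt c i - pt c' i = (\<Sum>j<r. emb (c (i * r + j) - c' (i * r + j)) * vs ! j) / pC ^ l"
      by (simp add: pt_def diff_divide_distrib[symmetric] sum_subtractf[symmetric] emb.hom_minus left_diff_distrib)
    moreover have "pdiv (l + N) (\<Sum>j<r. emb (c (i * r + j) - c' (i * r + j)) * vs ! j)"
    proof (intro pdiv_sum pdiv_mult' pdiv_emb)
      fix j assume j: "j \<in> {..<r}"
      hence "i * r + j < Suc i * r" by simp
      also have "\<dots> \<le> k * r" using that(2) by (intro mult_right_mono) auto
      finally show "pZ ^ (l + N) dvd c (i * r + j) - c' (i * r + j)"
        using that(1) by (simp add: cong_level_def residue_eq_iff[symmetric] add.commute)
      show "vs ! j \<in> OC" using j V vs(1) by (auto simp: r_def)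
    qed
    ultimately show ?thesis by (simp add: pdiv_def power_add)
  qed
  have OCc: "pt c i \<in> OC" if "i < k" for i
  proof -
    obtain N' where "cong_level (k * r) (0 + l) (cs N') c" using c[of l] by auto
    hence "pdiv 0 (pt c i - pt (cs N') i)" using that by (rule diff)
    hence "(pt c i - pt (cs N') i) + pt (cs N') i \<in> OC" using seq(2)[OF that] by (intro OC_add) auto
    thus ?thesis by simp
  qed
  have D: "lead_coeff D = 1" "pdivp 0 D"
    unfolding D_def using OCc by (auto simp: lead_coeff_prod intro: pdivp_prod_linear)
  have "pdivp N (embp (monp n z) mod D)" for N
  proof -
    obtain N' where N': "N' \<ge> N + l" "cong_level (k * r) (N + l) (cs N') c" using c by blast
    have 1: "pdivp N (embp (monp n z) - embp (monp n (zz N')))"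
    proof -
      have "pdiv N (emb (z i - zz N' i))" if "i < n" for i
      proof (rule pdiv_emb)
        have "cong_level n N (zz N') z" using N'(1) by (intro cong_level_mono[OF seq(1)]) simp
        thus "pZ ^ N dvd z i - zz N' i" using that by (simp add: cong_level_def residue_eq_iff[symmetric])
      qed
      thus ?thesis by (auto simp: pdivp_def emb.hom_minus)
    qed
    have "pdivp N (D - (\<Prod>i<k. lin (pt (cs N') i)))"
      unfolding D_def using OCc seq(2) diff[OF N'(2)] by (intro pdivp_prod_linear_diff) blast
    hence 2: "pdivp N ((D - (\<Prod>i<k. lin (pt (cs N') i))) * Qs N')" using seq(3) by (rule pdivp_mult)
    have "embp (monp n z) - D * Qs N' = (embp (monp n z) - embp (monp n (zz N'))) - (D - (\<Prod>i<k. lin (pt (cs N') i))) * Qs N'"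
      unfolding seq(4)[of N'] by (simp add: algebra_simps)
    hence "pdivp N (embp (monp n z) - D * Qs N')" using pdivp_diff[OF 1 2] by (simp only:)
    hence "pdivp N ((embp (monp n z) - D * Qs N') mod D)" by (rule pdivp_mod_monic[OF D])
    thus ?thesis by (simp add: mod_diff_eq[symmetric])
  qed
  hence "coeff (embp (monp n z) mod D) i = 0" for i
    by (intro pdiv_all_imp_0) (simp add: pdivp_def)
  hence "embp (monp n z) mod D = 0" by (simp add: poly_eq_iff)
  then obtain Q where Q: "embp (monp n z) = D * Q" by (auto simp: mod_eq_0_iff_dvd elim!: dvdE)
  have "embp (monp n z) \<noteq> 0" using monp_neq_0[of n z] by simp
  hence nz: "D \<noteq> 0" "Q \<noteq> 0" using Q by auto
  have "D = (\<Prod>x\<in>#image_mset (pt c) (mset_set {..<k}). lin x)"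
    by (simp add: D_def image_mset.compositionality o_def prod_unfold_prod_mset)
  hence "proots D = image_mset (pt c) (mset_set {..<k})" by (simp only: proots_prod_linear)
  moreover have "{#x \<in># image_mset (pt c) (mset_set {..<k}). x \<in> ?T#} = image_mset (pt c) (mset_set {..<k})"
    using ptT by (auto simp: filter_mset_eq_conv)
  ultimately have "{#x \<in># rts (monp n z). x \<in> ?T#} = image_mset (pt c) (mset_set {..<k}) + {#x \<in># proots Q. x \<in> ?T#}"
    unfolding Q proots_mult[OF nz] filter_union_mset by (simp only:)
  thus ?thesis by simp
qed

abbreviation Zn :: "'p :: prime_card padic_int poly \<Rightarrow> nat" where
  "Zn P \<equiv> num_roots_in (- padic_unramified) P"

section \<open>Passage to monic polynomials\<close>

lemma prod_mset_lin_scale: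
  fixes a :: "'a :: comm_ring_1"
  shows "(\<Prod>x\<in>#A. a * y - a * x) = a ^ size A * (\<Prod>x\<in>#A. y - x)"
  by (induction A) (simp_all add: algebra_simps)

lemma proots_monicize:
  fixes G :: "'p :: prime_card padic_closure poly"
  assumes "degree G > 0"
  shows "proots (monicize G) = image_mset (\<lambda>x. lead_coeff G * x) (proots G)"
proof -
  define a where "a = lead_coeff G"
  have "G \<noteq> 0" using assms by auto
  hence a: "a \<noteq> 0" by (simp add: a_def)
  note fact = alg_closed_proots_factorization[OF \<open>G \<noteq> 0\<close>]
  have "poly (monicize G) y = poly (\<Prod>x\<in>#image_mset (\<lambda>x. a * x) (proots G). lin x) y" for y
  proof -
    have "poly (monicize G) (a * (y / a)) = a ^ (degree G - 1) * poly G (y / a)"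
      unfolding a_def by (rule poly_monicize[OF assms])
    also have "poly G (y / a) = a * (\<Prod>x\<in>#proots G. y / a - x)"
      by (subst fact(1)) (simp add: poly_prod_mset a_def)
    also have "a ^ (degree G - 1) * (a * (\<Prod>x\<in>#proots G. y / a - x)) = a ^ size (proots G) * (\<Prod>x\<in>#proots G. y / a - x)"
      unfolding fact(2) using assms by (cases "degree G") simp_all
    also have "\<dots> = (\<Prod>x\<in>#proots G. a * (y / a) - a * x)" by (rule prod_mset_lin_scale[symmetric])
    finally show ?thesis using a by (simp add: poly_prod_mset image_mset.compositionality o_def)
  qed
  hence "poly (monicize G) = poly (\<Prod>x\<in>#image_mset (\<lambda>x. a * x) (proots G). lin x)" by blast
  hence "monicize G = (\<Prod>x\<in>#image_mset (\<lambda>x. a * x) (proots G). lin x)" by (simp only: poly_eq_poly_eq_iff)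
  hence "proots (monicize G) = image_mset (\<lambda>x. a * x) (proots G)" by (simp only: proots_prod_linear)
  thus ?thesis by (simp only: a_def)
qed

text \<open>The roots are multiplied by the leading coefficient, a nonzero element of Q_p, which
  neither creates nor destroys unramified roots. The monic polynomial has integral roots, as the
  closedness argument requires.\<close>

lemma num_roots_in_monicize:
  fixes F :: "'p :: prime_card padic_int poly"
  assumes "degree F > 0"
  shows "num_roots_in padic_unramified (monicize F) = num_roots_in padic_unramified F"
proof -
  have "lead_coeff F \<noteq> 0" using assms by auto
  have "rts (monicize F) = image_mset (\<lambda>x. emb (lead_coeff F) * x) (rts F)"
    unfolding embp_monicize using proots_monicize[of "embp F"] assms by simp
  thus ?thesis
    using unramified_emb_mult_iff[OF \<open>lead_coeff F \<noteq> 0\<close>]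
    by (simp add: num_roots_in_def filter_mset_image_mset)
qed

section \<open>Measurability of the root counts\<close>

context padic_haar
begin

lemma un_roots_monic_sets:
  "{z \<in> vecs n. k \<le> num_roots_in padic_unramified (monp n z)} \<in> sets (V n)"
proof -
  define B where "B = (\<lambda>i. {z :: nat \<Rightarrow> 'p padic_int. z \<in> vecs n \<and> k \<le> size {#x \<in># rts (monp n z). x \<in> un_level i#}})"
  have B: "B i \<in> sets (V n)" for i
  proof -
    \<comment> \<open>\<open>C N\<close> is the union of the level-N balls that meet
      \<open>B i\<close>, up to the values outside the index range. It is level-invariant, hence
      measurable, and by closedness the intersection over N is \<open>B i\<close>.\<close>
    define C where "C = (\<lambda>N. {z :: nat \<Rightarrow> 'p padic_int. z \<in> vecs n \<and> (\<exists>z'. cong_level n N z' z \<and> k \<le> size {#x \<in># rts (monp n z'). x \<in> un_level i#})})"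
    let ?Y = "muq (CARD('p) ^ fact i) :: 'p padic_closure set"
    have lev: "un_level i = (\<lambda>v. v / pC ^ i) ` Zspan ?Y" by (auto simp: un_level_def)
    have Y: "finite ?Y" "?Y \<subseteq> OC"
      using muq_factorization(1)[OF good_q_fact] muq_OC[OF good_q_fact] by blast+
    have "B i = (\<Inter>N. C N)"
    proof (intro equalityI subsetI)
      fix z assume z: "z \<in> B i"
      have "z \<in> C N" for N unfolding C_def
      proof (intro CollectI conjI exI)
        show "z \<in> vecs n" "k \<le> size {#x \<in># rts (monp n z). x \<in> un_level i#}" using z unfolding B_def by blast+
        show "cong_level n N z z" by (rule cong_level_refl)
      qed
      thus "z \<in> (\<Inter>N. C N)" by blast
    next
      fix z assume z: "z \<in> (\<Inter>N. C N)"
      hence 1: "z \<in> vecs n" unfolding C_def by blast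
      have 2: "\<exists>z'. cong_level n N z' z \<and> k \<le> size {#x \<in># rts (monp n z'). x \<in> un_level i#}" for N
        using z unfolding C_def by blast
      show "z \<in> B i" unfolding B_def using 1 roots_in_Zspan_closed[OF Y 1 2[unfolded lev]] by (simp only: lev mem_Collect_eq simp_thms)
    qed
    moreover have "C N \<in> sets (V n)" for N
    proof (rule level_inv_sets)
      show "level_inv n N (C N)" unfolding level_inv_def
      proof (intro conjI ballI impI)
        fix z z' :: "nat \<Rightarrow> 'p padic_int" assume z: "z \<in> C N" "z' \<in> vecs n" "cong_level n N z z'"
        then obtain w where w: "cong_level n N w z" "k \<le> size {#x \<in># rts (monp n w). x \<in> un_level i#}" unfolding C_def by blast
        have "cong_level n N w z'" using w(1) z(3) by (rule cong_level_trans)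
        thus "z' \<in> C N" using z(2) w(2) unfolding C_def by blast
      qed (unfold C_def, blast)
    qed
    hence "(\<Inter>N. C N) \<in> sets (V n)" by (intro sets.countable_INT) auto
    ultimately show ?thesis by (simp only:)
  qed
  have "{z \<in> vecs n. k \<le> num_roots_in padic_unramified (monp n z)} = (\<Union>i. B i)"
  proof -
    have "k \<le> num_roots_in padic_unramified (monp n z) \<longleftrightarrow> (\<exists>i. k \<le> size {#x \<in># rts (monp n z). x \<in> un_level i#})"
      for z :: "nat \<Rightarrow> 'p padic_int"
      unfolding num_roots_in_def padic_unramified_eq_UN by (rule size_filter_UN_chain[OF un_level_mono])
    thus ?thesis by (intro Set.set_eqI) (simp only: B_def UN_iff mem_Collect_eq, simp)
  qed
  moreover have "(\<Union>i. B i) \<in> sets (V n)" using B by (intro sets.countable_UN) auto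
  ultimately show ?thesis by (simp only:)
qed

lemma un_roots_monic_measurable:
  "(\<lambda>z. num_roots_in padic_unramified (monp n z)) \<in> V n \<rightarrow>\<^sub>M count_space UNIV"
  unfolding measurable_count_space_eq2_countable
proof (intro conjI ballI)
  fix k :: nat
  have "g -` {k} \<inter> A = {z \<in> A. k \<le> g z} - {z \<in> A. Suc k \<le> g z}"
    for g :: "(nat \<Rightarrow> 'p padic_int) \<Rightarrow> nat" and A by auto
  from this[of "\<lambda>z. num_roots_in padic_unramified (monp n z)" "vecs n"]
  have "(\<lambda>z. num_roots_in padic_unramified (monp n z)) -` {k} \<inter> space (V n) =
    {z \<in> vecs n. k \<le> num_roots_in padic_unramified (monp n z)} -
    {z \<in> vecs n. Suc k \<le> num_roots_in padic_unramified (monp n z)}" by (simp only: space_V)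
  thus "(\<lambda>z. num_roots_in padic_unramified (monp n z)) -` {k} \<inter> space (V n) \<in> sets (V n)"
    using un_roots_monic_sets by (simp only: sets.Diff)
qed simp

lemma coord_eq_0_sets:
  assumes "i < n"
  shows "{z \<in> vecs n. z i = 0} \<in> sets (V n)"
proof -
  have "{z \<in> vecs n. z i = 0} = (\<Inter>N. {z :: nat \<Rightarrow> 'p padic_int. z \<in> vecs n \<and> residue (z i) N = 0})"
    by (auto simp: residue_inject[symmetric] fun_eq_iff)
  moreover have "{z :: nat \<Rightarrow> 'p padic_int. z \<in> vecs n \<and> residue (z i) N = 0} \<in> sets (V n)" for N
    by (rule level_inv_sets[of _ N]) (use assms in \<open>auto simp: level_inv_def cong_level_def\<close>)
  ultimately show ?thesis by auto
qed

definition mcoeffs :: "nat \<Rightarrow> (nat \<Rightarrow> 'p padic_int) \<Rightarrow> nat \<Rightarrow> 'p padic_int" where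
  "mcoeffs r z = restrict (\<lambda>i. z i * z r ^ (r - 1 - i)) {..<r}"

lemma mcoeffs_measurable:
  assumes "r < n"
  shows "mcoeffs r \<in> V n \<rightarrow>\<^sub>M V r"
proof (rule measurable_V_level)
  show "mcoeffs r ` vecs n \<subseteq> vecs r" by (auto simp: mcoeffs_def)
  fix N and a :: "nat \<Rightarrow> 'p padic_int"
  show "level_inv n N {z \<in> vecs n. cong_level r N (mcoeffs r z) a}"
  proof (rule level_inv_vimage_cong)
    fix z z' :: "nat \<Rightarrow> 'p padic_int" assume z: "cong_level n N z z'"
    have "residue (z i * z r ^ (r - 1 - i)) N = residue (z' i * z' r ^ (r - 1 - i)) N" if "i < r" for i
    proof -
      have "residue (z i) N = residue (z' i) N" "residue (z r) N = residue (z' r) N"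
        using z that assms by (simp_all add: cong_level_def)
      thus ?thesis by (simp add: times_padic_int.rep_eq residue_power)
    qed
    thus "cong_level r N (mcoeffs r z) (mcoeffs r z')" by (simp add: cong_level_def mcoeffs_def)
  qed
qed

text \<open>The leading coefficient can vanish, so the space is cut into the sets \<open>E r\<close>
  of polynomials of exact degree \<open>r\<close>. On each of them the ramified roots number
  \<open>r\<close> minus the unramified roots of the associated monic polynomial, whose coefficients
  depend polynomially on the given ones.\<close>

lemma Zn_measurable:
  "(\<lambda>z. Zn (pol n z)) \<in> V n \<rightarrow>\<^sub>M count_space UNIV"
  unfolding measurable_count_space_eq2_countable
proof (intro conjI ballI)
  fix k :: nat
  define E where "E = (\<lambda>r. (vecs n - {z \<in> vecs n. z r = 0}) \<inter> {z :: nat \<Rightarrow> 'p padic_int. z \<in> vecs n \<and> (\<forall>i\<in>{Suc r..<n}. z i = 0)})"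
  define g where "g = (\<lambda>r z. r - num_roots_in padic_unramified (monp r (mcoeffs r z)))"
  \<comment> \<open>The zero polynomial lies in no \<open>E r\<close>; its root multiset is empty by
    convention.\<close>
  define O0 where "O0 = {z :: nat \<Rightarrow> 'p padic_int. z \<in> vecs n \<and> (\<forall>i\<in>{..<n}. z i = 0)}"
  have vs: "vecs n \<in> sets (V n)" using sets.top[of "V n"] by simp
  have zeros_sets: "{z :: nat \<Rightarrow> 'p padic_int. z \<in> vecs n \<and> (\<forall>i\<in>I. z i = 0)} \<in> sets (V n)"
    if "finite I" "I \<subseteq> {..<n}" for I
    using that
  proof (induction I)
    case empty
    thus ?case using vs by simp
  next
    case (insert i I)
    have "{z :: nat \<Rightarrow> 'p padic_int. z \<in> vecs n \<and> (\<forall>i\<in>insert i I. z i = 0)} =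
      {z \<in> vecs n. z i = 0} \<inter> {z. z \<in> vecs n \<and> (\<forall>i\<in>I. z i = 0)}" by blast
    moreover have "{z \<in> vecs n. z i = 0} \<in> sets (V n)" using insert.prems by (intro coord_eq_0_sets) simp
    moreover have "{z :: nat \<Rightarrow> 'p padic_int. z \<in> vecs n \<and> (\<forall>i\<in>I. z i = 0)} \<in> sets (V n)"
      using insert.IH insert.prems by simp
    ultimately show ?case by (simp only: sets.Int)
  qed
  have E: "E r \<in> sets (V n)" if "r < n" for r
    unfolding E_def using coord_eq_0_sets vs that
    by (intro sets.Int sets.Diff vs zeros_sets) auto
  have O0: "O0 \<in> sets (V n)"
    unfolding O0_def by (intro zeros_sets) auto
  have gm: "g r \<in> V n \<rightarrow>\<^sub>M count_space UNIV" if "r < n" for r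
    unfolding g_def using measurable_compose[OF mcoeffs_measurable[OF that] un_roots_monic_measurable]
    by measurable
  have eq: "Zn (pol n z) = g r z" if r: "r < n" "z \<in> E r" for r z
  proof -
    have zr: "z r \<noteq> 0" "\<And>i. r < i \<Longrightarrow> i < n \<Longrightarrow> z i = 0" using r by (auto simp: E_def)
    have deg: "degree (pol n z) = r"
      using zr r(1) by (intro antisym degree_le le_degree) (auto simp: not_less_eq)
    have nz: "pol n z \<noteq> 0" using zr(1) r(1) by (auto simp: poly_eq_iff)
    have "num_roots_in padic_unramified (pol n z) = num_roots_in padic_unramified (monp r (mcoeffs r z))"
    proof (cases "r = 0")
      case True
      have "num_roots_in padic_unramified (pol n z) \<le> 0"
        using num_roots_in_le[of padic_unramified "pol n z"] deg True by simp
      moreover have "num_roots_in padic_unramified (monp r (mcoeffs r z)) \<le> 0"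
        using num_roots_in_le[of padic_unramified "monp r (mcoeffs r z)"] unfolding degree_monp True .
      ultimately show ?thesis by simp
    next
      case False
      have "monicize (pol n z) = monp r (mcoeffs r z)"
        using r(1) by (intro poly_eqI) (auto simp: coeff_monicize deg mcoeffs_def)
      thus ?thesis using num_roots_in_monicize[of "pol n z"] deg False by simp
    qed
    thus ?thesis using num_roots_in_Compl[OF nz, of padic_unramified] deg by (simp add: g_def)
  qed
  have cover: "z \<in> O0 \<or> (\<exists>r<n. z \<in> E r)" if z: "z \<in> vecs n" for z
  proof (cases "pol n z = 0")
    case True
    hence "z i = 0" if "i < n" for i using coeff_pol[of n z i] that by simp
    thus ?thesis using z by (auto simp: O0_def)
  next
    case False
    define r where "r = degree (pol n z)"
    have "coeff (pol n z) r \<noteq> 0" unfolding r_def using False by (rule leading_coeff_neq_0)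
    hence r: "r < n" "z r \<noteq> 0" by (auto split: if_splits)
    have "z i = 0" if "r < i" "i < n" for i
      using coeff_eq_0[of "pol n z" i] that by (simp add: r_def)
    hence "z \<in> E r" using z r by (auto simp: E_def)
    thus ?thesis using r by blast
  qed
  have zero: "Zn (pol n z) = 0" if "z \<in> O0" for z
  proof -
    have "pol n z = 0" using that by (auto simp: O0_def poly_eq_iff)
    thus ?thesis by (simp add: num_roots_in_def)
  qed
  have "(\<lambda>z. Zn (pol n z)) -` {k} \<inter> space (V n) =
      (\<Union>r\<in>{..<n}. E r \<inter> (g r -` {k} \<inter> space (V n))) \<union> (if k = 0 then O0 else {})"
  proof (intro equalityI subsetI)
    fix z assume z: "z \<in> (\<lambda>z. Zn (pol n z)) -` {k} \<inter> space (V n)"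
    hence "z \<in> vecs n" by simp
    from cover[OF this] show "z \<in> (\<Union>r\<in>{..<n}. E r \<inter> (g r -` {k} \<inter> space (V n))) \<union> (if k = 0 then O0 else {})"
      using z eq zero by auto
  next
    fix z assume z: "z \<in> (\<Union>r\<in>{..<n}. E r \<inter> (g r -` {k} \<inter> space (V n))) \<union> (if k = 0 then O0 else {})"
    show "z \<in> (\<lambda>z. Zn (pol n z)) -` {k} \<inter> space (V n)"
    proof (cases "k = 0 \<and> z \<in> O0")
      case True
      thus ?thesis using zero by (auto simp: O0_def)
    next
      case False
      then obtain r where "r < n" "z \<in> E r" "g r z = k" "z \<in> vecs n" using z by (auto split: if_splits)
      thus ?thesis using eq by simp
    qed
  qed
  moreover have "E r \<inter> (g r -` {k} \<inter> space (V n)) \<in> sets (V n)" if "r < n" for r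
    by (rule sets.Int[OF E[OF that] measurable_sets[OF gm[OF that], of "{k}"]]) simp
  hence "(\<Union>r\<in>{..<n}. E r \<inter> (g r -` {k} \<inter> space (V n))) \<in> sets (V n)" by (intro sets.finite_UN) auto
  ultimately show "(\<lambda>z. Zn (pol n z)) -` {k} \<inter> space (V n) \<in> sets (V n)"
    using O0 by (auto intro!: sets.Un)
qed simp

text \<open>The coefficients may depend on \<open>z\<close> through any map that preserves
  congruences, in particular through polynomial formulas over Z_p.\<close>

lemma Zn_poly_map_measurable:
  fixes P :: "(nat \<Rightarrow> 'p padic_int) \<Rightarrow> 'p padic_int poly"
  assumes deg: "\<And>z. degree (P z) < m"
    and cong: "\<And>N z z'. cong_level k N z z' \<Longrightarrow> [:pZ ^ N:] dvd P z - P z'"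
  shows "(\<lambda>z. of_nat (Zn (P z)) :: ennreal) \<in> borel_measurable (V k)"
proof -
  have "(\<lambda>z. restrict (coeff (P z)) {..<m}) \<in> V k \<rightarrow>\<^sub>M V m"
  proof (rule measurable_V_level)
    fix N and a :: "nat \<Rightarrow> 'p padic_int"
    show "level_inv k N {z \<in> vecs k. cong_level m N (restrict (coeff (P z)) {..<m}) a}"
    proof (rule level_inv_vimage_cong)
      fix z z' :: "nat \<Rightarrow> 'p padic_int" assume "cong_level k N z z'"
      hence "[:pZ ^ N:] dvd P z - P z'" by (rule cong)
      thus "cong_level m N (restrict (coeff (P z)) {..<m}) (restrict (coeff (P z')) {..<m})"
        by (simp add: cong_level_def const_poly_dvd_iff residue_eq_iff)
    qed
  qed auto
  from measurable_compose[OF this Zn_measurable]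
  have "(\<lambda>z. Zn (pol m (restrict (coeff (P z)) {..<m}))) \<in> V k \<rightarrow>\<^sub>M count_space UNIV" .
  moreover have "pol m (restrict (coeff (P z)) {..<m}) = P z" for z
  proof -
    have "pol m (restrict (coeff (P z)) {..<m}) = pol m (coeff (P z))" by (intro pol_cong) simp
    thus ?thesis using pol_coeff[OF deg] by simp
  qed
  ultimately have "(\<lambda>z. Zn (P z)) \<in> V k \<rightarrow>\<^sub>M count_space UNIV" by simp
  from measurable_compose[OF this, of "\<lambda>k. of_nat k :: ennreal" borel] show ?thesis by simp
qed

end

section \<open>Clusters of roots\<close>

lemma size_filter_partition:
  assumes "finite I" "\<And>x. x \<in># M \<Longrightarrow> x \<in> U \<Longrightarrow> \<exists>!i. i \<in> I \<and> x \<in> A i"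
  shows "size {#x \<in># M. x \<in> U#} = (\<Sum>i\<in>I. size {#x \<in># M. x \<in> U \<inter> A i#})"
  using assms(2)
proof (induction M)
  case (add x M)
  have IH: "size {#x \<in># M. x \<in> U#} = (\<Sum>i\<in>I. size {#x \<in># M. x \<in> U \<inter> A i#})"
    by (rule add.IH) (use add.prems in simp)
  have "(if x \<in> U then 1 else 0 :: nat) = (\<Sum>i\<in>I. if x \<in> U \<inter> A i then 1 else 0)"
  proof (cases "x \<in> U")
    case True
    have "\<exists>!i. i \<in> I \<and> x \<in> A i" by (rule add.prems) (use True in simp_all)
    then obtain i where i: "i \<in> I \<and> x \<in> A i" "\<forall>j. j \<in> I \<and> x \<in> A j \<longrightarrow> j = i" by (elim ex1E) blast
    have "x \<in> U \<inter> A j \<longleftrightarrow> j = i" if "j \<in> I" for j using i that True by blast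
    hence "(\<Sum>i\<in>I. if x \<in> U \<inter> A i then 1 else 0 :: nat) = (\<Sum>j\<in>I. if j = i then 1 else 0)"
      by (intro sum.cong refl) (simp only:)
    also have "\<dots> = 1" using i(1) assms(1) by (simp add: sum.delta)
    finally show ?thesis using True by simp
  qed simp
  moreover have "(\<Sum>i\<in>I. size {#y \<in># add_mset x M. y \<in> U \<inter> A i#}) =
      (\<Sum>i\<in>I. (if x \<in> U \<inter> A i then 1 else 0) + size {#y \<in># M. y \<in> U \<inter> A i#})"
    by (intro sum.cong refl) simp
  moreover have "size {#y \<in># add_mset x M. y \<in> U#} = (if x \<in> U then 1 else 0) + size {#y \<in># M. y \<in> U#}"
    by simp
  ultimately show ?case using IH by (simp only: sum.distrib)
qed simp

lemma mem_rts: "P \<noteq> 0 \<Longrightarrow> x \<in># rts P \<longleftrightarrow> poly (embp P) x = 0" by simp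

lemma num_roots_in_eq_0:
  assumes "P \<noteq> 0" "\<And>x. poly (embp P) x = 0 \<Longrightarrow> x \<notin> U"
  shows "num_roots_in U P = 0"
proof -
  have "{#x \<in># rts P. x \<in> U#} = {#x \<in># rts P. False#}"
    by (intro filter_mset_cong refl) (use assms(2) mem_rts[OF assms(1)] in blast)
  thus ?thesis by (simp add: num_roots_in_def)
qed

lemma num_roots_in_cong:
  assumes "P \<noteq> 0" "\<And>x. poly (embp P) x = 0 \<Longrightarrow> x \<in> U \<longleftrightarrow> x \<in> U'"
  shows "num_roots_in U P = num_roots_in U' P"
proof -
  have "{#x \<in># rts P. x \<in> U#} = {#x \<in># rts P. x \<in> U'#}"
    by (intro filter_mset_cong refl) (use assms mem_rts[OF assms(1)] in blast)
  thus ?thesis by (simp only: num_roots_in_def)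
qed

text \<open>The integral elements whose residue is a root of \<open>f\<close>. The residue field is
  not constructed; vanishing there is expressed by a nonunit value of a lift.\<close>

definition residue_roots :: "'p :: prime_card mod_ring poly \<Rightarrow> 'p padic_closure set" where
  "residue_roots f = {x. x \<in> OC \<and> NU (poly (embp (map_poly lift f)) x)}"

lemma NU_poly_pC: "x \<in> OC \<Longrightarrow> NU (poly (embp (smult pZ R)) x)"
proof -
  assume "x \<in> OC"
  hence "NU (pC * poly (embp R) x)" by (intro NU_pC_mult OC_poly_embp)
  thus ?thesis by (simp add: embp_smult)
qed

lemma NU_eval_cong:
  assumes "map_poly red A = map_poly red B" "x \<in> OC" "NU (poly (embp B) x)"
  shows "NU (poly (embp A) x)"
proof -
  obtain R where R: "A = B + smult pZ R" using assms(1) by (rule red_eq_imp_cong)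
  have "NU (poly (embp B) x + poly (embp (smult pZ R)) x)" by (rule NU_add[OF assms(3) NU_poly_pC[OF assms(2)]])
  thus ?thesis unfolding R embp_add poly_add .
qed

text \<open>Independence of the lift: two lifts differ by p times a polynomial, whose values at
  integral points are nonunits.\<close>

lemma residue_roots_iff:
  assumes "map_poly red A = f"
  shows "x \<in> residue_roots f \<longleftrightarrow> x \<in> OC \<and> NU (poly (embp A) x)"
proof -
  have "map_poly red A = map_poly red (map_poly lift f)" using assms by simp
  from NU_eval_cong[OF this] NU_eval_cong[OF this[symmetric]] show ?thesis
    unfolding residue_roots_def mem_Collect_eq by blast
qed

lemma residue_roots_diff:
  assumes "x \<in> residue_roots f" "x \<in> residue_roots g"
  shows "x \<in> residue_roots (f - g)"
proof -
  have "map_poly red (map_poly lift f - map_poly lift g) = f - g" by (simp add: redp.hom_minus)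
  note iff = residue_roots_iff[OF this, of x]
  have "NU (poly (embp (map_poly lift f)) x - poly (embp (map_poly lift g)) x)"
    by (rule NU_diff) (use assms in \<open>simp_all add: residue_roots_def\<close>)
  thus ?thesis unfolding iff using assms(1) by (simp add: residue_roots_def embp.hom_minus)
qed

lemma NU_mult_iff: "x \<in> OC \<Longrightarrow> y \<in> OC \<Longrightarrow> NU (x * y) \<longleftrightarrow> NU x \<or> NU y"
  using NU_mult'[of x y] NU_mult'[of y x] not_NU_mult[of x y] by (auto simp only: mult.commute[of y x])

lemma residue_roots_mult_iff:
  "x \<in> residue_roots (f * g) \<longleftrightarrow> x \<in> residue_roots f \<or> x \<in> residue_roots g"
proof -
  have "map_poly red (map_poly lift f * map_poly lift g) = f * g" by (simp add: redp.hom_mult)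
  note iff = residue_roots_iff[OF this, of x]
  show ?thesis
  proof (cases "x \<in> OC")
    case True
    note oc = OC_poly_embp[OF True, of "map_poly lift f"] OC_poly_embp[OF True, of "map_poly lift g"]
    show ?thesis unfolding iff unfolding residue_roots_def mem_Collect_eq embp_mult poly_mult
      NU_mult_iff[OF oc] using True by blast
  next
    case False
    thus ?thesis unfolding residue_roots_def by blast
  qed
qed

lemma residue_roots_1: "x \<notin> residue_roots 1"
  by (subst residue_roots_iff[of 1]) simp_all

lemma residue_roots_const: "a \<noteq> 0 \<Longrightarrow> x \<notin> residue_roots [:a:]"
proof
  assume "a \<noteq> 0" "x \<in> residue_roots [:a:]"
  hence "x \<in> residue_roots ([:a:] * [:inverse a:])" unfolding residue_roots_mult_iff by blast
  moreover have "[:a:] * [:inverse a:] = 1" using \<open>a \<noteq> 0\<close> by simp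
  ultimately show False using residue_roots_1[of x] by (simp only:)
qed

lemma residue_roots_power: "x \<in> residue_roots (f ^ n) \<Longrightarrow> x \<in> residue_roots f"
  by (induction n) (auto simp: residue_roots_mult_iff residue_roots_1)

lemma residue_roots_dvd: "f dvd g \<Longrightarrow> x \<in> residue_roots f \<Longrightarrow> x \<in> residue_roots g"
  by (auto elim!: dvdE simp: residue_roots_mult_iff)

text \<open>The polynomials vanishing at the residue of \<open>x\<close> form a prime ideal, and
  \<open>f\<close> is its monic generator: the minimal polynomial of that residue over F_p.\<close>

lemma residue_minimal_poly:
  fixes x :: "'p :: prime_card padic_closure"
  assumes "h \<noteq> 0" "x \<in> residue_roots h"
  obtains f where "irreducible f" "lead_coeff f = 1" "\<And>g. x \<in> residue_roots g \<longleftrightarrow> f dvd g"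
proof -
  let ?P = "\<lambda>d. \<exists>g. g \<noteq> 0 \<and> x \<in> residue_roots g \<and> degree g = d"
  have "?P (degree h)" using assms by blast
  hence "?P (LEAST d. ?P d)" by (rule LeastI)
  then obtain g where g: "g \<noteq> 0" "x \<in> residue_roots g" "degree g = (LEAST d. ?P d)" by blast
  have min: "degree g \<le> degree g'" if "g' \<noteq> 0" "x \<in> residue_roots g'" for g'
    unfolding g(3) using that by (intro Least_le) blast
  define f where "f = smult (inverse (lead_coeff g)) g"
  have lc: "lead_coeff g \<noteq> 0" using g(1) by (rule leading_coeff_neq_0)
  have f: "f \<noteq> 0" "lead_coeff f = 1" "degree f = degree g" using lc g(1) by (simp_all add: f_def)
  have fg: "g dvd f" by (simp add: f_def dvd_smult)
  have xf: "x \<in> residue_roots f" by (rule residue_roots_dvd[OF fg g(2)])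
  have dvd: "f dvd g'" if "x \<in> residue_roots g'" for g'
  proof (rule ccontr)
    assume "\<not> f dvd g'"
    hence nz: "g' mod f \<noteq> 0" by (simp add: dvd_eq_mod_eq_0)
    have "x \<in> residue_roots (f * (g' div f))" using xf by (simp add: residue_roots_mult_iff)
    hence "x \<in> residue_roots (g' - f * (g' div f))" by (rule residue_roots_diff[OF that])
    hence "x \<in> residue_roots (g' mod f)" by (simp only: minus_mult_div_eq_mod)
    from min[OF nz this] show False using degree_mod_less[OF f(1), of g'] nz f(3) by auto
  qed
  have "degree f \<noteq> 0"
  proof
    assume "degree f = 0"
    then obtain a where "f = [:a:]" by (rule degree_eq_zeroE)
    thus False using residue_roots_const[of a x] f(1) xf by auto
  qed
  hence "\<not> is_unit f" using f(1) by (auto simp: is_unit_iff_degree)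
  have "irreducible f"
  proof (rule Factorial_Ring.irreducibleI[OF f(1) \<open>\<not> is_unit f\<close>])
    fix a b assume ab: "f = a * b"
    have nz: "a \<noteq> 0" "b \<noteq> 0" using ab f(1) by auto
    have deg: "degree f = degree a + degree b" using ab nz by (simp add: degree_mult_eq)
    consider "x \<in> residue_roots a" | "x \<in> residue_roots b" using xf ab residue_roots_mult_iff by blast
    thus "is_unit a \<or> is_unit b"
    proof cases
      case 1
      from min[OF nz(1) this] have "degree b = 0" using deg f(3) by simp
      thus ?thesis using nz by (simp add: is_unit_iff_degree)
    next
      case 2
      from min[OF nz(2) this] have "degree a = 0" using deg f(3) by simp
      thus ?thesis using nz by (simp add: is_unit_iff_degree)
    qed
  qed
  moreover have "x \<in> residue_roots g' \<longleftrightarrow> f dvd g'" for g' using dvd residue_roots_dvd[OF _ xf] by blast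
  ultimately show ?thesis using that f(2) by blast
qed

definition monic_irreducibles :: "'p :: prime_card mod_ring poly set" where
  "monic_irreducibles = {f. irreducible f \<and> lead_coeff f = 1}"

lemma monic_irreducible_dvd_imp_eq:
  fixes f g :: "'p :: prime_card mod_ring poly"
  assumes "f \<in> monic_irreducibles" "g \<in> monic_irreducibles" "f dvd g"
  shows "f = g"
proof -
  have f: "\<not> is_unit f" "lead_coeff f = 1" "irreducible g" "lead_coeff g = 1"
    using assms by (auto simp: monic_irreducibles_def Factorial_Ring.irreducible_def)
  obtain k where k: "g = f * k" using assms(3) by (rule dvdE)
  hence "is_unit k" using f Factorial_Ring.irreducibleD[OF f(3) k] by blast
  hence "degree k = 0" using is_unit_iff_degree[of k] by (cases "k = 0") auto
  then obtain a where a: "k = [:a:]" by (rule degree_eq_zeroE)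
  have "lead_coeff g = lead_coeff f * a" unfolding k a by (simp add: lead_coeff_mult)
  hence "a = 1" using f by simp
  thus ?thesis using k a by simp
qed

lemma residue_roots_partition:
  fixes x :: "'p :: prime_card padic_closure"
  assumes "h \<noteq> 0" "x \<in> residue_roots h"
  shows "\<exists>!f. f \<in> {f \<in> monic_irreducibles. f dvd h} \<and> x \<in> residue_roots f"
proof -
  obtain f where f: "irreducible f" "lead_coeff f = 1" "\<And>g. x \<in> residue_roots g \<longleftrightarrow> f dvd g"
    using residue_minimal_poly[OF assms] by blast
  show ?thesis
  proof (rule ex1I[of _ f])
    show "f \<in> {f \<in> monic_irreducibles. f dvd h} \<and> x \<in> residue_roots f"
      using f assms by (auto simp: monic_irreducibles_def)
  next
    fix g assume g: "g \<in> {f \<in> monic_irreducibles. f dvd h} \<and> x \<in> residue_roots g"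
    have "f \<in> monic_irreducibles" using f by (simp add: monic_irreducibles_def)
    moreover have "f dvd g" using g f(3) by blast
    ultimately have "f = g" using g by (intro monic_irreducible_dvd_imp_eq) auto
    thus "g = f" ..
  qed
qed

lemma residue_roots_coprime:
  fixes f u :: "'p :: prime_card mod_ring poly"
  assumes "f \<in> monic_irreducibles" "\<not> f dvd u"
  shows "x \<in> residue_roots f \<Longrightarrow> x \<notin> residue_roots u"
proof
  assume x: "x \<in> residue_roots f" "x \<in> residue_roots u"
  have "f \<noteq> 0" using assms by (auto simp: monic_irreducibles_def)
  then obtain g where g: "irreducible g" "lead_coeff g = 1" "\<And>h. x \<in> residue_roots h \<longleftrightarrow> g dvd h"
    using residue_minimal_poly x(1) by blast
  have "g = f" using g x(1) assms(1) by (intro monic_irreducible_dvd_imp_eq) (auto simp: monic_irreducibles_def)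
  thus False using g(3)[of u] x(2) assms(2) by blast
qed

lemma finite_irreducible_divisors:
  fixes h :: "'p :: prime_card mod_ring poly"
  assumes "h \<noteq> 0"
  shows "finite {f \<in> monic_irreducibles. f dvd h}"
  using assms by (intro finite_subset[OF _ finite_degree_le[of "degree h"]]) (auto intro: dvd_imp_degree_le)

lemma red_map_smult_pZ [simp]: "map_poly red (smult pZ (Q :: 'p :: prime_card padic_int poly)) = 0"
  by (simp add: red_poly_eq_0_iff)

lemma sum_neq_0_if_red:
  fixes H :: "'p :: prime_card padic_int poly"
  assumes "map_poly red H \<noteq> 0"
  shows "H + smult pZ Q \<noteq> 0"
proof
  assume "H + smult pZ Q = 0"
  hence "map_poly red (H + smult pZ Q) = 0" by (simp only: map_poly_0)
  thus False using assms by (simp add: redp.hom_add red_map_smult_pZ)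
qed

lemma degree_monom_pol_le: "s \<le> 1 \<Longrightarrow> degree (Polynomial.monom (1 :: 'a :: comm_ring_1) s * pol k z) \<le> k"
proof (cases k)
  case (Suc j)
  assume "s \<le> 1"
  have "degree (Polynomial.monom 1 s * pol k z) \<le> s + degree (pol k z)"
    by (rule order_trans[OF degree_mult_le add_right_mono[OF degree_monom_le]])
  also have "\<dots> \<le> k" using degree_pol_le[of j z] \<open>s \<le> 1\<close> Suc by simp
  finally show ?thesis .
qed (simp add: pol_def)

context padic_haar
begin

text \<open>The expected number of ramified roots of one random factor with \<open>k\<close> free
  coefficients. The value s = 0 serves finite clusters and s = 1 the cluster at infinity.\<close>

definition cluster :: "'p padic_int poly \<Rightarrow> nat \<Rightarrow> nat \<Rightarrow> ennreal" where
  "cluster H k s = (\<integral>\<^sup>+z. of_nat (Zn (H + smult pZ (Polynomial.monom 1 s * pol k z))) \<partial>V k)"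

lemma cluster_measurable:
  fixes H :: "'p padic_int poly"
  shows "(\<lambda>z. of_nat (Zn (H + smult pZ (Polynomial.monom 1 s * pol k z))) :: ennreal) \<in> borel_measurable (V k)"
proof (rule Zn_poly_map_measurable)
  fix z :: "nat \<Rightarrow> 'p padic_int"
  have "degree (pol k z) \<le> k" using degree_monom_pol_le[of 0 k z] by simp
  hence "degree (Polynomial.monom 1 s * pol k z) \<le> s + k"
    by (intro order_trans[OF degree_mult_le add_mono] degree_monom_le)
  hence "degree (smult pZ (Polynomial.monom 1 s * pol k z)) \<le> degree H + s + k"
    by (intro order_trans[OF degree_smult_le]) simp
  hence "degree (H + smult pZ (Polynomial.monom 1 s * pol k z)) \<le> degree H + s + k"
    by (intro degree_add_le) simp_all
  thus "degree (H + smult pZ (Polynomial.monom 1 s * pol k z)) < Suc (degree H + s + k)" by simp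
next
  fix N and z z' :: "nat \<Rightarrow> 'p padic_int"
  assume "cong_level k N z z'"
  hence "[:pZ ^ N:] dvd pol k z - pol k z'" unfolding const_power_dvd_pol_iff .
  hence "[:pZ ^ N:] dvd [:pZ:] * Polynomial.monom 1 s * (pol k z - pol k z')" by (rule dvd_mult)
  also have "\<dots> = (H + smult pZ (Polynomial.monom 1 s * pol k z)) - (H + smult pZ (Polynomial.monom 1 s * pol k z'))"
    by (simp add: algebra_simps smult_diff_right)
  finally show "[:pZ ^ N:] dvd \<dots>" .
qed

text \<open>After substituting the Hensel isometry the polynomial is a product whose first factor
  has all its roots in \<open>A\<close> and whose second factor has none there. The integrand then
  depends on the first \<open>k\<close> coordinates only, so the cofactor leaves no trace in the
  value.\<close>

lemma cluster_integral:
  fixes H U0 P0 :: "'p padic_int poly"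
  assumes hm: "hensel_map n k s H U0 P0"
    and red: "map_poly red H \<noteq> 0" "map_poly red U0 \<noteq> 0"
    and in_A: "\<And>w x. poly (embp (H + smult pZ (Polynomial.monom 1 s * w))) x = 0 \<Longrightarrow> degree w < k \<or> w = 0 \<Longrightarrow> x \<in> A"
    and notin_A: "\<And>w x. poly (embp (U0 + smult pZ w)) x = 0 \<Longrightarrow> degree w \<le> n - k \<Longrightarrow> x \<notin> A"
  shows "(\<lambda>z. of_nat (num_roots_in (- padic_unramified \<inter> A) (P0 + smult pZ (pol (Suc n) z))) :: ennreal)
           \<in> borel_measurable (V (Suc n))" (is "?f \<in> _")
    and "(\<integral>\<^sup>+z. of_nat (num_roots_in (- padic_unramified \<inter> A) (P0 + smult pZ (pol (Suc n) z))) \<partial>V (Suc n)) = cluster H k s"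
proof -
  interpret h: hensel_map n k s H U0 P0 by (rule hm)
  define F where "F = (\<lambda>z. of_nat (Zn (H + smult pZ (Polynomial.monom 1 s * pol k z))) :: ennreal)"
  have F: "F \<in> borel_measurable (V k)" unfolding F_def by (rule cluster_measurable)
  have eq: "?f (h.Psi z) = F (restrict z {..<k})" for z
  proof -
    let ?A = "H + smult pZ (Polynomial.monom 1 s * pol k z)" and ?B = "U0 + smult pZ (h.hu z)"
    have nz: "?A \<noteq> 0" "?B \<noteq> 0" by (rule sum_neq_0_if_red[OF red(1)], rule sum_neq_0_if_red[OF red(2)])
    have p: "pol k (restrict z {..<k}) = pol k z" by (intro pol_cong) simp
    have "num_roots_in (- padic_unramified \<inter> A) (P0 + smult pZ (pol (Suc n) (h.Psi z))) =
      num_roots_in (- padic_unramified \<inter> A) (?A * ?B)"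
      unfolding h.hensel_eq[symmetric] h.hw_def ..
    also have "\<dots> = num_roots_in (- padic_unramified \<inter> A) ?A + num_roots_in (- padic_unramified \<inter> A) ?B"
      by (rule num_roots_in_mult[OF nz])
    also have "num_roots_in (- padic_unramified \<inter> A) ?B = 0"
      using notin_A[OF _ h.degree_hu] by (intro num_roots_in_eq_0[OF nz(2)]) blast
    also have "num_roots_in (- padic_unramified \<inter> A) ?A = Zn ?A"
    proof (rule num_roots_in_cong[OF nz(1)])
      fix x assume "poly (embp ?A) x = 0"
      moreover have "degree (pol k z) < k \<or> pol k z = 0"
        using degree_pol_less[of k z] by (cases "k = 0") (simp_all add: pol_def)
      ultimately have "x \<in> A" by (rule in_A)
      thus "x \<in> - padic_unramified \<inter> A \<longleftrightarrow> x \<in> - padic_unramified" by blast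
    qed
    finally show ?thesis unfolding F_def p by (simp only: add_0_right)
  qed
  have k: "k \<le> Suc n" using h.k_le by simp
  have r: "(\<lambda>z. restrict z {..<k}) \<in> V (Suc n) \<rightarrow>\<^sub>M V k"
    using k by (intro measurable_restrict_subset) auto
  have m: "(\<lambda>z. ?f (h.Psi z)) \<in> borel_measurable (V (Suc n))"
    unfolding eq by (rule measurable_compose[OF r F])
  show "?f \<in> borel_measurable (V (Suc n))" by (rule isometry_borel_measurable[OF h.isometry_Psi m])
  have "(\<integral>\<^sup>+z. ?f z \<partial>V (Suc n)) = (\<integral>\<^sup>+z. ?f (h.Psi z) \<partial>V (Suc n))"
    by (rule isometry_nn_integral[OF h.isometry_Psi m])
  also have "\<dots> = (\<integral>\<^sup>+z. F (restrict z {..<k}) \<partial>V (Suc n))" unfolding eq ..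
  also have "\<dots> = (\<integral>\<^sup>+z. F z \<partial>V k)" by (rule nn_integral_restrict[OF k F])
  finally show "(\<integral>\<^sup>+z. ?f z \<partial>V (Suc n)) = cluster H k s" unfolding cluster_def F_def .
qed

definition cfin :: "'p mod_ring poly \<Rightarrow> nat \<Rightarrow> ennreal" where
  "cfin f m = cluster (map_poly lift f ^ m) (m * degree f) 0"

definition cinf :: "nat \<Rightarrow> ennreal" where
  "cinf m = cluster 1 m 1"

lemma red_lift_power: "map_poly red (map_poly lift f ^ m) = f ^ m"
  by (simp add: redp.hom_power)

lemma lead_coeff_lift_power:
  assumes "lead_coeff f = 1"
  shows "lead_coeff (map_poly lift f ^ m) = 1" "degree (map_poly lift f ^ m) = m * degree f"
proof -
  have lc: "lead_coeff (map_poly lift f) = 1" using assms by (simp add: coeff_map_poly)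
  thus "lead_coeff (map_poly lift f ^ m) = 1" by (simp only: lead_coeff_power power_one)
  have "map_poly lift f \<noteq> 0" using lc by auto
  thus "degree (map_poly lift f ^ m) = m * degree f" by (simp add: degree_power_eq)
qed

text \<open>The factor split off is f^m with m the full multiplicity, since only then is the
  cofactor prime to f, which both the Hensel map and the separation of the roots require.\<close>

lemma finite_cluster:
  assumes h: "h \<noteq> 0" "degree h \<le> n" and f: "f \<in> monic_irreducibles" "f dvd h"
  shows "(\<lambda>z. of_nat (num_roots_in (- padic_unramified \<inter> residue_roots f) (map_poly lift h + smult pZ (pol (Suc n) z))) :: ennreal)
           \<in> borel_measurable (V (Suc n)) \<and>
    (\<integral>\<^sup>+z. of_nat (num_roots_in (- padic_unramified \<inter> residue_roots f) (map_poly lift h + smult pZ (pol (Suc n) z))) \<partial>V (Suc n))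
      = cfin f (multiplicity f h)"
proof -
  define m where "m = multiplicity f h"
  have irr: "irreducible f" "lead_coeff f = 1" "f \<noteq> 0" using f(1) by (auto simp: monic_irreducibles_def)
  hence nu: "\<not> is_unit f" by (auto simp: Factorial_Ring.irreducible_def)
  obtain u where u: "h = f ^ m * u" "\<not> f dvd u"
    unfolding m_def using multiplicity_decompose'[OF h(1) nu] by blast
  have "u \<noteq> 0" using u h(1) by auto
  have deg: "degree h = m * degree f + degree u"
    unfolding u(1) using irr(3) \<open>u \<noteq> 0\<close> by (simp add: degree_mult_eq degree_power_eq)
  have m: "m \<ge> 1" unfolding m_def using f(2) h(1) nu by (simp add: Suc_le_eq multiplicity_gt_zero_iff)
  define H where "H = map_poly lift f ^ m"
  note lcH = lead_coeff_lift_power[OF irr(2), of m, folded H_def]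
  have cop: "coprime (map_poly red H) (map_poly red (map_poly lift u))"
  proof -
    have "coprime f u" using irr(1) u(2) by (intro prime_elem_imp_coprime irreducible_imp_prime_elem_gcd)
    thus ?thesis by (simp add: H_def red_lift_power)
  qed
  have "hensel_map n (degree H) 0 H (map_poly lift u) (map_poly lift h)"
  proof (rule hensel_map_finite[OF lcH(1) _ _ _ _ cop])
    show "degree H \<le> n" "degree (map_poly lift u) \<le> n - degree H" "degree (map_poly lift h) \<le> n"
      using deg h(2) lcH(2) by simp_all
    show "[:pZ:] dvd H * map_poly lift u - map_poly lift h"
      unfolding red_poly_eq_0_iff[symmetric] using u(1) by (simp add: redp.hom_minus redp.hom_mult H_def red_lift_power)
  qed
  note hm = this[unfolded lcH(2)]
  have rH: "map_poly red H = f ^ m" by (simp add: H_def red_lift_power)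
  have in_A: "x \<in> residue_roots f"
    if root: "poly (embp (H + smult pZ (Polynomial.monom 1 0 * w))) x = 0" and w: "degree w < m * degree f \<or> w = 0" for w x
  proof -
    let ?Q = "H + smult pZ (Polynomial.monom 1 0 * w)"
    have "lead_coeff ?Q = 1"
    proof (cases "w = 0")
      case False
      hence "degree (smult pZ (Polynomial.monom 1 0 * w)) < degree H" using w lcH(2)
        by (intro le_less_trans[OF degree_smult_le]) simp
      hence "lead_coeff (smult pZ (Polynomial.monom 1 0 * w) + H) = lead_coeff H" by (rule lead_coeff_add_le)
      hence "lead_coeff ?Q = lead_coeff H" unfolding add.commute[of H] .
      thus ?thesis using lcH by simp
    qed (use lcH in simp)
    hence x: "x \<in> OC" using root unfolding mem_OC_iff by blast
    have "map_poly red ?Q = f ^ m" by (simp add: redp.hom_add red_map_smult_pZ rH)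
    from residue_roots_iff[OF this, of x] have "x \<in> residue_roots (f ^ m)" using x root by simp
    thus ?thesis by (rule residue_roots_power)
  qed
  have notin_A: "x \<notin> residue_roots f" if root: "poly (embp (map_poly lift u + smult pZ w)) x = 0" for w x
  proof
    assume x: "x \<in> residue_roots f"
    have "map_poly red (map_poly lift u + smult pZ w) = u" by (simp add: redp.hom_add red_map_smult_pZ)
    from residue_roots_iff[OF this, of x] have "x \<in> residue_roots u" using x root by (simp add: residue_roots_def)
    thus False using residue_roots_coprime[OF f(1) u(2) x] by blast
  qed
  have nz: "map_poly red H \<noteq> 0" "map_poly red (map_poly lift u) \<noteq> 0" using irr(3) \<open>u \<noteq> 0\<close> by (simp_all add: rH)
  show ?thesis unfolding cfin_def m_def[symmetric] H_def[symmetric]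
    by (intro conjI; rule cluster_integral[OF hm nz]) (rule in_A notin_A; assumption)+
qed

text \<open>The missing degree n - degree h counts the coefficients of the factor at infinity. At an
  integral point 1 + p X w takes a unit value, so it has no integral root; the cofactor has a unit
  as leading coefficient and only integral roots.\<close>

lemma infinite_cluster:
  assumes h: "h \<noteq> 0" "degree h \<le> n"
  shows "(\<lambda>z. of_nat (num_roots_in (- padic_unramified \<inter> - OC) (map_poly lift h + smult pZ (pol (Suc n) z))) :: ennreal)
           \<in> borel_measurable (V (Suc n)) \<and>
    (\<integral>\<^sup>+z. of_nat (num_roots_in (- padic_unramified \<inter> - OC) (map_poly lift h + smult pZ (pol (Suc n) z))) \<partial>V (Suc n))
      = cinf (n - degree h)"
proof -
  define k where "k = n - degree h"
  have nk: "n - k = degree h" "k \<le> n" using h(2) by (simp_all add: k_def)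
  have top: "red (coeff (map_poly lift h) (n - k)) \<noteq> 0" using h(1) by (simp add: nk coeff_map_poly)
  have hm: "hensel_map n k 1 1 (map_poly lift h) (map_poly lift h)"
    by (rule hensel_map_infinite[OF nk(2) _ _ _ top]) (use h(2) nk in simp_all)
  have in_A: "x \<in> - OC" if root: "poly (embp (1 + smult pZ (Polynomial.monom 1 1 * w))) x = 0"
    for w :: "'p padic_int poly" and x
  proof
    assume "x \<in> OC"
    hence "NU (0 - poly (embp (smult pZ (Polynomial.monom 1 1 * w))) x)" by (intro NU_diff NU_poly_pC NU_0)
    moreover have "1 + poly (embp (smult pZ (Polynomial.monom 1 1 * w))) x = 0"
      using root by (simp add: embp_add)
    hence "1 = - poly (embp (smult pZ (Polynomial.monom 1 1 * w))) x" by (rule eq_neg_iff_add_eq_0[THEN iffD2])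
    ultimately have "NU (1 :: 'p padic_closure)" by (simp only: diff_0)
    thus False using not_NU_1 by blast
  qed
  have notin_A: "x \<notin> - OC" if root: "poly (embp (map_poly lift h + smult pZ w)) x = 0" and w: "degree w \<le> n - k" for w x
  proof -
    let ?U = "map_poly lift h + smult pZ w"
    have c: "red (coeff ?U (n - k)) \<noteq> 0" using top by (simp add: red.hom_add red.hom_mult)
    moreover have "degree ?U \<le> n - k"
      using w nk by (intro degree_add_le) (auto intro: order_trans[OF degree_smult_le])
    moreover have "degree ?U \<ge> n - k" using c by (intro le_degree) auto
    ultimately have "red (lead_coeff ?U) \<noteq> 0" by (metis antisym)
    thus ?thesis using lead_coeff_unit_root_OC[OF root] by simp
  qed
  have nz: "map_poly red (1 :: 'p padic_int poly) \<noteq> 0" "map_poly red (map_poly lift h) \<noteq> 0" using h(1) by simp_all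
  show ?thesis unfolding cinf_def k_def[symmetric]
    by (intro conjI; rule cluster_integral[OF hm nz]) (rule in_A notin_A; assumption)+
qed

definition expZ :: "nat \<Rightarrow> ennreal" where
  "expZ n = (\<integral>\<^sup>+z. of_nat (Zn (pol (Suc n) z)) \<partial>V (Suc n))"

lemma integral_split_clusters:
  assumes h: "h \<noteq> 0" "degree h \<le> n"
  shows "(\<integral>\<^sup>+z. of_nat (Zn (map_poly lift h + smult pZ (pol (Suc n) z))) \<partial>V (Suc n)) =
    (\<Sum>f\<in>{f \<in> monic_irreducibles. f dvd h}. cfin f (multiplicity f h)) + cinf (n - degree h)"
proof -
  let ?D = "{f \<in> monic_irreducibles. f dvd h}"
  let ?P = "\<lambda>z. map_poly lift h + smult pZ (pol (Suc n) z)"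
  have fin: "finite ?D" by (rule finite_irreducible_divisors[OF h(1)])
  have eq: "Zn (?P z) = (\<Sum>f\<in>?D. num_roots_in (- padic_unramified \<inter> residue_roots f) (?P z)) +
      num_roots_in (- padic_unramified \<inter> - OC) (?P z)" for z
  proof -
    have nz: "?P z \<noteq> 0" using h(1) by (intro sum_neq_0_if_red) simp
    \<comment> \<open>Integral and nonintegral roots are separated by a partition indexed by the
      truth values.\<close>
    have 1: "size {#x \<in># rts (?P z). x \<in> - padic_unramified#} =
       (\<Sum>b\<in>UNIV. size {#x \<in># rts (?P z). x \<in> - padic_unramified \<inter> {x. x \<in> OC \<longleftrightarrow> b}#})"
      by (rule size_filter_partition) auto
    have 2: "size {#x \<in># rts (?P z). x \<in> - padic_unramified \<inter> OC#} =
       (\<Sum>f\<in>?D. size {#x \<in># rts (?P z). x \<in> - padic_unramified \<inter> OC \<inter> residue_roots f#})"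
    proof (rule size_filter_partition[OF fin])
      fix x assume x: "x \<in># rts (?P z)" "x \<in> - padic_unramified \<inter> OC"
      have "map_poly red (?P z) = h" by (simp add: redp.hom_add red_map_smult_pZ)
      from residue_roots_iff[OF this, of x] have "x \<in> residue_roots h" using x mem_rts[OF nz, of x] by simp
      thus "\<exists>!f. f \<in> ?D \<and> x \<in> residue_roots f" by (rule residue_roots_partition[OF h(1)])
    qed
    have e: "- padic_unramified \<inter> OC \<inter> residue_roots f = - padic_unramified \<inter> residue_roots f" for f :: "'p mod_ring poly"
      by (auto simp: residue_roots_def)
    have "size {#x \<in># rts (?P z). x \<in> - padic_unramified#} =
       size {#x \<in># rts (?P z). x \<in> - padic_unramified \<inter> - OC#} + size {#x \<in># rts (?P z). x \<in> - padic_unramified \<inter> OC#}"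
      using 1 unfolding UNIV_bool by simp
    thus ?thesis unfolding num_roots_in_def 2[unfolded e] by (simp only: add.commute)
  qed
  note fc = finite_cluster[OF h]
  have "(\<integral>\<^sup>+z. of_nat (Zn (?P z)) \<partial>V (Suc n)) =
    (\<integral>\<^sup>+z. (\<Sum>f\<in>?D. of_nat (num_roots_in (- padic_unramified \<inter> residue_roots f) (?P z))) +
      of_nat (num_roots_in (- padic_unramified \<inter> - OC) (?P z)) \<partial>V (Suc n))"
    unfolding eq by simp
  also have "\<dots> = (\<integral>\<^sup>+z. (\<Sum>f\<in>?D. of_nat (num_roots_in (- padic_unramified \<inter> residue_roots f) (?P z))) \<partial>V (Suc n)) +
    (\<integral>\<^sup>+z. of_nat (num_roots_in (- padic_unramified \<inter> - OC) (?P z)) \<partial>V (Suc n))"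
    using fc infinite_cluster[OF h] by (intro nn_integral_add borel_measurable_sum) auto
  also have "(\<integral>\<^sup>+z. (\<Sum>f\<in>?D. of_nat (num_roots_in (- padic_unramified \<inter> residue_roots f) (?P z))) \<partial>V (Suc n)) =
    (\<Sum>f\<in>?D. \<integral>\<^sup>+z. of_nat (num_roots_in (- padic_unramified \<inter> residue_roots f) (?P z)) \<partial>V (Suc n))"
    using fc by (intro nn_integral_sum) auto
  also have "\<dots> = (\<Sum>f\<in>?D. cfin f (multiplicity f h))" using fc by (intro sum.cong refl) auto
  also have "(\<integral>\<^sup>+z. of_nat (num_roots_in (- padic_unramified \<inter> - OC) (?P z)) \<partial>V (Suc n)) = cinf (n - degree h)"
    using infinite_cluster[OF h] by blast
  finally show ?thesis .
qed

lemma expZ_recursion: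
  "expZ n = ennreal (1 / real CARD('p) ^ Suc n) * (expZ n +
     (\<Sum>h | h \<noteq> 0 \<and> degree h \<le> n. (\<Sum>f\<in>{f \<in> monic_irreducibles. f dvd h}. cfin f (multiplicity f h)) + cinf (n - degree h)))"
proof -
  let ?I = "\<lambda>h. \<integral>\<^sup>+z. of_nat (Zn (pol (Suc n) (digits (Suc n) h z))) \<partial>V (Suc n)"
  have m: "(\<lambda>z. of_nat (Zn (pol (Suc n) z)) :: ennreal) \<in> borel_measurable (V (Suc n))"
    using cluster_measurable[of 0 0 "Suc n"] by (simp add: num_roots_in_smult)
  have dig: "pol (Suc n) (digits (Suc n) h z) = map_poly lift h + smult pZ (pol (Suc n) z)" if "degree h \<le> n" for h z
    using that by (intro poly_eqI) (auto simp: digits_def coeff_map_poly coeff_eq_0)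
  have "expZ n = ennreal (1 / real CARD('p) ^ Suc n) * (\<Sum>h | degree h \<le> n. ?I h)"
    unfolding expZ_def by (rule nn_integral_split_digits[OF m])
  also have "{h :: 'p mod_ring poly. degree h \<le> n} = insert 0 {h. h \<noteq> 0 \<and> degree h \<le> n}" by auto
  also have "(\<Sum>h\<in>insert 0 {h. h \<noteq> 0 \<and> degree h \<le> n}. ?I h) = ?I 0 + (\<Sum>h | h \<noteq> 0 \<and> degree h \<le> n. ?I h)"
    by (rule sum.insert) (auto intro: finite_subset[OF _ finite_degree_le[of n]])
  \<comment> \<open>Over h = 0 the polynomial is p times an equally distributed one and has the same
    roots, so the expectation itself reappears.\<close>
  also have "?I 0 = expZ n" unfolding expZ_def using dig[of 0] by (simp add: num_roots_in_smult)
  also have "(\<Sum>h | h \<noteq> 0 \<and> degree h \<le> n. ?I h) =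
     (\<Sum>h | h \<noteq> 0 \<and> degree h \<le> n. (\<Sum>f\<in>{f \<in> monic_irreducibles. f dvd h}. cfin f (multiplicity f h)) + cinf (n - degree h))"
    using dig integral_split_clusters by (intro sum.cong refl) simp
  finally show ?thesis .
qed

lemma cluster_le:
  assumes "s \<le> 1" "degree H \<le> k"
  shows "cluster H k s \<le> of_nat k"
proof -
  have "Zn (H + smult pZ (Polynomial.monom 1 s * pol k z)) \<le> k" for z
    using assms degree_monom_pol_le[of s k z]
    by (intro order_trans[OF num_roots_in_le] degree_add_le order_trans[OF degree_smult_le])
  hence "cluster H k s \<le> (\<integral>\<^sup>+z. of_nat k \<partial>V k)"
    unfolding cluster_def by (intro nn_integral_mono of_nat_mono)
  thus ?thesis using prob_space.emeasure_space_1[OF prob_space_V[of k]] by simp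
qed

lemma cfin_le:
  assumes "f \<in> monic_irreducibles"
  shows "cfin f m \<le> of_nat (m * degree f)"
  unfolding cfin_def using assms lead_coeff_lift_power(2)[of f m]
  by (intro cluster_le) (auto simp: monic_irreducibles_def)

lemma cinf_le: "cinf m \<le> of_nat m"
  unfolding cinf_def by (intro cluster_le) simp_all

lemma expZ_le: "expZ n \<le> of_nat n"
proof -
  have "Zn (pol (Suc n) z) \<le> n" for z :: "nat \<Rightarrow> 'p padic_int"
    by (rule order_trans[OF num_roots_in_le degree_pol_le])
  hence "expZ n \<le> (\<integral>\<^sup>+z. of_nat n \<partial>V (Suc n))"
    unfolding expZ_def by (intro nn_integral_mono of_nat_mono)
  thus ?thesis using prob_space.emeasure_space_1[OF prob_space_V[of "Suc n"]] by simp
qed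

lemma cfin_1:
  assumes f: "f \<in> monic_irreducibles"
  shows "cfin f 1 = 0"
proof -
  have irr: "irreducible f" "lead_coeff f = 1" using f by (auto simp: monic_irreducibles_def)
  have "degree f > 0" using irr is_unit_iff_degree[of f] by (cases "f = 0") (auto simp: Factorial_Ring.irreducible_def)
  have "Zn (map_poly lift f + smult pZ (pol (degree f) z)) = 0" for z
  proof (rule num_roots_in_eq_0)
    let ?W = "map_poly lift f + smult pZ (pol (degree f) z)"
    have rW: "map_poly red ?W = f" by (simp add: redp.hom_add red_map_smult_pZ)
    show "?W \<noteq> 0" using irr by (intro sum_neq_0_if_red) auto
    have "degree (smult pZ (pol (degree f) z)) < degree (map_poly lift f)"
      using degree_pol_less[OF \<open>degree f > 0\<close>, of z] by (intro le_less_trans[OF degree_smult_le]) simp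
    hence "lead_coeff (smult pZ (pol (degree f) z) + map_poly lift f) = lead_coeff (map_poly lift f)"
      by (rule lead_coeff_add_le)
    hence "lead_coeff ?W = lead_coeff (map_poly lift f)" unfolding add.commute[of "map_poly lift f"] .
    hence lc: "lead_coeff ?W = 1" using irr by (simp add: coeff_map_poly)
    fix x assume "poly (embp ?W) x = 0"
    hence "x \<in> padic_unramified" using irreducible_reduction_root_unramified[OF lc] irr(1) rW by simp
    thus "x \<notin> - padic_unramified" by simp
  qed
  thus ?thesis by (simp add: cfin_def cluster_def)
qed

text \<open>The factor is linear or constant, so a root can only lie in Q_p.\<close>

lemma cinf_1: "cinf 1 = 0"
proof -
  have "Zn (1 + smult pZ (Polynomial.monom 1 1 * pol 1 z)) = 0" for z :: "nat \<Rightarrow> 'p padic_int"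
  proof (rule num_roots_in_eq_0)
    show "1 + smult pZ (Polynomial.monom 1 1 * pol 1 z) \<noteq> 0" by (intro sum_neq_0_if_red) simp
    fix x assume "poly (embp (1 + smult pZ (Polynomial.monom 1 1 * pol 1 z))) x = 0"
    moreover have "1 + smult pZ (Polynomial.monom 1 1 * pol 1 z) = [:1, pZ * z 0:]"
      by (simp add: pol_def monom_0 monom_Suc poly_eq_iff coeff_pCons split: nat.split)
    ultimately have "1 + x * emb (pZ * z 0) = 0" by (simp only: embp_pCons) simp
    hence "1 = - (x * emb (pZ * z 0))" by (rule eq_neg_iff_add_eq_0[THEN iffD2])
    hence eq: "x * emb (pZ * z 0) = - 1" by (rule equation_minus_iff[THEN iffD1])
    hence "emb (pZ * z 0) \<noteq> 0" by auto
    hence "x = - 1 / emb (pZ * z 0)" using eq by (simp only: nonzero_eq_divide_eq simp_thms)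
    also have "- 1 = emb (- 1)" by (simp add: emb.hom_uminus)
    finally have "x = emb (- 1) / emb (pZ * z 0)" .
    thus "x \<notin> - padic_unramified" using unramified_div_emb by blast
  qed
  thus ?thesis by (simp add: cinf_def cluster_def)
qed

text \<open>An unramified integer that is a nonunit is divisible by p, since its Teichmueller digit
  must be 0. Then p^2 divides every term of the equation except p a, so p would divide a.\<close>

lemma Eisenstein_root_not_unramified:
  fixes x :: "'p padic_closure"
  assumes "\<not> pZ dvd a" and root: "x ^ 2 + pC * (emb b * x + emb a) = 0" and x: "x \<in> OC"
  shows "x \<notin> padic_unramified"
proof
  assume "x \<in> padic_unramified"
  then obtain e where e: "e > 0" "x \<in> Sq (CARD('p) ^ e)" unfolding padic_unramified_iff by blast
  note gq = good_q_power[OF e(1), where 'p = 'p]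
  obtain \<tau> where t: "\<tau> \<in> muq (CARD('p) ^ e)" "pdiv 1 (x - \<tau>)" using Sq_integer_digit[OF gq e(2) x] .
  have "x ^ 2 = - (pC * (emb b * x + emb a))" by (rule eq_neg_iff_add_eq_0[THEN iffD2, OF root])
  hence "x ^ 2 = pC * (- (emb b * x + emb a))" unfolding mult_minus_right .
  hence "NU (x ^ 2)" using x by (simp only:) (intro NU_pC_mult OC_uminus OC_add OC_mult OC_emb)
  hence nx: "NU x" using not_NU_power[OF x] by blast
  have "NU (x - \<tau>)" using t(2) pdiv_imp_NU[of 0 "x - \<tau>"] by simp
  hence "NU (x - (x - \<tau>))" by (rule NU_diff[OF nx])
  hence "NU \<tau>" by simp
  hence "\<tau> = 0" using muq_nonzero_unit(2)[OF gq t(1)] by blast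
  hence "x / pC \<in> OC" using t(2) by (simp add: pdiv_def)
  define y where "y = x / pC"
  have y: "x = pC * y" "y \<in> OC" using \<open>x / pC \<in> OC\<close> by (simp_all add: y_def)
  have "pC * (pC * y ^ 2 + (emb b * (pC * y) + emb a)) = 0"
    using root unfolding y(1) by (simp add: algebra_simps power2_eq_square)
  hence "pC * y ^ 2 + (emb b * (pC * y) + emb a) = 0" by simp
  hence "emb a = - (pC * (y ^ 2 + emb b * y))" by (simp add: algebra_simps eq_neg_iff_add_eq_0)
  hence "emb a = pC * (- (y ^ 2 + emb b * y))" unfolding mult_minus_right .
  moreover have "- (y ^ 2 + emb b * y) \<in> OC" using y(2) by (intro OC_uminus OC_add OC_mult OC_power OC_emb)
  ultimately have "pZ dvd a" by (rule pZ_dvd_if_OC)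
  thus False using assms(1) by blast
qed

lemma cfin_X_2_pos: "cfin [:0, 1:] 2 \<ge> ennreal (1 / real CARD('p) ^ 2)"
proof -
  let ?P = "\<lambda>z :: nat \<Rightarrow> 'p padic_int. map_poly lift [:0, 1:] ^ 2 + smult pZ (Polynomial.monom 1 0 * pol 2 z)"
  \<comment> \<open>On the ball of vectors congruent to (1, 1) modulo p the constant term is p times
    a unit, so the quadratic polynomial is Eisenstein. This ball has measure p^(-2).\<close>
  have Zn2: "Zn (?P z) \<ge> 1" if z: "z \<in> cyl 2 1 (\<lambda>_. 1)" for z
  proof -
    have P: "?P z = [:pZ * z 0, pZ * z 1, 1:]"
      by (simp add: pol_def numeral_2_eq_2 monom_0 monom_Suc map_poly_pCons)
    have "residue (z 0) 1 = residue (1 :: 'p padic_int) 1" using z by (auto simp: cyl_def cong_level_def)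
    hence "red (z 0) = 1" by (simp add: red_def one_padic_int.rep_eq residue_of_nat)
    hence nd: "\<not> pZ dvd z 0" using red_eq_0_iff[of "z 0"] by simp
    have nz: "?P z \<noteq> 0" unfolding P by simp
    have "num_roots_in padic_unramified (?P z) = 0"
    proof (rule num_roots_in_eq_0[OF nz])
      fix x assume root: "poly (embp (?P z)) x = 0"
      have "x \<in> OC" unfolding mem_OC_iff
        by (rule exI[of _ "?P z"], rule conjI[OF _ root]) (simp only: P, simp)
      moreover have "x ^ 2 + pC * (emb (z 1) * x + emb (z 0)) = 0"
        using root unfolding P by (simp add: emb.hom_mult algebra_simps power2_eq_square)
      ultimately show "x \<notin> padic_unramified" using Eisenstein_root_not_unramified[OF nd] by blast
    qed
    moreover have "degree (?P z) = 2" unfolding P by simp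
    ultimately show ?thesis using num_roots_in_Compl[OF nz, of padic_unramified] by linarith
  qed
  have "ennreal (1 / real CARD('p) ^ 2) = (\<integral>\<^sup>+z. indicator (cyl 2 1 (\<lambda>_. 1)) z \<partial>V 2)"
    by (simp add: emeasure_cyl)
  also have "\<dots> \<le> (\<integral>\<^sup>+z. of_nat (Zn (?P z)) \<partial>V 2)"
  proof (rule nn_integral_mono)
    fix z show "indicator (cyl 2 1 (\<lambda>_. 1)) z \<le> (of_nat (Zn (?P z)) :: ennreal)"
      using Zn2[of z] of_nat_mono[of 1 "Zn (?P z)", where ?'a = ennreal] by (auto split: split_indicator)
  qed
  also have "\<dots> = cfin [:0, 1:] 2" by (simp add: cfin_def cluster_def)
  finally show ?thesis .
qed

lemma expected_roots_eq: "expected_roots \<mu> (- padic_unramified) n = expZ n"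
proof -
  have "poly_of_coeffs n a = pol (Suc n) a" for a :: "nat \<Rightarrow> 'p padic_int"
    by (simp add: poly_of_coeffs_def pol_def lessThan_Suc_atMost)
  thus ?thesis by (simp add: expected_roots_def expZ_def lessThan_Suc_atMost)
qed

end

section \<open>Counting and the limit\<close>

lemma card_degree_le: "card {h :: 'p :: prime_card mod_ring poly. degree h \<le> n} = CARD('p) ^ Suc n"
proof -
  have "bij_betw (\<lambda>z. pol (Suc n) z) (PiE {..<Suc n} (\<lambda>_. UNIV)) {h :: 'p mod_ring poly. degree h \<le> n}"
  proof (rule bij_betwI[where g = "\<lambda>h. restrict (coeff h) {..<Suc n}"])
    show "pol (Suc n) \<in> (PiE {..<Suc n} (\<lambda>_. UNIV)) \<rightarrow> {h :: 'p mod_ring poly. degree h \<le> n}"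
      using degree_pol_le by blast
    show "(\<lambda>h :: 'p mod_ring poly. restrict (coeff h) {..<Suc n}) \<in> {h. degree h \<le> n} \<rightarrow> PiE {..<Suc n} (\<lambda>_. UNIV)"
      by auto
    show "restrict (coeff (pol (Suc n) z)) {..<Suc n} = z"
      if "z \<in> PiE {..<Suc n} (\<lambda>_. UNIV :: 'p mod_ring set)" for z
      using that by (intro ext) (auto simp: PiE_def extensional_def)
    fix h :: "'p mod_ring poly" assume h: "h \<in> {h. degree h \<le> n}"
    have "pol (Suc n) (restrict (coeff h) {..<Suc n}) = pol (Suc n) (coeff h)" by (intro pol_cong) simp
    also have "\<dots> = h"
      using h by (intro poly_eqI) (simp add: coeff_eq_0)
    finally show "pol (Suc n) (restrict (coeff h) {..<Suc n}) = h" .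
  qed
  from bij_betw_same_card[OF this] show ?thesis by (simp add: card_PiE)
qed

text \<open>The minimum covers the case degree g > n, in which 0 is the only multiple left.\<close>

lemma card_multiples:
  fixes g :: "'p :: prime_card mod_ring poly"
  assumes "g \<noteq> 0"
  shows "real (card {h. g dvd h \<and> degree h \<le> n}) = real CARD('p) ^ Suc n / real CARD('p) ^ min (degree g) (Suc n)"
proof (cases "degree g \<le> n")
  case True
  have "bij_betw (\<lambda>q. g * q) {q. degree q \<le> n - degree g} {h. g dvd h \<and> degree h \<le> n}"
  proof (rule bij_betwI')
    fix q :: "'p mod_ring poly" assume "q \<in> {q. degree q \<le> n - degree g}"
    thus "g * q \<in> {h. g dvd h \<and> degree h \<le> n}" using True degree_mult_le[of g q] by auto
  next
    fix h :: "'p mod_ring poly" assume h: "h \<in> {h. g dvd h \<and> degree h \<le> n}"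
    then obtain q where q: "h = g * q" by (auto elim!: dvdE)
    have "degree q \<le> n - degree g"
    proof (cases "q = 0")
      case False
      hence "degree h = degree g + degree q" using q assms by (simp add: degree_mult_eq)
      thus ?thesis using h by auto
    qed simp
    thus "\<exists>q\<in>{q. degree q \<le> n - degree g}. h = g * q" using q by blast
  qed (use assms in auto)
  from bij_betw_same_card[OF this] have "card {h. g dvd h \<and> degree h \<le> n} = CARD('p) ^ Suc (n - degree g)"
    by (simp only: card_degree_le)
  moreover have "real CARD('p) ^ Suc n = real CARD('p) ^ Suc (n - degree g) * real CARD('p) ^ degree g"
    unfolding power_add[symmetric] using True by simp
  ultimately show ?thesis using True by simp
next
  case False
  have "h = 0" if "g dvd h" "degree h \<le> n" for h
    using dvd_imp_degree_le[OF that(1)] that(2) False by (cases "h = 0") auto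
  hence "{h. g dvd h \<and> degree h \<le> n} = {0}" by auto
  thus ?thesis using False by simp
qed

lemma card_prime_ge_2: "real CARD('p :: prime_card) \<ge> 2"
  using prime_ge_2_nat[OF prime_card[where 'a = 'p]] by simp

text \<open>The share, among the p^(n+1) polynomials of degree at most n, of those divisible exactly
  m times by a given irreducible of degree d. For large n it equals p^(-dm)(1 - p^(-d)).\<close>

definition mult_weight :: "real \<Rightarrow> nat \<Rightarrow> nat \<Rightarrow> nat \<Rightarrow> real" where
  "mult_weight p d n m = 1 / p ^ min (d * m) (Suc n) - 1 / p ^ min (d * Suc m) (Suc n)"

lemma monic_irreducibleD:
  fixes f :: "'p :: prime_card mod_ring poly"
  assumes "f \<in> monic_irreducibles"
  shows "f \<noteq> 0" "\<not> is_unit f" "degree f > 0" "irreducible f" "lead_coeff f = 1"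
  using assms is_unit_iff_degree[of f] by (auto simp: monic_irreducibles_def Factorial_Ring.irreducible_def)

text \<open>Multiples of f^m minus multiples of f^(m+1); the zero polynomial belongs to both sets
  and cancels.\<close>

lemma card_multiplicity:
  fixes f :: "'p :: prime_card mod_ring poly"
  assumes f: "f \<in> monic_irreducibles"
  shows "real (card {h. h \<noteq> 0 \<and> degree h \<le> n \<and> multiplicity f h = m}) =
    real CARD('p) ^ Suc n * mult_weight (real CARD('p)) (degree f) n m"
proof -
  note fD = monic_irreducibleD[OF f]
  let ?A = "\<lambda>m. {h. f ^ m dvd h \<and> degree h \<le> n}"
  have deg: "degree (f ^ m) = degree f * m" for m using fD(1) by (simp add: degree_power_eq mult.commute)
  have fin: "finite (?A m)" for m by (rule finite_subset[OF _ finite_degree_le[of n]]) blast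
  have "{h. h \<noteq> 0 \<and> degree h \<le> n \<and> multiplicity f h = m} = ?A m - ?A (Suc m)"
  proof (intro Set.set_eqI iffI)
    fix h assume "h \<in> {h. h \<noteq> 0 \<and> degree h \<le> n \<and> multiplicity f h = m}"
    hence h: "h \<noteq> 0" "degree h \<le> n" "multiplicity f h = m" by blast+
    thus "h \<in> ?A m - ?A (Suc m)"
      using power_dvd_iff_le_multiplicity[OF h(1) fD(2), of m] power_dvd_iff_le_multiplicity[OF h(1) fD(2), of "Suc m"] by simp
  next
    fix h assume h: "h \<in> ?A m - ?A (Suc m)"
    hence "h \<noteq> 0" by auto
    moreover have "multiplicity f h = m" using h by (intro multiplicity_eqI) auto
    ultimately show "h \<in> {h. h \<noteq> 0 \<and> degree h \<le> n \<and> multiplicity f h = m}" using h by blast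
  qed
  moreover have sub: "?A (Suc m) \<subseteq> ?A m" using dvd_trans[OF le_imp_power_dvd[of m "Suc m" f]] by auto
  have "real (card (?A m - ?A (Suc m))) = real (card (?A m)) - real (card (?A (Suc m)))"
    using card_Diff_subset[OF fin sub] card_mono[OF fin sub] by (simp add: of_nat_diff)
  ultimately show ?thesis
    using card_multiples[of "f ^ m" n] card_multiples[of "f ^ Suc m" n] fD(1)
    unfolding deg mult_weight_def by (simp add: right_diff_distrib)
qed

text \<open>Either f^m does not fit into degree n and the weight is 0, or the first term has reached
  its final value and only the subtracted term, which decreases, depends on n.\<close>

lemma mult_weight_mono:
  assumes "p \<ge> 1" "n \<le> n'"
  shows "mult_weight p d n m \<le> mult_weight p d n' m"
proof -
  have dec: "1 / p ^ j \<le> 1 / p ^ i" if "i \<le> j" for i j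
    using assms(1) power_increasing[OF that assms(1)] by (intro divide_left_mono) auto
  show ?thesis
  proof (cases "d * m \<le> n")
    case True
    have "1 / p ^ min (d * Suc m) (Suc n') \<le> 1 / p ^ min (d * Suc m) (Suc n)" using assms(2) by (intro dec) auto
    thus ?thesis using True assms(2) by (simp add: mult_weight_def)
  next
    case False
    hence "min (d * m) (Suc n) = Suc n" "min (d * Suc m) (Suc n) = Suc n" by auto
    hence "mult_weight p d n m = 0" unfolding mult_weight_def by (simp only: diff_self)
    moreover have "mult_weight p d n' m \<ge> 0"
      unfolding mult_weight_def using dec[of "min (d * m) (Suc n')" "min (d * Suc m) (Suc n')"] by simp
    ultimately show ?thesis by simp
  qed
qed

lemma mult_weight_nonneg: "p \<ge> 1 \<Longrightarrow> mult_weight p d n m \<ge> 0"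
  unfolding mult_weight_def
  using divide_left_mono[OF power_increasing[of "min (d * m) (Suc n)" "min (d * Suc m) (Suc n)" p], of 1] by simp

lemma mult_weight_le:
  assumes "p \<ge> 1"
  shows "mult_weight p d n m \<le> (1 / p ^ d) ^ m * (1 - 1 / p ^ d)"
proof -
  have dec: "1 / p ^ j \<le> 1 / p ^ i" if "i \<le> j" for i j
    using assms power_increasing[OF that assms] by (intro divide_left_mono) auto
  have eq: "(1 / p ^ d) ^ m * (1 - 1 / p ^ d) = 1 / p ^ (d * m) - 1 / p ^ (d * Suc m)"
    by (simp add: right_diff_distrib power_mult power_add power_one_over)
  show ?thesis
  proof (cases "d * m \<le> n")
    case True
    have "1 / p ^ (d * Suc m) \<le> 1 / p ^ min (d * Suc m) (Suc n)" by (rule dec) simp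
    thus ?thesis using True unfolding eq by (simp add: mult_weight_def)
  next
    case False
    hence "min (d * m) (Suc n) = Suc n" "min (d * Suc m) (Suc n) = Suc n" by auto
    hence "mult_weight p d n m = 0" unfolding mult_weight_def by (simp only: diff_self)
    thus ?thesis unfolding eq using dec[of "d * m" "d * Suc m"] by simp
  qed
qed

lemma sum_arith_geometric_le:
  fixes y :: real
  assumes "0 \<le> y" "y < 1"
  shows "(\<Sum>m = 2..n. real (m - 1) * y ^ m) \<le> y ^ 2 / (1 - y) ^ 2"
proof -
  \<comment> \<open>The exact partial sum, whose two error terms are nonnegative.\<close>
  have "(\<Sum>m = 2..n. real (m - 1) * y ^ m) * (1 - y) ^ 2 + real n * y ^ Suc n * (1 - y) + y ^ Suc n * y = y ^ 2"
    if "n \<ge> 1" for n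
    using that
  proof (induction n rule: dec_induct)
    case base
    show ?case by (simp add: power2_eq_square algebra_simps)
  next
    case (step n)
    have "(\<Sum>m = 2..Suc n. real (m - 1) * y ^ m) = (\<Sum>m = 2..n. real (m - 1) * y ^ m) + real n * y ^ Suc n"
      using step.hyps by (cases n) (simp_all add: atLeastAtMostSuc_conv)
    thus ?case using step.IH by (simp add: algebra_simps power2_eq_square)
  qed
  from this[of n] have "(\<Sum>m = 2..n. real (m - 1) * y ^ m) * (1 - y) ^ 2 \<le> y ^ 2" if "n \<ge> 1"
    using that assms by (smt (verit) mult_nonneg_nonneg of_nat_0_le_iff zero_le_power)
  moreover have "(\<Sum>m = 2..n. real (m - 1) * y ^ m) * (1 - y) ^ 2 \<le> y ^ 2" if "n = 0" using that by simp
  ultimately have "(\<Sum>m = 2..n. real (m - 1) * y ^ m) * (1 - y) ^ 2 \<le> y ^ 2" by (cases "n = 0") auto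
  thus ?thesis using assms by (simp add: pos_le_divide_eq)
qed

text \<open>Distinct monic irreducibles of degree d are coprime and all divide X^(p^d) - X, so the
  degree of their product is at most p^d.\<close>

lemma card_irreducibles_le:
  assumes "d > 0"
  shows "d * card {f \<in> monic_irreducibles :: 'p :: prime_card mod_ring poly set. degree f = d} \<le> CARD('p) ^ d"
proof -
  let ?F = "{f \<in> monic_irreducibles :: 'p mod_ring poly set. degree f = d}"
  define Q where "Q = ((Polynomial.monom 1 1) ^ (CARD('p) ^ d) - Polynomial.monom 1 1 :: 'p mod_ring poly)"
  have p: "CARD('p) > 1" using prime_gt_1_nat[OF prime_card[where 'a = 'p]] .
  have "CARD('p) ^ d > 1" using p assms by (intro one_less_power)
  have Q_monom: "Q = Polynomial.monom 1 (CARD('p) ^ d) - Polynomial.monom 1 1" by (simp add: Q_def monom_power)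
  have "coeff Q (CARD('p) ^ d) = 1" unfolding Q_monom using \<open>CARD('p) ^ d > 1\<close> by simp
  hence Q0: "Q \<noteq> 0" by auto
  have degQ: "degree Q \<le> CARD('p) ^ d"
    unfolding Q_monom using \<open>CARD('p) ^ d > 1\<close> by (intro degree_diff_le order_trans[OF degree_monom_le]) auto
  have fin: "finite ?F" by (rule finite_subset[OF _ finite_degree_le[of d]]) auto
  have "(\<Prod>f\<in>G. f) dvd Q" if "finite G" "G \<subseteq> ?F" for G
    using that
  proof (induction G)
    case (insert f G)
    have f: "f \<in> monic_irreducibles" "degree f = d" using insert.prems by auto
    note fD = monic_irreducibleD[OF f(1)]
    have "f dvd Q" unfolding Q_def by (rule irreducible_dvd_Frobenius[OF fD(4)]) (simp add: f)
    moreover have "coprime f (\<Prod>g\<in>G. g)"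
    proof (rule prod_coprime_right)
      fix g assume g: "g \<in> G"
      hence g': "g \<in> monic_irreducibles" "f \<noteq> g" using insert by auto
      have "\<not> f dvd g" using monic_irreducible_dvd_imp_eq[OF f(1) g'(1)] g'(2) by blast
      thus "coprime f g" using fD(4) by (intro prime_elem_imp_coprime irreducible_imp_prime_elem_gcd)
    qed
    ultimately have "f * (\<Prod>g\<in>G. g) dvd Q" using insert by (intro divides_mult) auto
    thus ?case using insert.hyps by simp
  qed simp
  from this[OF fin] have "(\<Prod>f\<in>?F. f) dvd Q" by simp
  hence "degree (\<Prod>f\<in>?F. f) \<le> degree Q" using Q0 by (rule dvd_imp_degree_le)
  hence "degree (\<Prod>f\<in>?F. f) \<le> CARD('p) ^ d" using degQ by (rule order_trans)
  moreover have "degree (\<Prod>f\<in>?F. f) = (\<Sum>f\<in>?F. degree f)"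
    using monic_irreducibleD(1) by (intro degree_prod_eq_sum_degree) auto
  moreover have "(\<Sum>f\<in>?F. degree f) = d * card ?F" by simp
  ultimately show ?thesis by linarith
qed

section \<open>Real-valued expectations, their bounds and their limit\<close>

context padic_haar
begin

definition afin :: "'p mod_ring poly \<Rightarrow> nat \<Rightarrow> real" where "afin f m = enn2real (cfin f m)"
definition ainf :: "nat \<Rightarrow> real" where "ainf m = enn2real (cinf m)"

lemma ennreal_afin: "f \<in> monic_irreducibles \<Longrightarrow> cfin f m = ennreal (afin f m)"
  and ennreal_ainf: "cinf m = ennreal (ainf m)"
proof -
  show "cfin f m = ennreal (afin f m)" if "f \<in> monic_irreducibles"
    using cfin_le[OF that, of m] unfolding afin_def
    by (intro ennreal_enn2real[symmetric]) (auto simp: ennreal_of_nat_eq_real_of_nat elim: le_less_trans)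
  show "cinf m = ennreal (ainf m)"
    using cinf_le[of m] unfolding ainf_def
    by (intro ennreal_enn2real[symmetric]) (auto simp: ennreal_of_nat_eq_real_of_nat elim: le_less_trans)
qed

lemma afin_nonneg: "afin f m \<ge> 0" and ainf_nonneg: "ainf m \<ge> 0"
  by (simp_all add: afin_def ainf_def)

text \<open>For m \<ge> 2 the trivial bound m d is at most 2(m-1)d. In this form it also covers m =
  1, where the contribution is 0, and fits the series of (m-1) y^m.\<close>

lemma afin_bound:
  assumes f: "f \<in> monic_irreducibles" and m: "m \<ge> 1"
  shows "afin f m \<le> 2 * real (degree f) * real (m - 1)"
proof (cases "m = 1")
  case True
  thus ?thesis using cfin_1[OF f] by (simp add: afin_def)
next
  case False
  have "ennreal (afin f m) \<le> ennreal (real (m * degree f))"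
    using cfin_le[OF f, of m] unfolding ennreal_afin[OF f] ennreal_of_nat_eq_real_of_nat .
  hence "afin f m \<le> real (m * degree f)" by (subst (asm) ennreal_le_iff) simp_all
  also have "m * degree f \<le> 2 * degree f * (m - 1)" using False m
    by (cases m) (auto simp: algebra_simps)
  hence "real (m * degree f) \<le> real (2 * degree f * (m - 1))" by (rule of_nat_mono)
  finally show ?thesis by simp
qed

lemma ainf_bound: "ainf m \<le> 2 * real (m - 1)"
proof (cases "m \<ge> 2")
  case False
  hence "m = 0 \<or> m = 1" by auto
  thus ?thesis using cinf_1 cinf_le[of 0] by (auto simp: ainf_def)
next
  case True
  have "ennreal (ainf m) \<le> ennreal (real m)"
    using cinf_le[of m] unfolding ennreal_ainf ennreal_of_nat_eq_real_of_nat .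
  hence "ainf m \<le> real m" by (subst (asm) ennreal_le_iff) simp_all
  thus ?thesis using True by (simp add: of_nat_diff)
qed

abbreviation irr_le :: "nat \<Rightarrow> 'p mod_ring poly set" where
  "irr_le n \<equiv> {f \<in> monic_irreducibles. degree f \<le> n}"

lemma finite_irr_le: "finite (irr_le n)"
  by (rule finite_subset[OF _ finite_degree_le[of n]]) auto

text \<open>The finite contributions averaged over all reductions h, but summed by f and m instead
  of by h.\<close>

definition fin_part :: "nat \<Rightarrow> real" where
  "fin_part n = (\<Sum>f\<in>irr_le n. \<Sum>m=1..n. afin f m * mult_weight (real CARD('p)) (degree f) n m)"

text \<open>Here \<open>m\<close> is the drop of degree, and (p-1)/p^(m+1) is the share of nonzero
  polynomials of degree n - m.\<close>

definition inf_part :: "nat \<Rightarrow> real" where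
  "inf_part n = (\<Sum>m\<le>n. ainf m * ((real CARD('p) - 1) / real CARD('p) ^ Suc m))"

lemma sum_fin_part:
  "(\<Sum>h | h \<noteq> 0 \<and> degree h \<le> n. \<Sum>f\<in>{f \<in> monic_irreducibles. f dvd h}. afin f (multiplicity f h)) =
    real CARD('p) ^ Suc n * fin_part n"
proof -
  let ?H = "{h :: 'p mod_ring poly. h \<noteq> 0 \<and> degree h \<le> n}"
  have finH: "finite ?H" by (rule finite_subset[OF _ finite_degree_le[of n]]) auto
  have "(\<Sum>h\<in>?H. \<Sum>f\<in>{f \<in> monic_irreducibles. f dvd h}. afin f (multiplicity f h)) =
    (\<Sum>h\<in>?H. \<Sum>f\<in>{f \<in> irr_le n. f dvd h}. afin f (multiplicity f h))"
  proof (intro sum.cong refl)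
    fix h assume h: "h \<in> ?H"
    show "{f \<in> monic_irreducibles. f dvd h} = {f \<in> irr_le n. f dvd h}"
      using h dvd_imp_degree_le[of _ h] by force
  qed
  also have "\<dots> = (\<Sum>f\<in>irr_le n. \<Sum>h\<in>{h \<in> ?H. f dvd h}. afin f (multiplicity f h))"
    by (rule sum.swap_restrict[OF finH finite_irr_le])
  also have "\<dots> = (\<Sum>f\<in>irr_le n. real CARD('p) ^ Suc n * (\<Sum>m=1..n. afin f m * mult_weight (real CARD('p)) (degree f) n m))"
  proof (intro sum.cong refl)
    fix f assume f: "f \<in> irr_le n"
    hence fm: "f \<in> monic_irreducibles" by blast
    note fD = monic_irreducibleD[OF fm]
    have "(\<Sum>h\<in>{h \<in> ?H. f dvd h}. afin f (multiplicity f h)) =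
       (\<Sum>m=1..n. \<Sum>h\<in>{h \<in> {h \<in> ?H. f dvd h}. multiplicity f h = m}. afin f (multiplicity f h))"
    proof (rule sum.group[symmetric])
      show "multiplicity f ` {h \<in> ?H. f dvd h} \<subseteq> {1..n}"
      proof
        fix m assume "m \<in> multiplicity f ` {h \<in> ?H. f dvd h}"
        then obtain h where h: "h \<noteq> 0" "degree h \<le> n" "f dvd h" "m = multiplicity f h" by blast
        have "m \<ge> 1" using multiplicity_gt_zero_iff[OF h(1) fD(2)] h by simp
        moreover have "degree (f ^ m) \<le> degree h"
          using h(1,4) multiplicity_dvd[of f h] by (intro dvd_imp_degree_le) auto
        hence "m * degree f \<le> n" using h(2) fD(1) by (simp add: degree_power_eq mult.commute)
        hence "m \<le> n" using fD(3) by (cases "degree f") auto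
        ultimately show "m \<in> {1..n}" by simp
      qed
      show "finite {h \<in> ?H. f dvd h}" by (rule finite_subset[OF _ finH]) blast
    qed simp
    also have "\<dots> = (\<Sum>m=1..n. real (card {h. h \<noteq> 0 \<and> degree h \<le> n \<and> multiplicity f h = m}) * afin f m)"
    proof (intro sum.cong refl)
      fix m assume m: "m \<in> {1..n}"
      have "{h \<in> {h \<in> ?H. f dvd h}. multiplicity f h = m} = {h. h \<noteq> 0 \<and> degree h \<le> n \<and> multiplicity f h = m}"
        using m multiplicity_gt_zero_iff[OF _ fD(2)] by force
      thus "(\<Sum>h\<in>{h \<in> {h \<in> ?H. f dvd h}. multiplicity f h = m}. afin f (multiplicity f h)) =
          real (card {h. h \<noteq> 0 \<and> degree h \<le> n \<and> multiplicity f h = m}) * afin f m"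
        by simp
    qed
    finally show "(\<Sum>h\<in>{h \<in> ?H. f dvd h}. afin f (multiplicity f h)) =
        real CARD('p) ^ Suc n * (\<Sum>m=1..n. afin f m * mult_weight (real CARD('p)) (degree f) n m)"
      unfolding card_multiplicity[OF fm] sum_distrib_left by (simp add: mult_ac)
  qed
  finally show ?thesis unfolding fin_part_def sum_distrib_left .
qed

lemma sum_inf_part:
  "(\<Sum>h | h \<noteq> (0 :: 'p mod_ring poly) \<and> degree h \<le> n. ainf (n - degree h)) = real CARD('p) ^ Suc n * inf_part n"
proof -
  let ?H = "{h :: 'p mod_ring poly. h \<noteq> 0 \<and> degree h \<le> n}"
  have finH: "finite ?H" by (rule finite_subset[OF _ finite_degree_le[of n]]) auto
  have p: "real CARD('p) > 0" by simp
  have card_deg: "real (card {h :: 'p mod_ring poly. h \<noteq> 0 \<and> degree h = k}) = (real CARD('p) - 1) * real CARD('p) ^ k" for k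
  proof (cases k)
    case 0
    have "{h :: 'p mod_ring poly. h \<noteq> 0 \<and> degree h = 0} = {h. degree h \<le> 0} - {0}" by auto
    hence "card {h :: 'p mod_ring poly. h \<noteq> 0 \<and> degree h = 0} = CARD('p) - 1"
      using card_degree_le[where ?'p = 'p, of 0] finite_degree_le[where ?'p = 'p, of 0] by simp
    thus ?thesis using 0 by (simp add: of_nat_diff Suc_leI)
  next
    case (Suc j)
    have "{h :: 'p mod_ring poly. h \<noteq> 0 \<and> degree h = k} = {h. degree h \<le> Suc j} - {h. degree h \<le> j}" using Suc by auto
    moreover have "real (card ({h :: 'p mod_ring poly. degree h \<le> Suc j} - {h. degree h \<le> j})) =
        real (card {h :: 'p mod_ring poly. degree h \<le> Suc j}) - real (card {h :: 'p mod_ring poly. degree h \<le> j})"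
    proof -
      have s: "{h :: 'p mod_ring poly. degree h \<le> j} \<subseteq> {h. degree h \<le> Suc j}" by auto
      show ?thesis using card_Diff_subset[OF finite_degree_le s] card_mono[OF finite_degree_le s] by (simp add: of_nat_diff)
    qed
    ultimately show ?thesis unfolding card_degree_le Suc by (simp add: algebra_simps)
  qed
  have "(\<Sum>h\<in>?H. ainf (n - degree h)) = (\<Sum>k\<le>n. \<Sum>h\<in>{h \<in> ?H. degree h = k}. ainf (n - degree h))"
    by (rule sum.group[symmetric]) (use finH in auto)
  also have "\<dots> = (\<Sum>k\<le>n. (real CARD('p) - 1) * real CARD('p) ^ k * ainf (n - k))"
  proof (intro sum.cong refl)
    fix k assume k: "k \<in> {..n}"
    have "{h \<in> ?H. degree h = k} = {h. h \<noteq> 0 \<and> degree h = k}" using k by auto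
    thus "(\<Sum>h\<in>{h \<in> ?H. degree h = k}. ainf (n - degree h)) = (real CARD('p) - 1) * real CARD('p) ^ k * ainf (n - k)"
      using card_deg[of k] by simp
  qed
  also have "\<dots> = (\<Sum>m\<le>n. (real CARD('p) - 1) * real CARD('p) ^ (n - m) * ainf m)"
    by (rule sum.reindex_bij_witness[of _ "\<lambda>m. n - m" "\<lambda>m. n - m"]) auto
  also have "\<dots> = (\<Sum>m\<le>n. real CARD('p) ^ Suc n * (ainf m * ((real CARD('p) - 1) / real CARD('p) ^ Suc m)))"
  proof (intro sum.cong refl)
    fix m assume "m \<in> {..n}"
    hence "real CARD('p) ^ Suc n = real CARD('p) ^ (n - m) * real CARD('p) ^ Suc m"
      unfolding power_add[symmetric] by simp
    thus "(real CARD('p) - 1) * real CARD('p) ^ (n - m) * ainf m =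
        real CARD('p) ^ Suc n * (ainf m * ((real CARD('p) - 1) / real CARD('p) ^ Suc m))" by simp
  qed
  finally show ?thesis unfolding inf_part_def sum_distrib_left .
qed

text \<open>The recursion is the linear equation e = p^(-n-1)(e + T). Solving it for e needs the
  finiteness of \<open>expZ n\<close>, and the denominator stems from the reduction h = 0.\<close>

lemma expZ_real:
  "expZ n = ennreal ((fin_part n + inf_part n) / (1 - 1 / real CARD('p) ^ Suc n))"
proof -
  define e where "e = enn2real (expZ n)"
  have E: "expZ n = ennreal e"
    using expZ_le[of n] unfolding e_def
    by (intro ennreal_enn2real[symmetric]) (auto simp: ennreal_of_nat_eq_real_of_nat elim: le_less_trans)
  have e0: "e \<ge> 0" by (simp add: e_def)
  let ?H = "{h :: 'p mod_ring poly. h \<noteq> 0 \<and> degree h \<le> n}"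
  define T where "T = (\<Sum>h\<in>?H. (\<Sum>f\<in>{f \<in> monic_irreducibles. f dvd h}. afin f (multiplicity f h)) + ainf (n - degree h))"
  have T0: "T \<ge> 0" unfolding T_def by (intro sum_nonneg add_nonneg_nonneg afin_nonneg ainf_nonneg)
  have T: "T = real CARD('p) ^ Suc n * (fin_part n + inf_part n)"
    unfolding T_def sum.distrib sum_fin_part sum_inf_part by (simp add: distrib_left)
  have "(\<Sum>h\<in>?H. (\<Sum>f\<in>{f \<in> monic_irreducibles. f dvd h}. cfin f (multiplicity f h)) + cinf (n - degree h)) =
    (\<Sum>h\<in>?H. ennreal ((\<Sum>f\<in>{f \<in> monic_irreducibles. f dvd h}. afin f (multiplicity f h)) + ainf (n - degree h)))"
  proof (intro sum.cong refl)
    fix h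
    have "(\<Sum>f\<in>{f \<in> monic_irreducibles. f dvd h}. cfin f (multiplicity f h)) =
        ennreal (\<Sum>f\<in>{f \<in> monic_irreducibles. f dvd h}. afin f (multiplicity f h))"
      using ennreal_afin afin_nonneg by (subst sum_ennreal[symmetric]) auto
    thus "(\<Sum>f\<in>{f \<in> monic_irreducibles. f dvd h}. cfin f (multiplicity f h)) + cinf (n - degree h) =
        ennreal ((\<Sum>f\<in>{f \<in> monic_irreducibles. f dvd h}. afin f (multiplicity f h)) + ainf (n - degree h))"
      unfolding ennreal_ainf by (simp add: ennreal_plus[symmetric] sum_nonneg afin_nonneg ainf_nonneg del: ennreal_plus)
  qed
  also have "\<dots> = ennreal T"
    unfolding T_def by (intro sum_ennreal add_nonneg_nonneg sum_nonneg afin_nonneg ainf_nonneg)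
  finally have "ennreal e = ennreal (1 / real CARD('p) ^ Suc n) * (ennreal e + ennreal T)"
    using expZ_recursion[of n] unfolding E by (simp only:)
  also have "\<dots> = ennreal (1 / real CARD('p) ^ Suc n * (e + T))"
    using e0 T0 by (simp only: ennreal_plus[symmetric] ennreal_mult[symmetric] zero_le_divide_1_iff zero_le_power of_nat_0_le_iff add_nonneg_nonneg)
  finally have "e = 1 / real CARD('p) ^ Suc n * (e + T)" using e0 T0 by (subst (asm) ennreal_inj) auto
  hence eq: "e * (1 - 1 / real CARD('p) ^ Suc n) = fin_part n + inf_part n"
    unfolding T by (simp add: field_simps)
  have "real CARD('p) ^ Suc n > 1" using card_prime_ge_2[where ?'p = 'p] by (intro one_less_power) auto
  hence "1 - 1 / real CARD('p) ^ Suc n \<noteq> 0" by auto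
  hence "e = (fin_part n + inf_part n) / (1 - 1 / real CARD('p) ^ Suc n)"
    using eq by (simp only: nonzero_eq_divide_eq simp_thms)
  thus ?thesis unfolding E by (rule arg_cong)
qed

lemma fin_part_mono: "n \<le> n' \<Longrightarrow> fin_part n \<le> fin_part n'"
proof -
  assume n: "n \<le> n'"
  have p: "real CARD('p) \<ge> 1" using card_prime_ge_2[where ?'p = 'p] by linarith
  note nn = mult_nonneg_nonneg[OF afin_nonneg mult_weight_nonneg[OF p]]
  have "(\<Sum>m=1..n. afin f m * mult_weight (real CARD('p)) (degree f) n m) \<le>
      (\<Sum>m=1..n'. afin f m * mult_weight (real CARD('p)) (degree f) n' m)" for f
  proof -
    have "(\<Sum>m=1..n. afin f m * mult_weight (real CARD('p)) (degree f) n m) \<le>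
        (\<Sum>m=1..n. afin f m * mult_weight (real CARD('p)) (degree f) n' m)"
      by (intro sum_mono mult_left_mono mult_weight_mono p n afin_nonneg)
    also have "\<dots> \<le> (\<Sum>m=1..n'. afin f m * mult_weight (real CARD('p)) (degree f) n' m)"
      using n nn by (intro sum_mono2) auto
    finally show ?thesis .
  qed
  hence "fin_part n \<le> (\<Sum>f\<in>irr_le n. \<Sum>m=1..n'. afin f m * mult_weight (real CARD('p)) (degree f) n' m)"
    unfolding fin_part_def by (intro sum_mono)
  also have "\<dots> \<le> fin_part n'" unfolding fin_part_def
    using n by (intro sum_mono2 finite_irr_le sum_nonneg nn) auto
  finally show ?thesis .
qed

lemma inf_part_mono: "n \<le> n' \<Longrightarrow> inf_part n \<le> inf_part n'"
  unfolding inf_part_def using card_prime_ge_2[where ?'p = 'p]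
  by (intro sum_mono2 mult_nonneg_nonneg[OF ainf_nonneg]) auto

lemma inf_part_le: "inf_part n \<le> 2 / (real CARD('p) * (real CARD('p) - 1))"
proof -
  define p where "p = real CARD('p)"
  have p: "p \<ge> 2" unfolding p_def by (rule card_prime_ge_2)
  have "inf_part n \<le> (\<Sum>m\<le>n. 2 * real (m - 1) * ((p - 1) / p ^ Suc m))"
    unfolding inf_part_def p_def[symmetric] using p by (intro sum_mono mult_right_mono ainf_bound) auto
  also have "\<dots> = (\<Sum>m=2..n. 2 * real (m - 1) * ((p - 1) / p ^ Suc m))"
    by (rule sum.mono_neutral_right) auto
  also have "\<dots> = 2 * (p - 1) / p * (\<Sum>m=2..n. real (m - 1) * (1 / p) ^ m)"
    unfolding sum_distrib_left using p by (intro sum.cong refl) (simp add: power_one_over field_simps)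
  also have "\<dots> \<le> 2 * (p - 1) / p * ((1 / p) ^ 2 / (1 - 1 / p) ^ 2)"
    using p by (intro mult_left_mono sum_arith_geometric_le) auto
  also have "(1 / p) ^ 2 / (1 - 1 / p) ^ 2 = 1 / (p - 1) ^ 2"
  proof -
    have "1 - 1 / p = (p - 1) / p" using p by (simp add: diff_divide_distrib)
    thus ?thesis using p by (simp add: power_divide)
  qed
  also have "2 * (p - 1) / p * (1 / (p - 1) ^ 2) = 2 / (p * (p - 1))"
  proof -
    have "2 * c / p * (1 / c ^ 2) = 2 / (p * c)" if "c \<noteq> 0" for c
      using that by (simp add: power2_eq_square)
    from this[of "p - 1"] show ?thesis using p by linarith
  qed
  finally show ?thesis unfolding p_def .
qed

text \<open>Summing over m first gives 2 d y^2/(1-y) with y = p^(-d). The count of irreducibles then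
  cancels d and one factor y, leaving 2/(p^d - 1) for each degree d.\<close>

lemma fin_part_le: "fin_part n \<le> 2 * real CARD('p) / (real CARD('p) - 1) ^ 2"
proof -
  define p where "p = real CARD('p)"
  have p: "p \<ge> 2" unfolding p_def by (rule card_prime_ge_2)
  have f_bound: "(\<Sum>m=1..n. afin f m * mult_weight p (degree f) n m) \<le> 2 * real (degree f) * ((1 / p ^ degree f) ^ 2 / (1 - 1 / p ^ degree f))"
    if f: "f \<in> monic_irreducibles" for f
  proof -
    define y where "y = 1 / p ^ degree f"
    have "p ^ degree f > 1" using p monic_irreducibleD(3)[OF f] by (intro one_less_power) auto
    hence y: "0 < y" "y < 1" by (simp_all add: y_def)
    have "(\<Sum>m=1..n. afin f m * mult_weight p (degree f) n m) \<le> (\<Sum>m=1..n. 2 * real (degree f) * real (m - 1) * (y ^ m * (1 - y)))"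
      unfolding y_def using p
      by (intro sum_mono mult_mono afin_bound[OF f] mult_weight_le mult_weight_nonneg) auto
    also have "\<dots> = (\<Sum>m=2..n. 2 * real (degree f) * real (m - 1) * (y ^ m * (1 - y)))"
      by (rule sum.mono_neutral_right) auto
    also have "\<dots> = 2 * real (degree f) * (1 - y) * (\<Sum>m=2..n. real (m - 1) * y ^ m)"
      unfolding sum_distrib_left by (intro sum.cong refl) simp
    also have "\<dots> \<le> 2 * real (degree f) * (1 - y) * (y ^ 2 / (1 - y) ^ 2)"
      using y by (intro mult_left_mono sum_arith_geometric_le) auto
    also have "\<dots> = 2 * real (degree f) * (y ^ 2 / (1 - y))" using y by (simp add: power2_eq_square)
    finally show ?thesis unfolding y_def .
  qed
  have "fin_part n \<le> (\<Sum>f\<in>irr_le n. 2 * real (degree f) * ((1 / p ^ degree f) ^ 2 / (1 - 1 / p ^ degree f)))"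
    unfolding fin_part_def p_def[symmetric] by (intro sum_mono f_bound) auto
  also have "\<dots> = (\<Sum>d=1..n. \<Sum>f\<in>{f \<in> irr_le n. degree f = d}. 2 * real (degree f) * ((1 / p ^ degree f) ^ 2 / (1 - 1 / p ^ degree f)))"
    using monic_irreducibleD(3) by (intro sum.group[symmetric] finite_irr_le) (auto simp: Suc_le_eq)
  also have "\<dots> \<le> (\<Sum>d=1..n. 2 * p / (p - 1) * (1 / p) ^ d)"
  proof (rule sum_mono)
    fix d assume d: "d \<in> {1..n}"
    let ?F = "{f \<in> monic_irreducibles :: 'p mod_ring poly set. degree f = d}"
    define q where "q = p ^ d"
    have pd: "p ^ d = p * p ^ (d - 1)" using d by (cases d) auto
    have q1: "q > 1" unfolding q_def using p d by (intro one_less_power) auto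
    have eF: "{f \<in> irr_le n. degree f = d} = ?F" using d by auto
    have "real (d * card ?F) \<le> real (CARD('p) ^ d)" using d by (intro of_nat_mono card_irreducibles_le) simp
    hence c: "real d * real (card ?F) \<le> q" by (simp add: q_def p_def)
    have "(\<Sum>f\<in>{f \<in> irr_le n. degree f = d}. 2 * real (degree f) * ((1 / p ^ degree f) ^ 2 / (1 - 1 / p ^ degree f)))
       = (\<Sum>f\<in>?F. 2 * real d * ((1 / q) ^ 2 / (1 - 1 / q)))"
      unfolding eF q_def by (intro sum.cong refl) auto
    also have "\<dots> = 2 * (real d * real (card ?F)) * ((1 / q) ^ 2 / (1 - 1 / q))" by simp
    also have "\<dots> \<le> 2 * q * ((1 / q) ^ 2 / (1 - 1 / q))"
      using c q1 by (intro mult_right_mono) auto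
    also have "\<dots> = 2 / (q - 1)" using q1 by (simp add: field_simps power2_eq_square)
    \<comment> \<open>Weakening p^d - 1 to p^d - p^(d-1) turns the terms into a geometric
      series.\<close>
    also have "\<dots> \<le> 2 / (q - p ^ (d - 1))"
    proof -
      have "p ^ (d - 1) \<ge> 1" using p by (intro one_le_power) auto
      moreover have "p ^ (d - 1) < q" unfolding q_def pd using p by simp
      ultimately show ?thesis by (intro divide_left_mono mult_pos_pos) auto
    qed
    also have "q - p ^ (d - 1) = (p - 1) / p * p ^ d" unfolding q_def pd using p by (simp add: field_simps)
    also have "2 / ((p - 1) / p * p ^ d) = 2 * p / (p - 1) * (1 / p) ^ d" using p by (simp add: power_one_over)
    finally show "(\<Sum>f\<in>{f \<in> irr_le n. degree f = d}. 2 * real (degree f) * ((1 / p ^ degree f) ^ 2 / (1 - 1 / p ^ degree f)))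
        \<le> 2 * p / (p - 1) * (1 / p) ^ d" .
  qed
  also have "\<dots> = 2 * p / (p - 1) * (\<Sum>d=1..n. (1 / p) ^ d)" by (simp add: sum_distrib_left)
  also have "\<dots> \<le> 2 * p / (p - 1) * (1 / (p - 1))"
  proof (intro mult_left_mono)
    define x where "x = 1 / p"
    have px: "p * x ^ Suc n = x ^ n" for n using p by (simp add: x_def)
    have "(\<Sum>d=1..n. x ^ d) * (p - 1) + x ^ n = 1"
    proof (induction n)
      case (Suc n)
      have "(\<Sum>d=1..Suc n. x ^ d) = (\<Sum>d=1..n. x ^ d) + x ^ Suc n" by simp
      moreover have "(a + b) * (p - 1) + b = a * (p - 1) + p * b" for a b by (simp add: algebra_simps)
      ultimately show ?case using Suc.IH px[of n] by (simp only:)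
    qed simp
    hence "(\<Sum>d=1..n. (1 / p) ^ d) * (p - 1) + (1 / p) ^ n = 1" unfolding x_def .
    moreover have "(1 / p) ^ n \<ge> 0" using p by simp
    ultimately have "(\<Sum>d=1..n. (1 / p) ^ d) * (p - 1) \<le> 1" by linarith
    thus "(\<Sum>d=1..n. (1 / p) ^ d) \<le> 1 / (p - 1)" using p by (simp add: pos_le_divide_eq)
  qed (use p in auto)
  also have "\<dots> = 2 * p / (p - 1) ^ 2" by (simp add: power2_eq_square)
  finally show ?thesis unfolding p_def .
qed

text \<open>The witness is f = X with m = 2, available from n = 2 on. Monotonicity later carries
  positivity to the limit.\<close>

lemma fin_part_2_pos: "fin_part 2 > 0"
proof -
  define p where "p = real CARD('p)"
  have p: "p \<ge> 2" unfolding p_def by (rule card_prime_ge_2)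
  let ?X = "[:0, 1:] :: 'p mod_ring poly"
  have X: "?X \<in> monic_irreducibles" "degree ?X = 1"
    using irreducible_linear_field_poly[of 1 "0 :: 'p mod_ring"] by (simp_all add: monic_irreducibles_def)
  have "ennreal (1 / p ^ 2) \<le> ennreal (afin ?X 2)" using cfin_X_2_pos unfolding ennreal_afin[OF X(1)] p_def .
  hence "1 / p ^ 2 \<le> afin ?X 2" by (subst (asm) ennreal_le_iff) (auto simp: afin_nonneg)
  moreover have "1 / p ^ 2 > 0" using p by simp
  ultimately have a: "afin ?X 2 > 0" by linarith
  have "mult_weight p 1 2 2 = 1 / p ^ 2 - 1 / p ^ 3" by (simp add: mult_weight_def eval_nat_numeral)
  moreover have "1 / p ^ 3 < 1 / p ^ 2" using p by (intro divide_strict_left_mono power_strict_increasing) auto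
  ultimately have w: "mult_weight p 1 2 2 > 0" by simp
  have p1: "p \<ge> 1" using p by simp
  note nn = mult_nonneg_nonneg[OF afin_nonneg mult_weight_nonneg[OF p1]]
  have "0 < afin ?X 2 * mult_weight p (degree ?X) 2 2" using a w by (simp add: X(2))
  also have "\<dots> \<le> (\<Sum>m=1..2. afin ?X m * mult_weight p (degree ?X) 2 m)"
    by (rule member_le_sum) (auto intro: nn)
  also have "\<dots> \<le> fin_part 2" unfolding fin_part_def p_def[symmetric]
    using X by (intro member_le_sum[where f = "\<lambda>f. \<Sum>m=1..2. afin f m * mult_weight p (degree f) 2 m"] finite_irr_le)
      (auto intro!: sum_nonneg nn)
  finally show ?thesis .
qed

lemma expected_roots_limit:
  "\<exists>L :: real. (\<lambda>n. expected_roots \<mu> (- padic_unramified) n) \<longlonglongrightarrow> ennreal L \<and>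
    0 < L \<and> L \<le> (4 * real CARD('p) - 3) / (real CARD('p) - 1) ^ 2"
proof -
  define p where "p = real CARD('p)"
  have p: "p \<ge> 2" unfolding p_def by (rule card_prime_ge_2)
  define S where "S = (\<lambda>n. fin_part n + inf_part n)"
  define B where "B = (4 * p - 3) / (p - 1) ^ 2"
  have inc: "incseq S" unfolding S_def by (intro incseq_SucI add_mono fin_part_mono inf_part_mono) simp_all
  have bound: "S n \<le> B" for n
  proof -
    have "S n \<le> 2 * p / (p - 1) ^ 2 + 2 / (p * (p - 1))"
      unfolding S_def p_def by (rule add_mono[OF fin_part_le inf_part_le])
    also have "2 / (p * (p - 1)) = (2 * (p - 1) / p) / (p - 1) ^ 2"
    proof -
      have "2 / (p * c) = (2 * c / p) / c ^ 2" if "c \<noteq> 0" for c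
        using that by (simp add: power2_eq_square)
      from this[of "p - 1"] show ?thesis using p by linarith
    qed
    also have "2 * p / (p - 1) ^ 2 + (2 * (p - 1) / p) / (p - 1) ^ 2 = (2 * p + 2 * (p - 1) / p) / (p - 1) ^ 2"
      by (simp add: add_divide_distrib)
    also have "\<dots> \<le> B"
    proof -
      \<comment> \<open>The required 2p + 2(p-1)/p \<le> 4p - 3 becomes this inequality after
        multiplication by p; at p = 2 it is an equality.\<close>
      have "0 \<le> (2 * p - 1) * (p - 2)" using p by simp
      hence "2 * (p - 1) \<le> (2 * p - 3) * p" by (simp add: algebra_simps)
      hence "2 * (p - 1) / p \<le> 2 * p - 3" using p by (simp add: pos_divide_le_eq)
      thus ?thesis unfolding B_def by (intro divide_right_mono) auto
    qed
    finally show ?thesis .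
  qed
  obtain L where L: "S \<longlonglongrightarrow> L" "\<And>n. S n \<le> L" using incseq_convergent[OF inc] bound by metis
  have "L \<le> B" using L(1) bound by (intro LIMSEQ_le_const2) auto
  have "inf_part 2 \<ge> inf_part 0" by (rule inf_part_mono) simp
  moreover have "inf_part 0 \<ge> 0" using p by (simp add: inf_part_def p_def ainf_nonneg)
  ultimately have "S 2 > 0" using fin_part_2_pos by (simp add: S_def)
  hence "L > 0" using L(2)[of 2] by linarith
  \<comment> \<open>The factor coming from h = 0 decreases with n while \<open>S\<close> increases,
    so monotone convergence is applied to \<open>S\<close> alone, and the factor tends to 1.\<close>
  have "(\<lambda>n. S n / (1 - (1 / p) ^ Suc n)) \<longlonglongrightarrow> L / (1 - 0)"
    using p by (intro tendsto_divide L(1) tendsto_diff tendsto_const LIMSEQ_Suc[OF LIMSEQ_power_zero]) auto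
  hence "(\<lambda>n. ennreal (S n / (1 - (1 / p) ^ Suc n))) \<longlonglongrightarrow> ennreal L" by (intro tendsto_ennrealI) simp
  moreover have "ennreal (S n / (1 - (1 / p) ^ Suc n)) = expected_roots \<mu> (- padic_unramified) n" for n
    unfolding expected_roots_eq expZ_real S_def p_def power_one_over ..
  ultimately have "(\<lambda>n. expected_roots \<mu> (- padic_unramified) n) \<longlonglongrightarrow> ennreal L" by simp
  thus ?thesis using \<open>L > 0\<close> \<open>L \<le> B\<close> unfolding B_def p_def by blast
qed

end

theorem theorem1p6:
  fixes \<mu> :: "'p :: prime_card padic_int measure"
  assumes "haar_probability \<mu>"
  shows "\<exists>L :: real.
    (\<lambda>n. expected_roots \<mu> (- padic_unramified) n) \<longlonglongrightarrow> ennreal L \<and>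
    0 < L \<and> L \<le> (4 * real CARD('p) - 3) / (real CARD('p) - 1) ^ 2"
proof -
  interpret padic_haar \<mu> by unfold_locales (rule assms)
  show ?thesis by (rule expected_roots_limit)
qed

end
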